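(* Let $\mathbb{C}_n$ be the Clifford algebra over the field $\mathbb{F}=\mathbb{C}$ and let $\mathsf{Ext}(\mathbb{C}_n)=\{\mathsf{I},\mathsf{W},\mathsf{E},\mathsf{C},\Pi,\mathsf{K},\mathsf{S},\mathsf{F}\}$ be an extended automorphism group of $\mathbb{C}_n$, where $\mathsf{W},\mathsf{E},\mathsf{C},\Pi,\mathsf{K},\mathsf{S},\mathsf{F}$ are spinor representations of the transformations $\mathcal{A}\to\mathcal{A}^\star$, $\mathcal{A}\to\widetilde{\mathcal{A}}$, $\mathcal{A}\to\widetilde{\mathcal{A}^\star}$, $\mathcal{A}\to\overline{\mathcal{A}}$, $\mathcal{A}\to\overline{\mathcal{A}^\star}$, $\mathcal{A}\to\overline{\widetilde{\mathcal{A}}}$, $\mathcal{A}\to\overline{\widetilde{\mathcal{A}^\star}}$. Then over $\mathbb{F}=\mathbb{C}$, depending on the division ring structure of the real subalgebras $C\ell_{p,q}\subset\mathbb{C}_n$, there exist the following isomorphisms between finite groups and groups $\mathsf{Ext}(\mathbb{C}_n)$: 1) $\mathbb{K}\simeq\mathbb{R}$, types $p-q\equiv 0,2\pmod 8$. The matrix $\Pi$ of the pseudoautomorphism $\mathcal{A}\to\overline{\mathcal{A}}$ is proportional to the unit matrix (identical transformation) and the extended automorphism group $\mathsf{Ext}(\mathbb{C}_n)$ is reduced to the group of fundamental automorphisms $\mathsf{Aut}_\pm(\mathbb{C}_n)$. 2) $\mathbb{K}\simeq\mathbb{H}$, types $p-q\equiv 4,6\pmod 8$. Depending on the spinbasis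 structure of the subalgebra $C\ell_{p,q}$ there exist the following group isomorphisms. (i) If $m,v,l,u\equiv 0\pmod 2$, for the type $p-q\equiv 4\pmod 8$: $\mathsf{Ext}_-(\mathbb{C}_n)\simeq\mathbb{Z}_2\otimes\mathbb{Z}_2\otimes\mathbb{Z}_2$ with the signature $(+,+,+,+,+,+,+)$ and $\mathsf{Ext}(\mathbb{C}_n)\simeq\mathbb{Z}_4\otimes\mathbb{Z}_2$ with $(+,+,+,-,-,-,-)$. Here $m$ and $l$ are the numbers of complex skewsymmetric and complex symmetric matrices, and $u$ and $v$ the numbers of real skewsymmetric and real symmetric matrices of the spinbasis of $C\ell_{p,q}$. Correspondingly, at $m,v,l,u\equiv 0\pmod 2$ there exist Abelian groups $\mathsf{Ext}_-(\mathbb{C}_n)\simeq\mathbb{Z}_4\otimes\mathbb{Z}_2$ with $(+,-,-,d,e,f,g)$ for the type $p-q\equiv 4\pmod 8$ and $\mathsf{Ext}_-(\mathbb{C}_n)\simeq\mathbb{Z}_4\otimes\mathbb{Z}_2$ with $(-,+,-,d,e,f,g)$, $(-,-,+,d,e,f,g)$ for the type $p-q\equiv 6\pmod 8$, where among the symbols $d,e,f,g$ there are two pluses and two minuses. (ii) If $m,v,l,u\equiv 1\pmod 2$, or if among $m,v,l,u$ there are both even and odd numbers, then there exists the non-Abelian group $\mathsf{Ext}_+(\mathbb{C}_n)\simeq Q_4$ with the signatures $(-,-,-,d,e,f,g)$ for the type $p-q\equiv 6\pmod 8$, where among $d,e,f,g$ there are one plus and three minuses. Also there exist $\mathsf{Ext}_+(\mathbb{C}_n)\simeq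 D_4$ with $(+,-,+,d,e,f,g)$, $(+,+,-,d,e,f,g)$ for the type $p-q\equiv 4\pmod 8$ and $\mathsf{Ext}_+(\mathbb{C}_n)\simeq D_4$ with $(-,+,+,d,e,f,g)$ for the type $p-q\equiv 6\pmod 8$, where among $d,e,f,g$ there are three pluses and one minus. Besides, there exist the groups $\mathsf{Ext}_+(\mathbb{C}_n)\simeq Q_4$ with the signatures $(+,-,-,-,-,-,-)$ for $p-q\equiv 4\pmod 8$ and $(-,+,-,-,-,-,-)$, $(-,-,+,-,-,-,-)$ for $p-q\equiv 6\pmod 8$. Also there exist the groups $\mathsf{Ext}_+(\mathbb{C}_n)\simeq D_4$ with $(+,+,+,d,e,f,g)$, $(+,-,-,+,+,+,+)$ for the type $p-q\equiv 4\pmod 8$ and $(a,b,c,+,+,+,+)$ for the type $p-q\equiv 6\pmod 8$ (among $a,b,c$ there are one plus and two minuses, and among $d,e,f,g$ two pluses and two minuses). There exists the non-Abelian group $\mathsf{Ext}_+(\mathbb{C}_n)\simeq\overset{\ast}{\mathbb{Z}}_4\otimes\mathbb{Z}_2$ with the signatures $(+,-,-,d,e,f,g)$ for the type $p-q\equiv 4\pmod 8$ and $(-,+,-,d,e,f,g)$, $(-,-,+,d,e,f,g)$ for the type $p-q\equiv 6\pmod 8$, where among $d,e,f,g$ there are two pluses and two minuses. Also there exist $\mathsf{Ext}_+(\mathbb{C}_n)\simeq\overset{\ast}{\mathbb{Z}}_4\otimes\mathbb{Z}_2$ with $(+,-,+,d,e,f,g)$, $(+,+,-,d,e,f,g)$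 for $p-q\equiv 4\pmod 8$ and $(-,+,+,d,e,f,g)$ for $p-q\equiv 6\pmod 8$, where among $d,e,f,g$ there are one plus and three minuses. Finally, for the type $p-q\equiv 6\pmod 8$ there exists $\mathsf{Ext}_+(\mathbb{C}_n)\simeq\overset{\ast}{\mathbb{Z}}_4\otimes\mathbb{Z}_2$ with $(-,-,-,d,e,f,g)$, where among $d,e,f,g$ there are three pluses and one minus. The full number of the different signatures $(a,b,c,d,e,f,g)$ is equal to 64.
   Context: Clifford algebras: $C\ell_{p,q}$ is the real Clifford algebra with anticommuting generators $\mathbf{e}_i$, $\mathbf{e}_i^2=+1$ for $i\le p$, $-1$ for $p<i\le p+q$; $\mathbb{C}_n=\mathbb{C}\otimes C\ell_{p,q}$ for $n=p+q$ (here even), so $C\ell_{p,q}\subset\mathbb{C}_n\simeq\mathsf{M}_{2^{n/2}}(\mathbb{C})$. $\mathbb{K}=fC\ell_{p,q}f$ with $f$ a primitive idempotent. Transformations: $\star$ is the automorphism with $\mathbf{e}_i\to-\mathbf{e}_i$; $\widetilde{\phantom{cc}}$ is the antiautomorphism with $\mathbf{e}_i\to\mathbf{e}_i$; $\overline{\phantom{cc}}$ is $\mathcal{A}_1+i\mathcal{A}_2\mapsto\mathcal{A}_1-i\mathcal{A}_2$ ($\mathcal{A}_j\in C\ell_{p,q}$); the others are compositions of these. Spinor representations: $\mathcal{E}_i$ ($i=1,\dots,p+q$) are the matrices of the generators of $C\ell_{p,q}$ (spinbasis). For $\mathbb{K}\simeq\mathbb{R}$ they are real. In general each $\mathcal{E}_i$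 is real ($\dot{\mathcal{E}}_i=\mathcal{E}_i$, dot = entrywise complex conjugation) or complex ($\dot{\mathcal{E}}_i=-\mathcal{E}_i$), and symmetric or skewsymmetric. The matrices are defined by $\mathsf{A}^\star=\mathsf{W}\mathsf{A}\mathsf{W}^{-1}$, $\widetilde{\mathsf{A}}=\mathsf{E}\mathsf{A}^{T}\mathsf{E}^{-1}$, $\widetilde{\mathsf{A}^\star}=\mathsf{C}\mathsf{A}^{T}\mathsf{C}^{-1}$, $\overline{\mathsf{A}}=\Pi\dot{\mathsf{A}}\Pi^{-1}$, $\overline{\mathsf{A}^\star}=\mathsf{K}\dot{\mathsf{A}}\mathsf{K}^{-1}$, $\overline{\widetilde{\mathsf{A}}}=\mathsf{S}\dot{\mathsf{A}}^{T}\mathsf{S}^{-1}$, $\overline{\widetilde{\mathsf{A}^\star}}=\mathsf{F}\dot{\mathsf{A}}^{T}\mathsf{F}^{-1}$, and are taken as products of spinbasis matrices (up to sign): $\mathsf{W}=\mathcal{E}_1\mathcal{E}_2\cdots\mathcal{E}_{p+q}$, $\mathsf{C}=\mathsf{E}\mathsf{W}$, $\mathsf{K}=\Pi\mathsf{W}$, $\mathsf{S}=\Pi\mathsf{E}$, $\mathsf{F}=\Pi\mathsf{C}$. For $\mathbb{K}\simeq\mathbb{H}$: $\Pi$ is the product of all complex spinbasis matrices if their number is even, and the product of all real ones if the number of real ones is odd; $\mathsf{E}$ is the product of all skewsymmetric spinbasis matrices if their number $k$ is even, and the product of all symmetric ones if $k$ is odd. Signature: $(a,b,c,d,e,f,g)$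 are the signs of $\mathsf{W}^2,\mathsf{E}^2,\mathsf{C}^2,\Pi^2,\mathsf{K}^2,\mathsf{S}^2,\mathsf{F}^2$ (each square is $\pm\mathsf{I}$). $\mathsf{Aut}_\pm=\{\mathsf{I},\mathsf{W},\mathsf{E},\mathsf{C}\}$; the subscript $-$ (on $\mathsf{Aut}$ or $\mathsf{Ext}$) means all elements commute (Abelian case), the subscript $+$ marks the non-Abelian case (some elements anticommute). Convention for the "isomorphisms": products of elements are identified up to sign with elements of the set, and the finite groups are identified by commutativity and by "order structure", i.e. the number of elements of order 2 (square $+\mathsf{I}$) and of order 4 (square $-\mathsf{I}$) among the seven non-identity elements: $\mathbb{Z}_2\otimes\mathbb{Z}_2\otimes\mathbb{Z}_2$: Abelian, seven $+$; $\mathbb{Z}_4\otimes\mathbb{Z}_2$: Abelian, three $+$ and four $-$; $D_4$ (dihedral): non-Abelian, five $+$ and two $-$; $Q_4$ (quaternion): non-Abelian, one $+$ and six $-$; $\overset{\ast}{\mathbb{Z}}_4\otimes\mathbb{Z}_2$: the paper's symbol for the non-Abelian type with three $+$ and four $-$. The "full number of different signatures" counts all sign patterns $(a,b,c,d,e,f,g)\in\{+,-\}^7$ of one of the types (seven $+$), (five $+$, two $-$), (three $+$, four $-$), (one $+$, six $-$). $\otimes$ denotes direct product of groups.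
   Formalization: For K≃H, Π²=−I always, so existence is not claimed for (+,+,+,+,+,+,+), (+,−,−,+,+,+,+) or (a,b,c,+,+,+,+). For every other listed family with unspecified d,e,f,g, at least one signature of that shape is shown to occur, not each one. *)

theory Defs
  imports Complex_Main
    "HOL-Algebra.QuotRing"
    "HOL-Algebra.Multiplicative_Group"
    "HOL-Algebra.Elementary_Groups"
    "Jordan_Normal_Form.Matrix"
begin

section \<open>Clifford algebras\<close>

text \<open>An element of the complexification of the real Clifford algebra with signature (p,q) is the
  family of its coefficients on the basis monomials. The monomial of a finite set
  S = {i1 < ... < ik} of indices in {1..p+q} is the product of the generators with indices
  i1, ..., ik in this order.\<close>

type_synonym cliff = "nat set \<Rightarrow> complex"

text \<open>(monomial of S) (monomial of T) = sign * (monomial of the symmetric difference): one factor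
  -1 for each transposition needed to sort the product, and one for each repeated generator of
  square -1.\<close>

definition mono_sign :: "nat \<Rightarrow> nat set \<Rightarrow> nat set \<Rightarrow> complex" where
  "mono_sign p S T =
     (-1) ^ card {(i, j). i \<in> S \<and> j \<in> T \<and> j < i} * (-1) ^ card {i \<in> S \<inter> T. p < i}"

definition clifford :: "nat \<Rightarrow> nat \<Rightarrow> cliff ring" where
  "clifford p q = \<lparr>
     carrier = {a. \<forall>S. \<not> S \<subseteq> {1..p+q} \<longrightarrow> a S = 0},
     monoid.mult = (\<lambda>a b U. \<Sum>S\<in>Pow {1..p+q}. \<Sum>T\<in>Pow {1..p+q}.
               if sym_diff S T = U then mono_sign p S T * a S * b T else 0),
     one = (\<lambda>S. if S = {} then 1 else 0),
     zero = (\<lambda>S. 0),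
     add = (\<lambda>a b S. a S + b S) \<rparr>"

definition real_clifford :: "nat \<Rightarrow> nat \<Rightarrow> cliff ring" where
  "real_clifford p q = (clifford p q)\<lparr>carrier := {a \<in> carrier (clifford p q). \<forall>S. a S \<in> \<real>}\<rparr>"

definition scale :: "complex \<Rightarrow> cliff \<Rightarrow> cliff" where
  "scale c a = (\<lambda>S. c * a S)"

definition monomial :: "nat set \<Rightarrow> cliff" where
  "monomial S = (\<lambda>T. if T = S then 1 else 0)"

definition gen :: "nat \<Rightarrow> cliff" where
  "gen i = monomial {i}"

text \<open>The automorphism with e_i to -e_i, the antiautomorphism with e_i to e_i, and the
  conjugation with respect to the real subalgebra; reversing a product of k anticommuting
  generators takes k choose 2 transpositions.\<close>

definition star :: "cliff \<Rightarrow> cliff" where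
  "star a = (\<lambda>S. (-1) ^ card S * a S)"

definition tilde :: "cliff \<Rightarrow> cliff" where
  "tilde a = (\<lambda>S. (-1) ^ (card S choose 2) * a S)"

definition bar :: "cliff \<Rightarrow> cliff" where
  "bar a = (\<lambda>S. cnj (a S))"

lemma finite_index_set: "S \<subseteq> {1..n::nat} \<Longrightarrow> finite S"
  by (rule finite_subset) auto

lemma card_inversions:
  assumes "finite S" "finite T"
  shows "card {(i, j). i \<in> S \<and> j \<in> T \<and> j < i} + card {(i, j). i \<in> T \<and> j \<in> S \<and> j < i}
     + card (S \<inter> T) = card S * card (T :: nat set)"
proof -
  let ?A = "{(i, j). i \<in> S \<and> j \<in> T \<and> j < i}" and ?B = "{(i, j). i \<in> S \<and> j \<in> T \<and> i < j}"
    and ?D = "{(i, j). i \<in> S \<and> j \<in> T \<and> i = j}"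
  have f: "finite ?A" "finite ?B" "finite ?D"
    by (rule finite_subset[OF _ finite_cartesian_product[OF assms]]; auto)+
  have "{(i, j). i \<in> T \<and> j \<in> S \<and> j < i} = prod.swap ` ?B" by auto
  then have b: "card {(i, j). i \<in> T \<and> j \<in> S \<and> j < i} = card ?B"
    by (simp add: card_image)
  have "?D = (\<lambda>i. (i, i)) ` (S \<inter> T)" by auto
  then have d: "card ?D = card (S \<inter> T)"
    by (simp add: card_image inj_on_def)
  have "S \<times> T = (?A \<union> ?B) \<union> ?D" by auto
  then have "card (S \<times> T) = card ((?A \<union> ?B) \<union> ?D)" by (rule arg_cong)
  also have "\<dots> = card (?A \<union> ?B) + card ?D" using f by (intro card_Un_disjoint) auto
  also have "card (?A \<union> ?B) = card ?A + card ?B" using f by (intro card_Un_disjoint) auto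
  finally show ?thesis using b d assms by (simp add: card_cartesian_product)
qed

lemma card_sym_diff_nat:
  assumes "finite S" "finite T"
  shows "card (sym_diff S T) + 2 * card (S \<inter> T) = card S + card T"
proof -
  have 1: "card (sym_diff S T) = card (S - T) + card (T - S)"
    using assms by (intro card_Un_disjoint) auto
  have 2: "card S = card (S \<inter> T) + card (S - T)"
    using assms(1) by (rule card_Int_Diff)
  have 3: "card T = card (T \<inter> S) + card (T - S)"
    using assms(2) by (rule card_Int_Diff)
  have 4: "card (T \<inter> S) = card (S \<inter> T)" by (simp only: Int_commute)
  show ?thesis using 1 2 3 4 by linarith
qed

lemma choose2_add: "(s + t) choose 2 = (s choose 2) + (t choose 2) + s * (t::nat)"
proof (induction t)
  case (Suc t)
  have "(s + Suc t) choose 2 = ((s + t) choose 1) + ((s + t) choose 2)"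
    by (simp add: numeral_2_eq_2)
  moreover have "Suc t choose 2 = (t choose 1) + (t choose 2)" by (simp add: numeral_2_eq_2)
  ultimately show ?case using Suc by (simp)
qed simp

lemma choose2_double: "even (((2 * c) choose 2) + (c::nat))"
proof (induction c)
  case (Suc c)
  have "2 * Suc c choose 2 = (2 * c + 2) choose 2" by simp
  also have "\<dots> = ((2*c) choose 2) + (2 choose 2) + 2 * c * 2" by (rule choose2_add)
  finally show ?case using Suc by simp
qed (simp add: numeral_2_eq_2)

lemma tilde_sign:
  assumes S: "finite S" "finite T"
  shows "(-1) ^ (card (sym_diff S T) choose 2) * mono_sign p S T =
         mono_sign p T S * (-1) ^ (card S choose 2) * (-1) ^ (card T choose 2)"
proof -
  define d c s t where "d = card (sym_diff S T)" "c = card (S \<inter> T)" "s = card S" "t = card T"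
  define x y where "x = card {(i, j). i \<in> S \<and> j \<in> T \<and> j < i}"
     "y = card {(i, j). i \<in> T \<and> j \<in> S \<and> j < i}"
  have a: "d + 2 * c = s + t" using card_sym_diff_nat[OF S] by (simp add: d_c_s_t_def)
  have b: "x + y + c = s * t" using card_inversions[OF S] by (simp add: d_c_s_t_def x_y_def)
  have "(d choose 2) + ((2*c) choose 2) + d * (2*c) = (s choose 2) + (t choose 2) + s * t"
    using choose2_add[of d "2*c"] choose2_add[of s t] a by simp
  then have "(d choose 2) + ((2*c) choose 2) + 2 * (d * c) = (s choose 2) + (t choose 2) + (x + y + c)"
    using b by simp
  moreover obtain k where "((2*c) choose 2) + c = 2 * k"
    using choose2_double[of c] by (rule evenE)
  ultimately have "even ((d choose 2) + x) = even (y + (s choose 2) + (t choose 2))"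
    by presburger
  then have "(-1) ^ ((d choose 2) + x) = (-1 :: complex) ^ (y + (s choose 2) + (t choose 2))"
    by (simp only: minus_one_power_iff)
  then have "(-1) ^ (d choose 2) * (-1) ^ x * w = (-1) ^ y * w * (-1) ^ (s choose 2) * (-1) ^ (t choose 2)"
    for w :: complex
    by (simp add: power_add)
  moreover have "T \<inter> S = S \<inter> T" by (rule Int_commute)
  ultimately show ?thesis
    unfolding mono_sign_def d_c_s_t_def x_y_def by (simp only: mult.assoc)
qed

lemma star_mult:
  assumes "a \<in> carrier (clifford p q)" "b \<in> carrier (clifford p q)"
  shows "star (a \<otimes>\<^bsub>clifford p q\<^esub> b) = star a \<otimes>\<^bsub>clifford p q\<^esub> star b"
proof
  fix U
  have e: "(-1) ^ card (sym_diff S T) = ((-1) ^ card S * (-1) ^ card T :: complex)"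
    if "S \<subseteq> {1..p+q}" "T \<subseteq> {1..p+q}" for S T
  proof -
    have "card (sym_diff S T) + 2 * card (S \<inter> T) = card S + card T"
      using that by (intro card_sym_diff_nat finite_index_set)
    then have "(-1) ^ (card (sym_diff S T) + 2 * card (S \<inter> T)) = ((-1) ^ (card S + card T) :: complex)"
      by simp
    then show ?thesis by (simp add: power_add power_mult)
  qed
  show "star (a \<otimes>\<^bsub>clifford p q\<^esub> b) U = (star a \<otimes>\<^bsub>clifford p q\<^esub> star b) U"
    unfolding star_def clifford_def
    by (simp add: sum_distrib_left) (intro sum.cong refl, auto simp: e)
qed

lemma tilde_mult:
  assumes "a \<in> carrier (clifford p q)" "b \<in> carrier (clifford p q)"
  shows "tilde (a \<otimes>\<^bsub>clifford p q\<^esub> b) = tilde b \<otimes>\<^bsub>clifford p q\<^esub> tilde a"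
proof
  fix U
  let ?P = "Pow {1..p+q}"
  have c: "((-1) ^ (card U choose 2)) * (if sym_diff S T = U then mono_sign p S T * a S * b T else 0)
     = (if sym_diff T S = U then mono_sign p T S * ((-1) ^ (card T choose 2) * b T) * ((-1) ^ (card S choose 2) * a S) else 0)"
    if "S \<in> ?P" "T \<in> ?P" for S T
  proof (cases "sym_diff S T = U")
    case True
    have "(-1) ^ (card U choose 2) * mono_sign p S T =
         mono_sign p T S * (-1) ^ (card S choose 2) * (-1) ^ (card T choose 2)"
      using tilde_sign[of S T p] that True finite_index_set unfolding Pow_iff by blast
    then have "((-1) ^ (card U choose 2) * mono_sign p S T) * (a S * b T) =
       (mono_sign p T S * (-1) ^ (card S choose 2) * (-1) ^ (card T choose 2)) * (a S * b T)" by simp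
    moreover have "sym_diff T S = sym_diff S T" by (rule Un_commute)
    ultimately show ?thesis using True by (simp only: if_True simp_thms mult_ac)
  next
    case False
    moreover have "sym_diff T S = sym_diff S T" by (rule Un_commute)
    ultimately show ?thesis by (simp only: if_False mult_zero_right)
  qed
  have "tilde (a \<otimes>\<^bsub>clifford p q\<^esub> b) U = (\<Sum>S\<in>?P. \<Sum>T\<in>?P. ((-1) ^ (card U choose 2)) *
      (if sym_diff S T = U then mono_sign p S T * a S * b T else 0))"
    unfolding tilde_def clifford_def by (simp add: sum_distrib_left)
  also have "\<dots> = (\<Sum>S\<in>?P. \<Sum>T\<in>?P. (if sym_diff T S = U then mono_sign p T S *
      ((-1) ^ (card T choose 2) * b T) * ((-1) ^ (card S choose 2) * a S) else 0))"
    by (intro sum.cong refl c)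
  also have "\<dots> = (tilde b \<otimes>\<^bsub>clifford p q\<^esub> tilde a) U"
    by (subst sum.swap) (simp add: tilde_def clifford_def)
  finally show "tilde (a \<otimes>\<^bsub>clifford p q\<^esub> b) U = (tilde b \<otimes>\<^bsub>clifford p q\<^esub> tilde a) U" .
qed

lemma star_gen: "star (gen i) = scale (-1) (gen i)"
  by (auto simp: star_def gen_def monomial_def scale_def)

lemma tilde_gen: "tilde (gen i) = gen i"
  by (rule ext) (simp add: tilde_def gen_def monomial_def numeral_2_eq_2)

lemma monomial_mult:
  assumes "S \<subseteq> {1..p+q}" "T \<subseteq> {1..p+q}"
  shows "monomial S \<otimes>\<^bsub>clifford p q\<^esub> monomial T = scale (mono_sign p S T) (monomial (sym_diff S T))"
proof
  fix U
  have "(monomial S \<otimes>\<^bsub>clifford p q\<^esub> monomial T) U =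
     (\<Sum>A\<in>Pow {1..p+q}. if A = S then (\<Sum>B\<in>Pow {1..p+q}. if B = T then
         (if sym_diff A B = U then mono_sign p A B else 0) else 0) else 0)"
  proof -
    have "(monomial S \<otimes>\<^bsub>clifford p q\<^esub> monomial T) U =
      (\<Sum>A\<in>Pow {1..p+q}. \<Sum>B\<in>Pow {1..p+q}. if A = S then if B = T then
         (if sym_diff A B = U then mono_sign p A B else 0) else 0 else 0)"
      unfolding clifford_def monomial_def monoid.simps
    proof (intro sum.cong refl)
      show "(if sym_diff A B = U then mono_sign p A B * (if A = S then 1 else 0) * (if B = T then 1 else 0) else 0)
        = (if A = S then if B = T then (if sym_diff A B = U then mono_sign p A B else 0) else 0 else 0)" for A B
        by (cases "A = S"; cases "B = T")
          (simp_all only: if_True if_False mult_1_right mult_zero_right mult_zero_left if_cancel simp_thms)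
    qed
    also have "\<dots> = (\<Sum>A\<in>Pow {1..p+q}. if A = S then (\<Sum>B\<in>Pow {1..p+q}. if B = T then
         (if sym_diff A B = U then mono_sign p A B else 0) else 0) else 0)"
    proof (rule sum.cong[OF refl])
      show "(\<Sum>B\<in>Pow {1..p+q}. if A = S then if B = T then
           (if sym_diff A B = U then mono_sign p A B else 0) else 0 else 0) =
         (if A = S then (\<Sum>B\<in>Pow {1..p+q}. if B = T then
           (if sym_diff A B = U then mono_sign p A B else 0) else 0) else 0)" for A
        by (cases "A = S") (simp_all only: if_True if_False sum.neutral_const simp_thms)
    qed
    finally show ?thesis .
  qed
  also have "\<dots> = (if sym_diff S T = U then mono_sign p S T else 0)"
    using assms by (simp only: sum.delta finite_Pow_iff finite_atLeastAtMost Pow_iff if_True)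
  finally show "(monomial S \<otimes>\<^bsub>clifford p q\<^esub> monomial T) U = scale (mono_sign p S T) (monomial (sym_diff S T)) U"
    by (auto simp: scale_def monomial_def)
qed

lemma gen_square:
  assumes "i \<in> {1..p+q}"
  shows "gen i \<otimes>\<^bsub>clifford p q\<^esub> gen i = scale (if i \<le> p then 1 else -1) \<one>\<^bsub>clifford p q\<^esub>"
proof -
  have 1: "{(k, l). k \<in> {i} \<and> l \<in> {i} \<and> l < k} = {}" by auto
  have 2: "{j \<in> {i} \<inter> {i}. p < j} = (if p < i then {i} else {})" by auto
  have "mono_sign p {i} {i} = (if i \<le> p then 1 else -1)"
    unfolding mono_sign_def 1 2 by simp
  moreover have "\<one>\<^bsub>clifford p q\<^esub> = monomial {}"
    by (simp add: clifford_def monomial_def)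
  ultimately show ?thesis using assms
    by (simp add: gen_def monomial_mult)
qed

lemma gen_anticommute:
  assumes "i \<in> {1..p+q}" "j \<in> {1..p+q}" "i \<noteq> j"
  shows "gen i \<otimes>\<^bsub>clifford p q\<^esub> gen j = scale (-1) (gen j \<otimes>\<^bsub>clifford p q\<^esub> gen i)"
proof -
  have "{(k, l). k = i \<and> l = j \<and> l < k} = (if j < i then {(i, j)} else {})"
       "{(k, l). k = j \<and> l = i \<and> l < k} = (if i < j then {(j, i)} else {})" by auto
  then have "mono_sign p {i} {j} = - mono_sign p {j} {i}"
    using assms(3) by (auto simp: mono_sign_def)
  moreover have "sym_diff {j} {i} = sym_diff {i} {j}" by (rule Un_commute)
  ultimately show ?thesis using assms(1,2)
    by (simp add: gen_def monomial_mult scale_def)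
qed

subsection \<open>The division ring of a real Clifford algebra\<close>

definition idempotent :: "('a, 'b) ring_scheme \<Rightarrow> 'a \<Rightarrow> bool" where
  "idempotent R f \<longleftrightarrow> f \<in> carrier R \<and> f \<otimes>\<^bsub>R\<^esub> f = f"

definition primitive_idempotent :: "('a, 'b) ring_scheme \<Rightarrow> 'a \<Rightarrow> bool" where
  "primitive_idempotent R f \<longleftrightarrow>
     idempotent R f \<and> f \<noteq> \<zero>\<^bsub>R\<^esub> \<and>
     (\<forall>g h. idempotent R g \<and> idempotent R h \<and>
        g \<otimes>\<^bsub>R\<^esub> h = \<zero>\<^bsub>R\<^esub> \<and> h \<otimes>\<^bsub>R\<^esub> g = \<zero>\<^bsub>R\<^esub> \<and> f = g \<oplus>\<^bsub>R\<^esub> h \<longrightarrow>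
        g = \<zero>\<^bsub>R\<^esub> \<or> h = \<zero>\<^bsub>R\<^esub>)"

definition corner :: "'a ring \<Rightarrow> 'a \<Rightarrow> 'a ring" where
  "corner R f = R\<lparr>carrier := {f \<otimes>\<^bsub>R\<^esub> x \<otimes>\<^bsub>R\<^esub> f |x. x \<in> carrier R}, one := f\<rparr>"

definition real_ring :: "real ring" where
  "real_ring = \<lparr>carrier = UNIV, monoid.mult = (*), one = 1, zero = 0, add = (+)\<rparr>"

text \<open>The pair (a, b) is the quaternion a + b j.\<close>

definition quaternion_ring :: "(complex \<times> complex) ring" where
  "quaternion_ring = \<lparr>carrier = UNIV,
     monoid.mult = (\<lambda>(a, b) (c, d). (a * c - b * cnj d, a * d + b * cnj c)),
     one = (1, 0), zero = (0, 0), add = (\<lambda>(a, b) (c, d). (a + c, b + d))\<rparr>"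

text \<open>The isomorphism type of the corner ring does not depend on the primitive idempotent.\<close>

definition has_division_ring :: "nat \<Rightarrow> nat \<Rightarrow> 'a ring \<Rightarrow> bool" where
  "has_division_ring p q D \<longleftrightarrow>
     (\<exists>f. primitive_idempotent (real_clifford p q) f \<and> corner (real_clifford p q) f \<simeq> D)"

section \<open>Spinor representations\<close>

abbreviation spin_dim :: "nat \<Rightarrow> nat \<Rightarrow> nat" where
  "spin_dim p q \<equiv> 2 ^ ((p + q) div 2)"

abbreviation conj_mat :: "complex mat \<Rightarrow> complex mat" where
  "conj_mat \<equiv> map_mat cnj"

definition spinor_rep :: "nat \<Rightarrow> nat \<Rightarrow> (cliff \<Rightarrow> complex mat) \<Rightarrow> bool" where
  "spinor_rep p q \<gamma> \<longleftrightarrow>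
     \<gamma> \<in> ring_iso (clifford p q) (ring_mat TYPE(complex) (spin_dim p q) ()) \<and>
     (\<forall>c. \<forall>a\<in>carrier (clifford p q). \<gamma> (scale c a) = c \<cdot>\<^sub>m \<gamma> a)"

definition real_idx :: "nat \<Rightarrow> nat \<Rightarrow> (cliff \<Rightarrow> complex mat) \<Rightarrow> nat set" where
  "real_idx p q \<gamma> = {i \<in> {1..p+q}. conj_mat (\<gamma> (gen i)) = \<gamma> (gen i)}"

definition complex_idx :: "nat \<Rightarrow> nat \<Rightarrow> (cliff \<Rightarrow> complex mat) \<Rightarrow> nat set" where
  "complex_idx p q \<gamma> = {i \<in> {1..p+q}. conj_mat (\<gamma> (gen i)) = - \<gamma> (gen i)}"

definition sym_idx :: "nat \<Rightarrow> nat \<Rightarrow> (cliff \<Rightarrow> complex mat) \<Rightarrow> nat set" where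
  "sym_idx p q \<gamma> = {i \<in> {1..p+q}. transpose_mat (\<gamma> (gen i)) = \<gamma> (gen i)}"

definition skew_idx :: "nat \<Rightarrow> nat \<Rightarrow> (cliff \<Rightarrow> complex mat) \<Rightarrow> nat set" where
  "skew_idx p q \<gamma> = {i \<in> {1..p+q}. transpose_mat (\<gamma> (gen i)) = - \<gamma> (gen i)}"

definition has_spinbasis :: "nat \<Rightarrow> nat \<Rightarrow> (cliff \<Rightarrow> complex mat) \<Rightarrow> bool" where
  "has_spinbasis p q \<gamma> \<longleftrightarrow>
     spinor_rep p q \<gamma> \<and>
     real_idx p q \<gamma> \<union> complex_idx p q \<gamma> = {1..p+q} \<and>
     sym_idx p q \<gamma> \<union> skew_idx p q \<gamma> = {1..p+q}"

definition num_m :: "nat \<Rightarrow> nat \<Rightarrow> (cliff \<Rightarrow> complex mat) \<Rightarrow> nat" where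
  "num_m p q \<gamma> = card (complex_idx p q \<gamma> \<inter> skew_idx p q \<gamma>)"

definition num_l :: "nat \<Rightarrow> nat \<Rightarrow> (cliff \<Rightarrow> complex mat) \<Rightarrow> nat" where
  "num_l p q \<gamma> = card (complex_idx p q \<gamma> \<inter> sym_idx p q \<gamma>)"

definition num_u :: "nat \<Rightarrow> nat \<Rightarrow> (cliff \<Rightarrow> complex mat) \<Rightarrow> nat" where
  "num_u p q \<gamma> = card (real_idx p q \<gamma> \<inter> skew_idx p q \<gamma>)"

definition num_v :: "nat \<Rightarrow> nat \<Rightarrow> (cliff \<Rightarrow> complex mat) \<Rightarrow> nat" where
  "num_v p q \<gamma> = card (real_idx p q \<gamma> \<inter> sym_idx p q \<gamma>)"

definition spin_counts :: "nat \<Rightarrow> nat \<Rightarrow> (cliff \<Rightarrow> complex mat) \<Rightarrow> nat set" where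
  "spin_counts p q \<gamma> = {num_m p q \<gamma>, num_v p q \<gamma>, num_l p q \<gamma>, num_u p q \<gamma>}"

definition spin_prod :: "nat \<Rightarrow> nat \<Rightarrow> (cliff \<Rightarrow> complex mat) \<Rightarrow> nat set \<Rightarrow> complex mat" where
  "spin_prod p q \<gamma> I =
     foldr (*) (map (\<lambda>i. \<gamma> (gen i)) (sorted_list_of_set I)) (1\<^sub>m (spin_dim p q))"

section \<open>Extended automorphism groups\<close>

definition eq_sign :: "complex mat \<Rightarrow> complex mat \<Rightarrow> bool" (infix \<open>=\<^sub>\<plusminus>\<close> 50) where
  "A =\<^sub>\<plusminus> B \<longleftrightarrow> A = B \<or> A = - B"

text \<open>The matrix M implements the transformation \<open>\<phi>\<close> by \<open>\<gamma> (\<phi> a) = M (\<psi> (\<gamma> a)) M\<^sup>-\<^sup>1\<close>, where \<open>\<psi>\<close> is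
  the accompanying entrywise operation.\<close>

definition represents ::
  "nat \<Rightarrow> nat \<Rightarrow> (cliff \<Rightarrow> complex mat) \<Rightarrow> (cliff \<Rightarrow> cliff) \<Rightarrow>
   (complex mat \<Rightarrow> complex mat) \<Rightarrow> complex mat \<Rightarrow> bool" where
  "represents p q \<gamma> \<phi> \<psi> M \<longleftrightarrow>
     M \<in> carrier_mat (spin_dim p q) (spin_dim p q) \<and>
     (\<exists>M' \<in> carrier_mat (spin_dim p q) (spin_dim p q).
        M * M' = 1\<^sub>m (spin_dim p q) \<and> M' * M = 1\<^sub>m (spin_dim p q) \<and>
        (\<forall>a\<in>carrier (clifford p q). \<gamma> (\<phi> a) = M * \<psi> (\<gamma> a) * M'))"

definition ext_matrices :: "nat \<Rightarrow> nat \<Rightarrow> (cliff \<Rightarrow> complex mat) \<Rightarrow> complex mat list \<Rightarrow> bool" where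
  "ext_matrices p q \<gamma> X \<longleftrightarrow> (\<exists>W E C P K S F.
     X = [W, E, C, P, K, S, F] \<and>
     represents p q \<gamma> star (\<lambda>A. A) W \<and>
     represents p q \<gamma> tilde transpose_mat E \<and>
     represents p q \<gamma> (tilde \<circ> star) transpose_mat C \<and>
     represents p q \<gamma> bar conj_mat P \<and>
     represents p q \<gamma> (bar \<circ> star) conj_mat K \<and>
     represents p q \<gamma> (bar \<circ> tilde) (transpose_mat \<circ> conj_mat) S \<and>
     represents p q \<gamma> (bar \<circ> tilde \<circ> star) (transpose_mat \<circ> conj_mat) F \<and>
     (\<forall>A\<in>set X. \<exists>I\<subseteq>{1..p+q}. A =\<^sub>\<plusminus> spin_prod p q \<gamma> I) \<and>
     W =\<^sub>\<plusminus> spin_prod p q \<gamma> {1..p+q} \<and>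
     C =\<^sub>\<plusminus> E * W \<and> K =\<^sub>\<plusminus> P * W \<and> S =\<^sub>\<plusminus> P * E \<and> F =\<^sub>\<plusminus> P * C)"

definition Ext :: "nat \<Rightarrow> nat \<Rightarrow> complex mat list \<Rightarrow> complex mat set" where
  "Ext p q X = insert (1\<^sub>m (spin_dim p q)) (set X)"

definition Aut :: "nat \<Rightarrow> nat \<Rightarrow> complex mat list \<Rightarrow> complex mat set" where
  "Aut p q X = insert (1\<^sub>m (spin_dim p q)) (set (take 3 X))"

text \<open>For quaternionic division ring the matrices of the pseudoautomorphism and of the
  antiautomorphism are the following products.\<close>

definition quaternionic_ext ::
  "nat \<Rightarrow> nat \<Rightarrow> (cliff \<Rightarrow> complex mat) \<Rightarrow> complex mat list \<Rightarrow> bool" where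
  "quaternionic_ext p q \<gamma> X \<longleftrightarrow>
     even (p + q) \<and> has_division_ring p q quaternion_ring \<and>
     (int p - int q) mod 8 \<in> {4, 6} \<and>
     has_spinbasis p q \<gamma> \<and> ext_matrices p q \<gamma> X \<and>
     X ! 3 =\<^sub>\<plusminus> spin_prod p q \<gamma>
       (if even (card (complex_idx p q \<gamma>)) then complex_idx p q \<gamma> else real_idx p q \<gamma>) \<and>
     X ! 1 =\<^sub>\<plusminus> spin_prod p q \<gamma>
       (if even (card (skew_idx p q \<gamma>)) then skew_idx p q \<gamma> else sym_idx p q \<gamma>)"

subsection \<open>Signatures and isomorphism types\<close>

definition has_signature :: "nat \<Rightarrow> nat \<Rightarrow> complex mat list \<Rightarrow> int list \<Rightarrow> bool" where
  "has_signature p q X s \<longleftrightarrow>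
     length s = length X \<and> set s \<subseteq> {1, -1} \<and>
     (\<forall>i<length X. X ! i * X ! i = of_int (s ! i) \<cdot>\<^sub>m 1\<^sub>m (spin_dim p q))"

text \<open>Commutativity, number of elements of order 2, number of elements of order 4.\<close>

type_synonym order_structure = "bool \<times> nat \<times> nat"

definition group_type :: "'a monoid \<Rightarrow> order_structure" where
  "group_type G = (comm_group G,
     card {x \<in> carrier G. group.ord G x = 2}, card {x \<in> carrier G. group.ord G x = 4})"

abbreviation Z2 :: "int monoid" where "Z2 \<equiv> integer_mod_group 2"
abbreviation Z4 :: "int monoid" where "Z4 \<equiv> integer_mod_group 4"

text \<open>The pair (a, s) is \<open>x\<^sup>a y\<^sup>s\<close>, where \<open>x\<^sup>4 = 1\<close> and \<open>y x = x\<^sup>-\<^sup>1 y\<close>, with \<open>y\<^sup>2 = 1\<close> in the dihedral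
  group and \<open>y\<^sup>2 = x\<^sup>2\<close> in the quaternion group.\<close>

definition D4 :: "(int \<times> int) monoid" where
  "D4 = \<lparr>carrier = {0..<4} \<times> {0..<2},
     monoid.mult = (\<lambda>(a, s) (b, t). ((if s = 0 then a + b else a - b) mod 4, (s + t) mod 2)),
     one = (0, 0)\<rparr>"

definition Q4 :: "(int \<times> int) monoid" where
  "Q4 = \<lparr>carrier = {0..<4} \<times> {0..<2},
     monoid.mult = (\<lambda>(a, s) (b, t).
       ((if s = 0 then a + b else a - b + 2 * t) mod 4, (s + t) mod 2)),
     one = (0, 0)\<rparr>"

text \<open>No group of order 8 has this order structure; it is only a name for the type.\<close>

definition Z4Z2_star :: order_structure where
  "Z4Z2_star = (False, 3, 4)"

text \<open>Products are identified up to sign with elements of the set, and the orders of the seven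
  non-identity elements are read off from their squares.\<close>

definition ext_iso :: "nat \<Rightarrow> nat \<Rightarrow> complex mat list \<Rightarrow> order_structure \<Rightarrow> bool" where
  "ext_iso p q X \<tau> \<longleftrightarrow>
     (\<forall>A\<in>Ext p q X. \<forall>B\<in>Ext p q X. \<exists>D\<in>Ext p q X. A * B =\<^sub>\<plusminus> D) \<and>
     \<tau> = ((\<forall>A\<in>Ext p q X. \<forall>B\<in>Ext p q X. A * B = B * A),
          card {i. i < length X \<and> X ! i * X ! i = 1\<^sub>m (spin_dim p q)},
          card {i. i < length X \<and> X ! i * X ! i = - 1\<^sub>m (spin_dim p q)})"

definition distinct_up_to_sign :: "nat \<Rightarrow> nat \<Rightarrow> complex mat list \<Rightarrow> bool" where
  "distinct_up_to_sign p q X \<longleftrightarrow>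
     (let Y = 1\<^sub>m (spin_dim p q) # X in
      \<forall>i<length Y. \<forall>j<length Y. i \<noteq> j \<longrightarrow> \<not> Y ! i =\<^sub>\<plusminus> Y ! j)"

text \<open>The list t of signs has exactly k pluses.\<close>

definition signs :: "nat \<Rightarrow> nat \<Rightarrow> int list set" where
  "signs n k = {t. length t = n \<and> set t \<subseteq> {1, -1} \<and> count_list t 1 = k}"

definition sig_with :: "int list \<Rightarrow> nat \<Rightarrow> int list set" where
  "sig_with abc k = {abc @ t |t. t \<in> signs 4 k}"

text \<open>Each entry consists of p - q modulo 8, the isomorphism type, and the family of
  signatures. For quaternionic division ring the matrix P of the pseudoautomorphism satisfies
  P (conj P) = -1, and P is real, being a product of real or of an even number of purely imaginary
  matrices. Hence P P = -1, so that the families all of whose members have the sign + in position 3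
  (counted from 0) are not realized by any spinbasis.\<close>

definition abelian_families :: "(int \<times> order_structure \<times> int list set) set" where
  "abelian_families = {
     (4, group_type (Z2 \<times>\<times> Z2 \<times>\<times> Z2), {[1, 1, 1, 1, 1, 1, 1]}),
     (4, group_type (Z4 \<times>\<times> Z2), {[1, 1, 1, -1, -1, -1, -1]}),
     (4, group_type (Z4 \<times>\<times> Z2), sig_with [1, -1, -1] 2),
     (6, group_type (Z4 \<times>\<times> Z2), sig_with [-1, 1, -1] 2),
     (6, group_type (Z4 \<times>\<times> Z2), sig_with [-1, -1, 1] 2)}"

definition nonabelian_families :: "(int \<times> order_structure \<times> int list set) set" where
  "nonabelian_families = {
     (6, group_type Q4, sig_with [-1, -1, -1] 1),
     (4, group_type D4, sig_with [1, -1, 1] 3),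
     (4, group_type D4, sig_with [1, 1, -1] 3),
     (6, group_type D4, sig_with [-1, 1, 1] 3),
     (4, group_type Q4, {[1, -1, -1, -1, -1, -1, -1]}),
     (6, group_type Q4, {[-1, 1, -1, -1, -1, -1, -1]}),
     (6, group_type Q4, {[-1, -1, 1, -1, -1, -1, -1]}),
     (4, group_type D4, sig_with [1, 1, 1] 2),
     (4, group_type D4, {[1, -1, -1, 1, 1, 1, 1]}),
     (6, group_type D4, {abc @ [1, 1, 1, 1] |abc. abc \<in> signs 3 1}),
     (4, Z4Z2_star, sig_with [1, -1, -1] 2),
     (6, Z4Z2_star, sig_with [-1, 1, -1] 2),
     (6, Z4Z2_star, sig_with [-1, -1, 1] 2),
     (4, Z4Z2_star, sig_with [1, -1, 1] 1),
     (4, Z4Z2_star, sig_with [1, 1, -1] 1),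
     (6, Z4Z2_star, sig_with [-1, 1, 1] 1),
     (6, Z4Z2_star, sig_with [-1, -1, -1] 3)}"

definition all_signatures :: "int list set" where
  "all_signatures = signs 7 7 \<union> signs 7 5 \<union> signs 7 3 \<union> signs 7 1"

end

theory Submission
  imports Defs "Jordan_Normal_Form.Determinant"
begin

text \<open>Up to sign, every matrix in question is the image of a monomial of the Clifford algebra, so it
  is given by a set of indices, and products correspond to symmetric differences. The sign of a
  product is a bicharacter on these sets. Hence each square and each commutation relation is
  determined by six signs: the squares of W, E, P and the commutation signs a, b, d of the pairs
  (E, W), (P, W), (P, E). The square of W is fixed by p - q modulo 8; the signs a, b, d depend only
  on the parities of m, v, l, u and are all 1 exactly if these numbers are even. The 64 choices of
  the six signs run through the 64 signatures.

  For the existence statements, real anticommuting matrices are built by Kronecker products, some of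
  them are multiplied by the imaginary unit, and trace orthogonality of the monomials shows that they
  define an isomorphism from the complex Clifford algebra to the matrix algebra. In it, the real
  subalgebra consists of the matrices that commute with the antilinear map \<open>x \<mapsto> P x\<^sup>*\<close>; since
  \<open>P P\<^sup>* = -1\<close>, they are the endomorphisms of a quaternionic vector space, and the projection to
  a quaternionic line is a primitive idempotent with corner ring isomorphic to the quaternions.\<close>

section \<open>The sign of a product of monomials\<close>

text \<open>Index sets under symmetric difference form a vector space over the two-element field. On
  it \<open>mono_sign p S S\<close> is a quadratic form with polar form \<open>comm_sign\<close>, so
  on a span of three sets it is known from three values and three polar values. In
  \<open>sig_list\<close> each of these six signs occurs an even number of times, so a signature has
  an even number of minuses among its seven entries. Conversely the six signs can be read off from
  it one by one. Hence the 2^6 choices exhaust the patterns with an odd number of pluses. The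
  examples start from real orthogonal generators, v + l symmetric and u + m skew. Multiplying a
  generator by the imaginary unit flips its square and keeps its symmetry, which gives p = v + m and
  q = l + u. From p - q = (v + l - u - m) + 2 (m - l) one sees how m - l steers the residue modulo
  8, although the real construction only has v + l - u - m equal to 0 or 2. The quaternionic
  structure requires in addition that P is real, skew and of square -1; for these index sets
  everything follows from the sign of the square.\<close>

lemma neg_one_power_eq_iff: "((-1) ^ a = ((-1) ^ b :: complex)) = (even a = even b)"
  by (cases "even a"; cases "even b") simp_all

lemma neg_one_power_mult_self: "(-1) ^ a * (-1) ^ a = (1 :: complex)" "((-1) ^ a)\<^sup>2 = (1 :: complex)"
  by (simp_all flip: power_add power_mult power2_eq_square)

lemma prod_neg_one:
  "finite A \<Longrightarrow> (\<Prod>x\<in>A. if P x then -1 else 1 :: complex) = (-1) ^ card {x \<in> A. P x}"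
  by (simp add: prod.If_cases Int_def)

text \<open>Elements of the intersection occur in both products and cancel because every factor
  squares to one. This turns products of signs into characters for symmetric difference.\<close>

lemma prod_sym_diff:
  fixes f :: "'a \<Rightarrow> complex"
  assumes "finite A" "finite B" "\<And>x. f x * f x = 1"
  shows "prod f (sym_diff A B) = prod f A * prod f B"
proof -
  have 1: "prod f A = prod f (A - B) * prod f (A \<inter> B)"
    using assms(1) by (metis mult.commute prod.Int_Diff)
  have 2: "prod f B = prod f (B - A) * prod f (A \<inter> B)"
    using assms(2) by (metis mult.commute prod.Int_Diff Int_commute)
  have 3: "prod f (A \<inter> B) * prod f (A \<inter> B) = 1"
    by (simp add: prod.distrib[symmetric] assms(3))
  have 4: "prod f (sym_diff A B) = prod f (A - B) * prod f (B - A)"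
    using assms(1,2) by (intro prod.union_disjoint) auto
  have "prod f A * prod f B = prod f (A - B) * prod f (B - A) * (prod f (A \<inter> B) * prod f (A \<inter> B))"
    unfolding 1 2 by (simp only: mult_ac)
  then show ?thesis unfolding 3 4 by simp
qed

text \<open>The sign is a bicharacter of the group of finite sets under symmetric difference, because
  it is the product of these elementary signs.\<close>

definition gen_sign :: "nat \<Rightarrow> nat \<Rightarrow> nat \<Rightarrow> complex" where
  "gen_sign p i j = (if j < i \<or> i = j \<and> p < i then -1 else 1)"

lemma gen_sign_square: "gen_sign p i j * gen_sign p i j = 1"
  by (simp add: gen_sign_def)

text \<open>Inversions lie off the diagonal and repeated generators on it, so the two exponents in
  \<open>mono_sign\<close> count disjoint parts of one set of pairs.\<close>

lemma mono_sign_prod: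
  assumes "finite S" "finite T"
  shows "mono_sign p S T = (\<Prod>i\<in>S. \<Prod>j\<in>T. gen_sign p i j)"
proof -
  have "(\<Prod>i\<in>S. \<Prod>j\<in>T. gen_sign p i j) = (\<Prod>z\<in>S \<times> T. if snd z < fst z \<or> fst z = snd z \<and> p < fst z then -1 else 1)"
    by (simp add: prod.cartesian_product gen_sign_def case_prod_beta)
  also have "\<dots> = (-1) ^ card {z \<in> S \<times> T. snd z < fst z \<or> fst z = snd z \<and> p < fst z}"
    using assms by (intro prod_neg_one) simp
  also have "{z \<in> S \<times> T. snd z < fst z \<or> fst z = snd z \<and> p < fst z} =
    {(i, j). i \<in> S \<and> j \<in> T \<and> j < i} \<union> (\<lambda>i. (i, i)) ` {i \<in> S \<inter> T. p < i}" by auto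
  also have "card \<dots> = card {(i, j). i \<in> S \<and> j \<in> T \<and> j < i} + card ((\<lambda>i. (i, i)) ` {i \<in> S \<inter> T. p < i})"
  proof (rule card_Un_disjoint)
    show "finite {(i, j). i \<in> S \<and> j \<in> T \<and> j < i}"
      by (rule finite_subset[OF _ finite_cartesian_product[OF assms]]) auto
  qed (use assms in auto)
  also have "card ((\<lambda>i. (i, i)) ` {i \<in> S \<inter> T. p < i}) = card {i \<in> S \<inter> T. p < i}"
    by (rule card_image) (simp add: inj_on_def)
  finally show ?thesis by (simp add: mono_sign_def power_add)
qed

lemma finite_sym_diff: "finite S \<Longrightarrow> finite T \<Longrightarrow> finite (sym_diff S T)"
  by simp

lemma prod_gen_sign_square:
  "(\<Prod>j\<in>T. gen_sign p i j) * (\<Prod>j\<in>T. gen_sign p i j) = 1"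
  by (simp add: prod.distrib[symmetric] gen_sign_square)

lemma mono_sign_sym_diff_left:
  assumes "finite A" "finite B" "finite C"
  shows "mono_sign p (sym_diff A B) C = mono_sign p A C * mono_sign p B C"
  using assms finite_sym_diff[of A B]
  by (simp only: mono_sign_prod prod_sym_diff[OF _ _ prod_gen_sign_square])

lemma mono_sign_sym_diff_right:
  assumes "finite A" "finite B" "finite C"
  shows "mono_sign p A (sym_diff B C) = mono_sign p A B * mono_sign p A C"
  using assms finite_sym_diff[of B C]
  by (simp only: mono_sign_prod prod_sym_diff[OF _ _ gen_sign_square] prod.distrib)

lemma mono_sign_square: "mono_sign p S T * mono_sign p S T = 1"
  using neg_one_power_mult_self(1) by (simp add: mono_sign_def algebra_simps flip: mult.assoc)

lemma mono_sign_cases: "mono_sign p S T = 1 \<or> mono_sign p S T = -1"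
  using mono_sign_square[of p S T] by (simp add: square_eq_1_iff)

text \<open>Moving one monomial past the other swaps \<open>card S * card T\<close> pairs of
  generators; the pairs of equal generators commute and have to be discounted. Unlike
  \<open>mono_sign\<close>, this does not depend on the squares of the generators.\<close>

definition comm_sign :: "nat set \<Rightarrow> nat set \<Rightarrow> complex" where
  "comm_sign S T = (-1) ^ (card S * card T + card (S \<inter> T))"

lemma comm_sign_commute: "comm_sign S T = comm_sign T S"
  by (simp add: comm_sign_def mult.commute Int_commute)

lemma comm_sign_square: "comm_sign S T * comm_sign S T = 1"
  by (simp add: comm_sign_def neg_one_power_mult_self)

lemma comm_sign_self: "comm_sign S S = 1"
  by (simp add: comm_sign_def)

lemma comm_sign_cases: "comm_sign S T = 1 \<or> comm_sign S T = -1"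
  using comm_sign_square[of S T] by (simp add: square_eq_1_iff)

text \<open>The factors for generators of square -1 occur twice and cancel, and the inversions in
  the two orders together are the pairs of distinct indices.\<close>

lemma comm_sign_mono_sign:
  assumes "finite S" "finite T"
  shows "comm_sign S T = mono_sign p S T * mono_sign p T S"
proof -
  have "T \<inter> S = S \<inter> T" by auto
  then have "mono_sign p S T * mono_sign p T S = (-1) ^ (card {(i, j). i \<in> S \<and> j \<in> T \<and> j < i} +
      card {(i, j). i \<in> T \<and> j \<in> S \<and> j < i})"
    using neg_one_power_mult_self(1)[of "card {i \<in> S \<inter> T. p < i}"]
    by (simp add: mono_sign_def power_add algebra_simps)
  also have "\<dots> = comm_sign S T"
    unfolding comm_sign_def neg_one_power_eq_iff by (auto simp flip: card_inversions[OF assms])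
  finally show ?thesis by simp
qed

lemma mono_sign_commute:
  assumes "finite S" "finite T"
  shows "mono_sign p S T = comm_sign S T * mono_sign p T S"
  using comm_sign_mono_sign[OF assms, of p] mono_sign_square[of p T S] by simp

lemma comm_sign_sym_diff_left:
  assumes "finite A" "finite B" "finite C"
  shows "comm_sign (sym_diff A B) C = comm_sign A C * comm_sign B C"
  using assms finite_sym_diff[of A B] comm_sign_mono_sign[of _ _ 0]
  by (simp only: mono_sign_sym_diff_left mono_sign_sym_diff_right mult_ac)

lemma comm_sign_sym_diff_right:
  assumes "finite A" "finite B" "finite C"
  shows "comm_sign C (sym_diff A B) = comm_sign C A * comm_sign C B"
  using comm_sign_sym_diff_left[OF assms] by (simp only: comm_sign_commute[of C])

text \<open>Within one set, every two-element subset contributes exactly one inversion.\<close>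

lemma mono_sign_self:
  assumes "finite S"
  shows "mono_sign p S S = (-1) ^ ((card S choose 2) + card {i \<in> S. p < i})"
proof -
  define x where "x = card {(i, j). i \<in> S \<and> j \<in> S \<and> j < i}"
  have "2 * x + card S = card S * card S"
    using card_inversions[OF assms assms] by (simp add: x_def)
  then have "2 * x = card S * (card S - 1)" by (cases "card S") auto
  then have "x = card S choose 2" by (simp add: choose_two)
  then show ?thesis by (simp add: mono_sign_def power_add x_def)
qed

text \<open>The polarization identity of the quadratic form; it yields the squares of C, K, S and F
  from those of W, E and P.\<close>

lemma mono_sign_sym_diff_self:
  assumes "finite S" "finite T"
  shows "mono_sign p (sym_diff S T) (sym_diff S T) = comm_sign S T * mono_sign p S S * mono_sign p T T"
  using assms finite_sym_diff[of S T] comm_sign_mono_sign[OF assms, of p]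
  by (simp only: mono_sign_sym_diff_left mono_sign_sym_diff_right mult_ac)

section \<open>Spinor representations in terms of monomials\<close>

lemma monomial_carrier: "S \<subseteq> {1..p+q} \<Longrightarrow> monomial S \<in> carrier (clifford p q)"
  by (auto simp: clifford_def monomial_def)

lemma scale_carrier: "a \<in> carrier (clifford p q) \<Longrightarrow> scale c a \<in> carrier (clifford p q)"
  by (auto simp: clifford_def scale_def)

lemma clifford_one: "\<one>\<^bsub>clifford p q\<^esub> = monomial {}"
  by (simp add: clifford_def monomial_def)

text \<open>\<open>sym_diff I T = U\<close> has the single solution \<open>T = sym_diff I U\<close>,
  so multiplying by a monomial only permutes the coefficients and changes signs.\<close>

lemma monomial_mult_left:
  assumes "I \<subseteq> {1..p+q}" "a \<in> carrier (clifford p q)"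
  shows "(monomial I \<otimes>\<^bsub>clifford p q\<^esub> a) U =
    (if U \<subseteq> {1..p+q} then mono_sign p I (sym_diff I U) * a (sym_diff I U) else 0)"
proof -
  have "(monomial I \<otimes>\<^bsub>clifford p q\<^esub> a) U =
     (\<Sum>S\<in>Pow {1..p+q}. if S = I then (\<Sum>T\<in>Pow {1..p+q}. if T = sym_diff I U
        then mono_sign p I T * a T else 0) else 0)"
    unfolding clifford_def monoid.simps
  proof (rule sum.cong[OF refl])
    fix S
    have "(sym_diff I T = U) = (T = sym_diff I U)" for T by auto
    then show "(\<Sum>T\<in>Pow {1..p+q}. if sym_diff S T = U then mono_sign p S T * monomial I S * a T else 0) =
      (if S = I then \<Sum>T\<in>Pow {1..p+q}. if T = sym_diff I U then mono_sign p I T * a T else 0 else 0)"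
      by (cases "S = I") (simp_all only: monomial_def if_True if_False mult_1_right mult_zero_right
          mult_zero_left if_cancel sum.neutral_const simp_thms)
  qed
  also have "\<dots> = (if sym_diff I U \<subseteq> {1..p+q} then mono_sign p I (sym_diff I U) * a (sym_diff I U) else 0)"
    using assms(1) by (simp only: sum.delta finite_Pow_iff finite_atLeastAtMost Pow_iff if_True)
  also have "sym_diff I U \<subseteq> {1..p+q} \<longleftrightarrow> U \<subseteq> {1..p+q}"
    using assms(1) by blast
  finally show ?thesis .
qed

lemma monomial_mult_right:
  assumes "I \<subseteq> {1..p+q}" "a \<in> carrier (clifford p q)"
  shows "(a \<otimes>\<^bsub>clifford p q\<^esub> monomial I) U =
    (if U \<subseteq> {1..p+q} then mono_sign p (sym_diff I U) I * a (sym_diff I U) else 0)"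
proof -
  have "(a \<otimes>\<^bsub>clifford p q\<^esub> monomial I) U =
     (\<Sum>T\<in>Pow {1..p+q}. if T = I then (\<Sum>S\<in>Pow {1..p+q}. if S = sym_diff I U
        then mono_sign p S I * a S else 0) else 0)"
    unfolding clifford_def monoid.simps
  proof (subst sum.swap, rule sum.cong[OF refl])
    fix T
    have "(sym_diff S I = U) = (S = sym_diff I U)" for S by auto
    then show "(\<Sum>S\<in>Pow {1..p+q}. if sym_diff S T = U then mono_sign p S T * a S * monomial I T else 0) =
      (if T = I then \<Sum>S\<in>Pow {1..p+q}. if S = sym_diff I U then mono_sign p S I * a S else 0 else 0)"
      by (cases "T = I") (simp_all only: monomial_def if_True if_False mult_1_right mult_zero_right
          mult_zero_left if_cancel sum.neutral_const simp_thms)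
  qed
  also have "\<dots> = (if sym_diff I U \<subseteq> {1..p+q} then mono_sign p (sym_diff I U) I * a (sym_diff I U) else 0)"
    using assms(1) by (simp only: sum.delta finite_Pow_iff finite_atLeastAtMost Pow_iff if_True)
  also have "sym_diff I U \<subseteq> {1..p+q} \<longleftrightarrow> U \<subseteq> {1..p+q}"
    using assms(1) by blast
  finally show ?thesis .
qed

text \<open>Conjugation by a monomial is diagonal in the monomial basis. Implementing a
  transformation thus amounts to finding an index set with a prescribed commutation
  character.\<close>

lemma monomial_mult_commute:
  assumes "I \<subseteq> {1..p+q}" "a \<in> carrier (clifford p q)"
  shows "monomial I \<otimes>\<^bsub>clifford p q\<^esub> a =
    (\<lambda>S. comm_sign I S * a S) \<otimes>\<^bsub>clifford p q\<^esub> monomial I"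
proof
  fix U
  have c: "(\<lambda>S. comm_sign I S * a S) \<in> carrier (clifford p q)"
    using assms(2) by (simp add: clifford_def)
  show "(monomial I \<otimes>\<^bsub>clifford p q\<^esub> a) U =
    ((\<lambda>S. comm_sign I S * a S) \<otimes>\<^bsub>clifford p q\<^esub> monomial I) U"
  proof (cases "U \<subseteq> {1..p+q}")
    case True
    then have "finite I" "finite (sym_diff I U)"
      using assms(1) finite_index_set by blast+
    from mono_sign_commute[OF this, of p] show ?thesis
      unfolding monomial_mult_left[OF assms] monomial_mult_right[OF assms(1) c] by simp
  qed (simp only: monomial_mult_left[OF assms] monomial_mult_right[OF assms(1) c] if_False)
qed

section \<open>Scalars, conjugation and transposition of matrices\<close>

lemma uminus_smult_mat: "- A = (-1 :: 'a :: ring_1) \<cdot>\<^sub>m A"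
  by (rule eq_matI) auto

lemma conj_mat_mult:
  assumes "A \<in> carrier_mat n m" "B \<in> carrier_mat m k"
  shows "conj_mat (A * B) = conj_mat A * conj_mat B"
  using assms by (intro eq_matI) (auto simp: scalar_prod_def)

lemma conj_mat_smult: "conj_mat (c \<cdot>\<^sub>m A) = cnj c \<cdot>\<^sub>m conj_mat A"
  by (rule eq_matI) auto

lemma transpose_mat_smult: "transpose_mat (c \<cdot>\<^sub>m A) = c \<cdot>\<^sub>m transpose_mat A"
  by (rule eq_matI) auto

lemma one_smult_mat: "(1 :: 'a :: monoid_mult) \<cdot>\<^sub>m A = A"
  by (rule eq_matI) auto

lemma smult_smult_mat: "a \<cdot>\<^sub>m (b \<cdot>\<^sub>m A) = (a * b :: 'a :: semigroup_mult) \<cdot>\<^sub>m A"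
  by (rule eq_matI) (auto simp: mult.assoc)

lemma mono_sign_below: "\<forall>a\<in>A. b < a \<Longrightarrow> mono_sign p {b} A = 1"
proof -
  assume "\<forall>a\<in>A. b < a"
  then have "{(i, j). i \<in> {b} \<and> j \<in> A \<and> j < i} = {}" "{i \<in> {b} \<inter> A. p < i} = {}" by auto
  then show ?thesis by (simp only: mono_sign_def card.empty power_0 mult_1)
qed

lemma sorted_list_of_set_insert_below:
  assumes "finite A" "\<forall>a\<in>A. (b :: nat) < a"
  shows "sorted_list_of_set (insert b A) = b # sorted_list_of_set A"
proof -
  have "b \<notin> A" using assms(2) by auto
  then show ?thesis using assms by (simp add: insort_is_Cons less_imp_le)
qed

section \<open>Images of monomials under a spinor representation\<close>

locale spinor =
  fixes p q :: nat and \<gamma> :: "cliff \<Rightarrow> complex mat"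
  assumes rep: "spinor_rep p q \<gamma>"
begin

abbreviation N :: nat where "N \<equiv> spin_dim p q"

abbreviation e :: "nat set \<Rightarrow> complex mat" where "e S \<equiv> \<gamma> (monomial S)"

lemma iso: "\<gamma> \<in> ring_iso (clifford p q) (ring_mat TYPE(complex) N ())"
  using rep by (simp add: spinor_rep_def)

lemma
  assumes "a \<in> carrier (clifford p q)"
  shows rep_carrier: "\<gamma> a \<in> carrier_mat N N"
    and rep_scale: "\<gamma> (scale c a) = c \<cdot>\<^sub>m \<gamma> a"
    and rep_mult: "b \<in> carrier (clifford p q) \<Longrightarrow> \<gamma> (a \<otimes>\<^bsub>clifford p q\<^esub> b) = \<gamma> a * \<gamma> b"
    and rep_add: "b \<in> carrier (clifford p q) \<Longrightarrow> \<gamma> (a \<oplus>\<^bsub>clifford p q\<^esub> b) = \<gamma> a + \<gamma> b"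
    and rep_eq_iff: "b \<in> carrier (clifford p q) \<Longrightarrow> \<gamma> a = \<gamma> b \<longleftrightarrow> a = b"
  using iso rep assms ring_iso_memE[OF iso]
  by (auto simp: spinor_rep_def ring_mat_def bij_betw_def inj_on_def)

lemma rep_surj:
  assumes "M \<in> carrier_mat N N"
  obtains a where "a \<in> carrier (clifford p q)" "\<gamma> a = M"
proof -
  have "\<gamma> ` carrier (clifford p q) = carrier_mat N N"
    using ring_iso_memE(5)[OF iso] by (simp add: bij_betw_def ring_mat_def)
  then show thesis using assms that by (metis imageE)
qed

lemma rep_one: "e {} = 1\<^sub>m N"
  using ring_iso_memE(4)[OF iso] by (simp add: clifford_one ring_mat_def)

lemma e_carrier [simp]: "S \<subseteq> {1..p+q} \<Longrightarrow> e S \<in> carrier_mat N N"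
  by (intro rep_carrier monomial_carrier)

lemma e_dim [simp]: "S \<subseteq> {1..p+q} \<Longrightarrow> dim_row (e S) = N" "S \<subseteq> {1..p+q} \<Longrightarrow> dim_col (e S) = N"
  using e_carrier by blast+

lemma e_mult:
  assumes "S \<subseteq> {1..p+q}" "T \<subseteq> {1..p+q}"
  shows "e S * e T = mono_sign p S T \<cdot>\<^sub>m e (sym_diff S T)"
proof -
  have "sym_diff S T \<subseteq> {1..p+q}" using assms by blast
  then show ?thesis
    using assms by (simp only: rep_mult[symmetric] monomial_mult monomial_carrier rep_scale)
qed

lemma e_eq_smultD:
  assumes "S \<subseteq> {1..p+q}" "T \<subseteq> {1..p+q}" "e S = c \<cdot>\<^sub>m e T"
  shows "S = T"
proof -
  have "monomial S = scale c (monomial T)"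
    using assms by (metis rep_scale rep_eq_iff scale_carrier monomial_carrier)
  then have "monomial S S = scale c (monomial T) S" by simp
  then show ?thesis by (auto simp: monomial_def scale_def split: if_splits)
qed

lemma e_eq_sign_iff:
  assumes "S \<subseteq> {1..p+q}" "T \<subseteq> {1..p+q}"
  shows "e S =\<^sub>\<plusminus> e T \<longleftrightarrow> S = T"
  unfolding eq_sign_def uminus_smult_mat
  using e_eq_smultD[OF assms, of 1] e_eq_smultD[OF assms, of "-1"] by (metis one_smult_mat)

lemma e_commute:
  assumes "S \<subseteq> {1..p+q}" "T \<subseteq> {1..p+q}"
  shows "e S * e T = comm_sign S T \<cdot>\<^sub>m (e T * e S)"
proof -
  have "sym_diff T S = sym_diff S T" by (rule Un_commute)
  moreover have "finite S" "finite T" using assms finite_index_set by blast+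
  ultimately show ?thesis
    using assms by (simp only: e_mult smult_smult_mat mono_sign_commute[of S T p])
qed

lemma e_square: "S \<subseteq> {1..p+q} \<Longrightarrow> e S * e S = mono_sign p S S \<cdot>\<^sub>m 1\<^sub>m N"
  by (simp add: e_mult rep_one)

text \<open>A new smallest factor stands in front of all others, so no inversion and no sign arises.
  The same induction order serves for conjugation and transposition below.\<close>

lemma spin_prod_e:
  assumes "I \<subseteq> {1..p+q}"
  shows "spin_prod p q \<gamma> I = e I"
  using finite_index_set[OF assms] assms
proof (induction I rule: finite_linorder_min_induct)
  case empty
  show ?case by (simp add: spin_prod_def rep_one)
next
  case (insert b A)
  have "sym_diff {b} A = insert b A" using insert.hyps(2) by auto
  then have "e (insert b A) = e {b} * e A"
    using insert e_mult[of "{b}" A] mono_sign_below[of A b p]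
    by (simp add: one_smult_mat)
  moreover have "spin_prod p q \<gamma> (insert b A) = e {b} * spin_prod p q \<gamma> A"
    unfolding spin_prod_def sorted_list_of_set_insert_below[OF insert.hyps(1,2)]
    by (simp add: gen_def)
  ultimately show ?case using insert by simp
qed

text \<open>Linearity in all coefficients at once, by induction on the set of monomials kept. It
  reduces entrywise operations on a represented element to their effect on the monomials.\<close>

lemma rep_expansion:
  assumes a: "a \<in> carrier (clifford p q)" and rc: "r < N" "c < N"
  shows "\<gamma> a $$ (r, c) = (\<Sum>S\<in>Pow {1..p+q}. a S * e S $$ (r, c))"
proof -
  have "\<gamma> (\<lambda>S. if S \<in> F then a S else 0) $$ (r, c) = (\<Sum>S\<in>F. a S * e S $$ (r, c))"
    if "finite F" "F \<subseteq> Pow {1..p+q}" for F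
    using that
  proof (induction F rule: finite_induct)
    case empty
    have "(\<lambda>S. 0) = scale 0 (monomial {})" by (simp add: scale_def)
    then have "\<gamma> (\<lambda>S. 0) = 0 \<cdot>\<^sub>m e {}" by (simp only: rep_scale monomial_carrier empty_subsetI)
    then show ?case using rc by (simp add: rep_one)
  next
    case (insert T F)
    let ?b = "\<lambda>S. if S \<in> F then a S else 0"
    have T: "T \<subseteq> {1..p+q}" and b: "?b \<in> carrier (clifford p q)"
      using insert.prems a by (auto simp: clifford_def)
    have "(\<lambda>S. if S \<in> insert T F then a S else 0) = scale (a T) (monomial T) \<oplus>\<^bsub>clifford p q\<^esub> ?b"
      using insert.hyps(2) by (auto simp: clifford_def scale_def monomial_def)
    then have "\<gamma> (\<lambda>S. if S \<in> insert T F then a S else 0) = a T \<cdot>\<^sub>m e T + \<gamma> ?b"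
      using b T by (simp only: rep_add rep_scale scale_carrier monomial_carrier)
    then show ?case
      using insert rc rep_carrier[OF b] T by simp
  qed
  from this[OF _ subset_refl]
  have "\<gamma> (\<lambda>S. if S \<in> Pow {1..p+q} then a S else 0) $$ (r, c) = (\<Sum>S\<in>Pow {1..p+q}. a S * e S $$ (r, c))"
    by simp
  moreover have "(\<lambda>S. if S \<in> Pow {1..p+q} then a S else 0) = a"
    using a by (auto simp: clifford_def)
  ultimately show ?thesis by simp
qed

lemma e_conjugation:
  assumes "I \<subseteq> {1..p+q}" "a \<in> carrier (clifford p q)"
  shows "e I * \<gamma> a = \<gamma> (\<lambda>S. comm_sign I S * a S) * e I"
proof -
  have "(\<lambda>S. comm_sign I S * a S) \<in> carrier (clifford p q)"
    using assms(2) by (simp add: clifford_def)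
  then show ?thesis
    using assms monomial_mult_commute[OF assms] by (simp only: rep_mult[symmetric] monomial_carrier)
qed

text \<open>Here \<open>b\<close> is the effect of \<open>\<psi>\<close> on coefficients, which
  depends on the chosen matrices; conjugation by the monomial has to supply the missing character
  that turns it into \<open>\<phi>\<close>.\<close>

lemma represents_e:
  assumes I: "I \<subseteq> {1..p+q}"
    and b: "\<And>a. a \<in> carrier (clifford p q) \<Longrightarrow> b a \<in> carrier (clifford p q) \<and> \<psi> (\<gamma> a) = \<gamma> (b a)"
    and \<phi>: "\<And>a S. a \<in> carrier (clifford p q) \<Longrightarrow> \<phi> a S = comm_sign I S * b a S"
  shows "represents p q \<gamma> \<phi> \<psi> (e I)"
proof -
  \<comment> \<open>The square of a monomial is a sign times the unit, so its inverse is that sign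
    times itself.\<close>
  define M' where "M' = mono_sign p I I \<cdot>\<^sub>m e I"
  have M': "M' \<in> carrier_mat N N" using I by (simp add: M'_def)
  have inv: "e I * M' = 1\<^sub>m N" "M' * e I = 1\<^sub>m N"
    unfolding M'_def mult_smult_distrib[OF e_carrier[OF I] e_carrier[OF I]]
      mult_smult_assoc_mat[OF e_carrier[OF I] e_carrier[OF I]] e_square[OF I]
    by (simp_all add: smult_smult_mat mono_sign_square one_smult_mat)
  have "\<gamma> (\<phi> a) = e I * \<psi> (\<gamma> a) * M'" if a: "a \<in> carrier (clifford p q)" for a
  proof -
    have ba: "b a \<in> carrier (clifford p q)" "\<psi> (\<gamma> a) = \<gamma> (b a)" using b[OF a] by auto
    have \<phi>a: "\<phi> a = (\<lambda>S. comm_sign I S * b a S)" using \<phi>[OF a] by auto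
    then have c: "\<phi> a \<in> carrier (clifford p q)" using ba(1) by (auto simp: clifford_def)
    have "e I * \<gamma> (b a) = \<gamma> (\<phi> a) * e I" unfolding \<phi>a by (rule e_conjugation[OF I ba(1)])
    then have "e I * \<psi> (\<gamma> a) * M' = \<gamma> (\<phi> a) * (e I * M')"
      unfolding ba(2) using assoc_mult_mat[OF rep_carrier[OF c] e_carrier[OF I] M'] by simp
    then show ?thesis using inv(1) rep_carrier[OF c] by simp
  qed
  then show ?thesis unfolding represents_def using M' inv I by auto
qed

end

section \<open>Conjugation and transposition of monomials\<close>

lemma card_insert_Int:
  "finite A \<Longrightarrow> b \<notin> A \<Longrightarrow> card (insert b A \<inter> B) = card ({b} \<inter> B) + card (A \<inter> B)"
  by (cases "b \<in> B") simp_all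

locale spinbasis = spinor +
  assumes real_or_complex: "real_idx p q \<gamma> \<union> complex_idx p q \<gamma> = {1..p+q}"
    and sym_or_skew: "sym_idx p q \<gamma> \<union> skew_idx p q \<gamma> = {1..p+q}"
begin

abbreviation "Re_idx \<equiv> real_idx p q \<gamma>"
abbreviation "Cx_idx \<equiv> complex_idx p q \<gamma>"
abbreviation "Sy_idx \<equiv> sym_idx p q \<gamma>"
abbreviation "Sk_idx \<equiv> skew_idx p q \<gamma>"

lemma gen_conj:
  assumes "i \<in> {1..p+q}"
  shows "conj_mat (e {i}) = (-1) ^ card ({i} \<inter> Cx_idx) \<cdot>\<^sub>m e {i}"
proof (cases "i \<in> Cx_idx")
  case True
  then show ?thesis by (simp add: complex_idx_def gen_def uminus_smult_mat)
next
  case False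
  then have "i \<in> Re_idx" using assms real_or_complex by auto
  then show ?thesis using False by (simp add: real_idx_def gen_def one_smult_mat)
qed

lemma gen_transpose:
  assumes "i \<in> {1..p+q}"
  shows "transpose_mat (e {i}) = (-1) ^ card ({i} \<inter> Sk_idx) \<cdot>\<^sub>m e {i}"
proof (cases "i \<in> Sk_idx")
  case True
  then show ?thesis by (simp add: skew_idx_def gen_def uminus_smult_mat)
next
  case False
  then have "i \<in> Sy_idx" using assms sym_or_skew by auto
  then show ?thesis using False by (simp add: sym_idx_def gen_def one_smult_mat)
qed

lemma e_conj:
  assumes "S \<subseteq> {1..p+q}"
  shows "conj_mat (e S) = (-1) ^ card (S \<inter> Cx_idx) \<cdot>\<^sub>m e S"
  using finite_index_set[OF assms] assms
proof (induction S rule: finite_linorder_min_induct)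
  case empty
  show ?case by (simp add: rep_one) (rule eq_matI, auto)
next
  case (insert b A)
  have "sym_diff {b} A = insert b A" using insert.hyps(2) by auto
  then have eq: "e (insert b A) = e {b} * e A"
    using insert e_mult[of "{b}" A] mono_sign_below[of A b p]
    by (simp add: one_smult_mat)
  have b: "b \<in> {1..p+q}" "{b} \<subseteq> {1..p+q}" "A \<subseteq> {1..p+q}" and nb: "b \<notin> A"
    using insert by auto
  have "conj_mat (e (insert b A)) = ((-1) ^ card ({b} \<inter> Cx_idx) \<cdot>\<^sub>m e {b}) * ((-1) ^ card (A \<inter> Cx_idx) \<cdot>\<^sub>m e A)"
    unfolding eq conj_mat_mult[OF e_carrier[OF b(2)] e_carrier[OF b(3)]] gen_conj[OF b(1)]
      insert.IH[OF b(3)] by simp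
  also have "\<dots> = (-1) ^ card (insert b A \<inter> Cx_idx) \<cdot>\<^sub>m (e {b} * e A)"
    using mult_smult_assoc_mat[OF e_carrier[OF b(2)] smult_carrier_mat[OF e_carrier[OF b(3)]]]
      mult_smult_distrib[OF e_carrier[OF b(2)] e_carrier[OF b(3)]]
    by (simp add: smult_smult_mat card_insert_Int[OF insert.hyps(1) nb] power_add)
  finally show ?case unfolding eq .
qed

text \<open>Transposition reverses the factors. Bringing the smallest generator back to the front
  costs one sign for each remaining factor, which adds up to \<open>card S choose 2\<close>.\<close>

lemma e_transpose:
  assumes "S \<subseteq> {1..p+q}"
  shows "transpose_mat (e S) = (-1) ^ ((card S choose 2) + card (S \<inter> Sk_idx)) \<cdot>\<^sub>m e S"
  using finite_index_set[OF assms] assms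
proof (induction S rule: finite_linorder_min_induct)
  case empty
  show ?case by (simp add: rep_one numeral_2_eq_2) (rule eq_matI, auto)
next
  case (insert b A)
  have sd: "sym_diff {b} A = insert b A" using insert.hyps(2) by auto
  then have eq: "e (insert b A) = e {b} * e A"
    using insert e_mult[of "{b}" A] mono_sign_below[of A b p]
    by (simp add: one_smult_mat)
  have b: "b \<in> {1..p+q}" "{b} \<subseteq> {1..p+q}" "A \<subseteq> {1..p+q}" and nb: "b \<notin> A"
    using insert by auto
  have cs: "comm_sign A {b} = (-1) ^ card A" using nb by (simp add: comm_sign_def)
  have c2: "card (insert b A) choose 2 = card A + (card A choose 2)"
    using insert.hyps(1) nb by (simp add: numeral_2_eq_2)
  have "transpose_mat (e (insert b A)) = ((-1) ^ ((card A choose 2) + card (A \<inter> Sk_idx)) \<cdot>\<^sub>m e A)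
      * ((-1) ^ card ({b} \<inter> Sk_idx) \<cdot>\<^sub>m e {b})"
    unfolding eq transpose_mult[OF e_carrier[OF b(2)] e_carrier[OF b(3)]] gen_transpose[OF b(1)]
      insert.IH[OF b(3)] by simp
  also have "\<dots> = ((-1) ^ ((card A choose 2) + card (A \<inter> Sk_idx)) * (-1) ^ card ({b} \<inter> Sk_idx)) \<cdot>\<^sub>m (e A * e {b})"
    using mult_smult_assoc_mat[OF e_carrier[OF b(3)] smult_carrier_mat[OF e_carrier[OF b(2)]]]
      mult_smult_distrib[OF e_carrier[OF b(3)] e_carrier[OF b(2)]]
    by (simp add: smult_smult_mat)
  also have "\<dots> = (-1) ^ ((card (insert b A) choose 2) + card (insert b A \<inter> Sk_idx)) \<cdot>\<^sub>m (e {b} * e A)"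
    unfolding e_commute[OF b(3,2)] cs c2
    by (simp add: smult_smult_mat card_insert_Int[OF insert.hyps(1) nb] power_add algebra_simps)
  finally show ?case unfolding eq .
qed

lemma rep_conj:
  assumes a: "a \<in> carrier (clifford p q)"
  shows "(\<lambda>S. (-1) ^ card (S \<inter> Cx_idx) * cnj (a S)) \<in> carrier (clifford p q) \<and>
    conj_mat (\<gamma> a) = \<gamma> (\<lambda>S. (-1) ^ card (S \<inter> Cx_idx) * cnj (a S))"
proof
  let ?b = "\<lambda>S. (-1) ^ card (S \<inter> Cx_idx) * cnj (a S)"
  show b: "?b \<in> carrier (clifford p q)" using a by (simp add: clifford_def)
  show "conj_mat (\<gamma> a) = \<gamma> ?b"
  proof (rule eq_matI)
    fix r c assume "r < dim_row (\<gamma> ?b)" "c < dim_col (\<gamma> ?b)"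
    then have rc: "r < N" "c < N" using rep_carrier[OF b] by auto
    have "cnj (e S $$ (r, c)) = (-1) ^ card (S \<inter> Cx_idx) * e S $$ (r, c)" if "S \<subseteq> {1..p+q}" for S
      using arg_cong[OF e_conj[OF that], of "\<lambda>M. M $$ (r, c)"] rc that by simp
    then show "conj_mat (\<gamma> a) $$ (r, c) = \<gamma> ?b $$ (r, c)"
      using rc rep_carrier[OF a]
      by (simp add: rep_expansion[OF a rc] rep_expansion[OF b rc] mult.assoc mult.left_commute)
  qed (use rep_carrier[OF a] rep_carrier[OF b] in auto)
qed

text \<open>The sign of reversing the factors is precisely that of \<open>tilde\<close>; only the
  character counting skew generators is left to be corrected by conjugation.\<close>

lemma rep_transpose:
  assumes a: "a \<in> carrier (clifford p q)"
  shows "(\<lambda>S. (-1) ^ card (S \<inter> Sk_idx) * tilde a S) \<in> carrier (clifford p q) \<and>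
    transpose_mat (\<gamma> a) = \<gamma> (\<lambda>S. (-1) ^ card (S \<inter> Sk_idx) * tilde a S)"
proof
  let ?b = "\<lambda>S. (-1) ^ card (S \<inter> Sk_idx) * tilde a S"
  show b: "?b \<in> carrier (clifford p q)" using a by (simp add: clifford_def tilde_def)
  show "transpose_mat (\<gamma> a) = \<gamma> ?b"
  proof (rule eq_matI)
    fix r c assume "r < dim_row (\<gamma> ?b)" "c < dim_col (\<gamma> ?b)"
    then have rc: "r < N" "c < N" using rep_carrier[OF b] by auto
    have "e S $$ (c, r) = (-1) ^ ((card S choose 2) + card (S \<inter> Sk_idx)) * e S $$ (r, c)"
      if "S \<subseteq> {1..p+q}" for S
      using arg_cong[OF e_transpose[OF that], of "\<lambda>M. M $$ (r, c)"] rc that by simp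
    then show "transpose_mat (\<gamma> a) $$ (r, c) = \<gamma> ?b $$ (r, c)"
      using rc rep_carrier[OF a]
      unfolding rep_expansion[OF b rc]
      by (simp add: rep_expansion[OF a] tilde_def power_add mult.assoc mult.left_commute)
  qed (use rep_carrier[OF a] rep_carrier[OF b] in auto)
qed

end

section \<open>The index sets of the seven matrices\<close>

text \<open>The quadratic form on the span of W, E, P, evaluated at W, E, EW, P, PW, PE, PEW:
  squares \<open>w\<close>, \<open>\<epsilon>\<close>, \<open>\<pi>\<close> of the factors times the
  commutation signs of the pairs involved, \<open>a\<close> for (E, W), \<open>b\<close> for (P, W),
  \<open>d\<close> for (P, E).\<close>

definition sig_list :: "int \<Rightarrow> int \<Rightarrow> int \<Rightarrow> int \<Rightarrow> int \<Rightarrow> int \<Rightarrow> int list" where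
  "sig_list w \<epsilon> \<pi> a b d = [w, \<epsilon>, a * \<epsilon> * w, \<pi>, b * \<pi> * w, d * \<pi> * \<epsilon>, d * b * a * \<pi> * \<epsilon> * w]"

text \<open>A linear combination over the two-element field with coefficients \<open>x\<close>,
  \<open>y\<close>, \<open>z\<close>; disequality of truth values serves as addition.\<close>

definition comb :: "'a set \<Rightarrow> 'a set \<Rightarrow> 'a set \<Rightarrow> bool \<Rightarrow> bool \<Rightarrow> bool \<Rightarrow> 'a set" where
  "comb P E W x y z = {i. (x \<and> i \<in> P) \<noteq> ((y \<and> i \<in> E) \<noteq> (z \<and> i \<in> W))}"

lemma sym_diff_comb:
  "sym_diff (comb P E W x y z) (comb P E W x' y' z') = comb P E W (x \<noteq> x') (y \<noteq> y') (z \<noteq> z')"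
  by (auto simp: comb_def)

context spinbasis
begin

lemma e_neq_uminus:
  assumes "S \<subseteq> {1..p+q}"
  shows "e S \<noteq> - e S"
proof
  assume "e S = - e S"
  then have "monomial S = scale (-1) (monomial S)"
    using assms by (metis rep_scale rep_eq_iff scale_carrier monomial_carrier uminus_smult_mat)
  then have "monomial S S = scale (-1) (monomial S) S" by simp
  then show False by (simp add: monomial_def scale_def)
qed

lemma e_sign_cases:
  assumes "A =\<^sub>\<plusminus> e S"
  obtains s where "s * s = (1 :: complex)" "A = s \<cdot>\<^sub>m e S"
  using assms that[of 1] that[of "-1"]
  by (auto simp: eq_sign_def uminus_smult_mat one_smult_mat)

lemma e_sign_mult:
  assumes "S \<subseteq> {1..p+q}" "T \<subseteq> {1..p+q}" "A =\<^sub>\<plusminus> e S" "B =\<^sub>\<plusminus> e T"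
  shows "A * B =\<^sub>\<plusminus> e (sym_diff S T)"
proof -
  obtain s t where s: "s * s = 1" "A = s \<cdot>\<^sub>m e S" and t: "t * t = 1" "B = t \<cdot>\<^sub>m e T"
    using assms(3,4) by (elim e_sign_cases)
  have "A * B = (s * t * mono_sign p S T) \<cdot>\<^sub>m e (sym_diff S T)"
    unfolding s(2) t(2) mult_smult_assoc_mat[OF e_carrier[OF assms(1)] smult_carrier_mat[OF e_carrier[OF assms(2)]]]
      mult_smult_distrib[OF e_carrier[OF assms(1)] e_carrier[OF assms(2)]]
    by (simp only: e_mult[OF assms(1,2)] smult_smult_mat mult.assoc)
  moreover have "s = 1 \<or> s = -1" "t = 1 \<or> t = -1"
    using s(1) t(1) by (simp_all add: square_eq_1_iff)
  then have "s * t * mono_sign p S T = 1 \<or> s * t * mono_sign p S T = -1"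
    using mono_sign_cases[of p S T] by auto
  ultimately show ?thesis by (auto simp: eq_sign_def one_smult_mat uminus_smult_mat)
qed

lemma e_sign_commute:
  assumes "S \<subseteq> {1..p+q}" "T \<subseteq> {1..p+q}" "A =\<^sub>\<plusminus> e S" "B =\<^sub>\<plusminus> e T"
  shows "A * B = B * A \<longleftrightarrow> comm_sign S T = 1"
proof -
  obtain s t where s: "s * s = 1" "A = s \<cdot>\<^sub>m e S" and t: "t * t = 1" "B = t \<cdot>\<^sub>m e T"
    using assms(3,4) by (elim e_sign_cases)
  note c = e_carrier[OF assms(1)] e_carrier[OF assms(2)]
  have AB: "A * B = (s * t) \<cdot>\<^sub>m (e S * e T)"
    unfolding s(2) t(2) mult_smult_assoc_mat[OF c(1) smult_carrier_mat[OF c(2)]]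
      mult_smult_distrib[OF c] smult_smult_mat ..
  have BA: "B * A = (s * t) \<cdot>\<^sub>m (e T * e S)"
    unfolding s(2) t(2) mult_smult_assoc_mat[OF c(2) smult_carrier_mat[OF c(1)]]
      mult_smult_distrib[OF c(2,1)] smult_smult_mat mult.commute[of s] ..
  have eq: "A * B = comm_sign S T \<cdot>\<^sub>m (B * A)"
    unfolding AB BA e_commute[OF assms(1,2)] smult_smult_mat by (simp add: mult.commute)
  have TS: "sym_diff T S \<subseteq> {1..p+q}" using assms by blast
  \<comment> \<open>Makes the sign visible: a product of two monomials is never its own negative, so
    a commutation sign -1 really excludes commuting.\<close>
  have "B * A \<noteq> - (B * A)"
    using e_sign_mult[OF assms(2,1,4,3)] e_neq_uminus[OF TS] unfolding eq_sign_def
    by (metis uminus_uminus_mat)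
  then show ?thesis
    using eq comm_sign_cases[of S T] by (auto simp: one_smult_mat uminus_smult_mat)
qed

lemma e_sign_square:
  assumes "S \<subseteq> {1..p+q}" "A =\<^sub>\<plusminus> e S"
  shows "A * A = mono_sign p S S \<cdot>\<^sub>m 1\<^sub>m N"
proof -
  obtain s where s: "s * s = 1" "A = s \<cdot>\<^sub>m e S"
    using assms(2) by (elim e_sign_cases)
  note c = e_carrier[OF assms(1)]
  show ?thesis
    unfolding s(2) mult_smult_assoc_mat[OF c smult_carrier_mat[OF c]] mult_smult_distrib[OF c c]
      smult_smult_mat s(1) one_smult_mat by (rule e_square[OF assms(1)])
qed

end

lemma eq_sign_trans: "A =\<^sub>\<plusminus> B \<Longrightarrow> B =\<^sub>\<plusminus> C \<Longrightarrow> A =\<^sub>\<plusminus> C"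
  by (auto simp: eq_sign_def)

lemma eq_sign_refl: "A =\<^sub>\<plusminus> A"
  by (simp add: eq_sign_def)

locale even_spinbasis = spinbasis +
  assumes even_dim: "even (p + q)"
begin

definition W_set where "W_set = {1..p+q}"
definition E_set where "E_set = (if even (card Sk_idx) then Sk_idx else Sy_idx)"
definition P_set where "P_set = (if even (card Cx_idx) then Cx_idx else Re_idx)"

definition ext_sets where
  "ext_sets = [W_set, E_set, sym_diff E_set W_set, P_set, sym_diff P_set W_set,
     sym_diff P_set E_set, sym_diff P_set (sym_diff E_set W_set)]"

lemma index_sets_disjoint: "Re_idx \<inter> Cx_idx = {}" "Sy_idx \<inter> Sk_idx = {}"
proof -
  have "e {i} \<noteq> - e {i}" if "i \<in> {1..p+q}" for i
    using that by (intro e_neq_uminus) simp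
  then show "Re_idx \<inter> Cx_idx = {}" "Sy_idx \<inter> Sk_idx = {}"
    unfolding real_idx_def complex_idx_def sym_idx_def skew_idx_def gen_def by force+
qed

lemma index_sets_subset:
  "Re_idx \<subseteq> {1..p+q}" "Cx_idx \<subseteq> {1..p+q}" "Sy_idx \<subseteq> {1..p+q}" "Sk_idx \<subseteq> {1..p+q}"
  by (auto simp: real_idx_def complex_idx_def sym_idx_def skew_idx_def)

lemma index_sets_finite: "finite Re_idx" "finite Cx_idx" "finite Sy_idx" "finite Sk_idx"
  using index_sets_subset finite_index_set by blast+

lemma ext_sets_subset: "W_set \<subseteq> {1..p+q}" "E_set \<subseteq> {1..p+q}" "P_set \<subseteq> {1..p+q}"
  using index_sets_subset by (auto simp: W_set_def E_set_def P_set_def)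

lemma ext_sets_finite: "finite W_set" "finite E_set" "finite P_set"
  using ext_sets_subset finite_index_set by blast+

lemma ext_sets_comb:
  "ext_sets = map (\<lambda>(x, y, z). comb P_set E_set W_set x y z)
     [(False, False, True), (False, True, False), (False, True, True), (True, False, False),
      (True, False, True), (True, True, False), (True, True, True)]"
  by (auto simp: ext_sets_def comb_def)

text \<open>With the empty set for the unit matrix the sets form a linear span, from which closure
  under products up to sign is immediate.\<close>

lemma insert_ext_sets: "insert {} (set ext_sets) = {comb P_set E_set W_set x y z |x y z. True}"
proof -
  have "comb P_set E_set W_set False False False = {}" by (simp add: comb_def)
  then have "T \<in> insert {} (set ext_sets) \<longleftrightarrow> (\<exists>x y z. T = comb P_set E_set W_set x y z)" for T
    unfolding ext_sets_comb
    by (simp only: ex_bool_eq list.map prod.case set_simps insert_iff empty_iff) argo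
  then show ?thesis by (simp only: set_eq_iff mem_Collect_eq simp_thms)
qed

lemma sym_diff_ext_sets:
  "S \<in> insert {} (set ext_sets) \<Longrightarrow> T \<in> insert {} (set ext_sets) \<Longrightarrow>
     sym_diff S T \<in> insert {} (set ext_sets)"
  unfolding insert_ext_sets by (clarsimp simp: sym_diff_comb) blast

lemma insert_ext_sets_subset: "S \<in> insert {} (set ext_sets) \<Longrightarrow> S \<subseteq> {1..p+q}"
  using ext_sets_subset unfolding ext_sets_def by auto

section \<open>The characters that implement the transformations\<close>

lemma comm_sign_W:
  assumes "S \<subseteq> {1..p+q}"
  shows "comm_sign W_set S = (-1) ^ card S"
proof -
  have "W_set \<inter> S = S" using assms by (auto simp: W_set_def)
  then show ?thesis using even_dim by (simp add: comm_sign_def neg_one_power_eq_iff W_set_def)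
qed

text \<open>This explains the parity rule in the choice of E and P. If \<open>card B\<close> is
  even, the factor \<open>card B * card S\<close> drops out. If it is odd, so is
  \<open>card A\<close>, because the total is even, and \<open>card S + card (S \<inter> A)\<close>
  has the parity of \<open>card (S \<inter> B)\<close>.\<close>

lemma comm_sign_complementary:
  assumes "A \<union> B = {1..p+q}" "A \<inter> B = {}" "S \<subseteq> {1..p+q}"
  shows "comm_sign (if even (card B) then B else A) S = (-1) ^ card (S \<inter> B)"
proof (cases "even (card B)")
  case True
  then show ?thesis by (simp add: comm_sign_def neg_one_power_eq_iff Int_commute)
next
  case False
  have fin: "finite A" "finite B" "finite S" using assms finite_index_set by blast+
  then have "card A + card B = p + q"
    using assms(1,2) card_Un_disjoint[of A B] by simp
  then have "odd (card A)" using False even_dim by presburger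
  have "S = (S \<inter> A) \<union> (S \<inter> B)" using assms(1,3) by blast
  then have "card S = card (S \<inter> A) + card (S \<inter> B)"
    using card_Un_disjoint[of "S \<inter> A" "S \<inter> B"] fin assms(2) by auto
  then show ?thesis
    using False \<open>odd (card A)\<close> by (auto simp add: comm_sign_def neg_one_power_eq_iff Int_commute)
qed

lemma comm_sign_E: "S \<subseteq> {1..p+q} \<Longrightarrow> comm_sign E_set S = (-1) ^ card (S \<inter> Sk_idx)"
  unfolding E_set_def using sym_or_skew index_sets_disjoint by (intro comm_sign_complementary) auto

lemma comm_sign_P: "S \<subseteq> {1..p+q} \<Longrightarrow> comm_sign P_set S = (-1) ^ card (S \<inter> Cx_idx)"
  unfolding P_set_def using real_or_complex index_sets_disjoint by (intro comm_sign_complementary) auto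

text \<open>Coefficients vanish outside the index range, so characters need to be compared only on
  its subsets, where they are known.\<close>

lemma clifford_carrier_eqI:
  assumes "a \<in> carrier (clifford p q)"
    and "\<And>S. S \<subseteq> {1..p+q} \<Longrightarrow> f S = (g S :: complex)"
  shows "f S * a S = g S * a S" "f S * cnj (a S) = g S * cnj (a S)"
  using assms by (cases "S \<subseteq> {1..p+q}"; simp add: clifford_def)+

lemmas comm_sign_simps = comm_sign_sym_diff_left[OF _ _ finite_index_set] ext_sets_finite
  comm_sign_W comm_sign_E comm_sign_P finite_sym_diff

lemma represents_W: "represents p q \<gamma> star (\<lambda>A. A) (e W_set)"
  using ext_sets_subset(1)
proof (rule represents_e[where b = "\<lambda>a. a"])
  show "star a S = comm_sign W_set S * a S" if "a \<in> carrier (clifford p q)" for a S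
    unfolding star_def by (rule clifford_carrier_eqI(1)[OF that]) (simp only: comm_sign_W)
qed simp

text \<open>The extra character \<open>f\<close> is trivial for reversion and
  \<open>(-1) ^ card S\<close> for its composition with the grade involution.\<close>

lemma represents_transpose:
  assumes "I \<subseteq> {1..p+q}" "\<And>S. S \<subseteq> {1..p+q} \<Longrightarrow> comm_sign I S = f S * (-1) ^ card (S \<inter> Sk_idx)"
    and "\<And>a. \<phi> a = (\<lambda>S. f S * tilde a S)"
  shows "represents p q \<gamma> \<phi> transpose_mat (e I)"
  using assms(1) rep_transpose
proof (rule represents_e)
  show "\<phi> a S = comm_sign I S * ((- 1) ^ card (S \<inter> Sk_idx) * tilde a S)"
    if "a \<in> carrier (clifford p q)" for a S
  proof -
    have "tilde a \<in> carrier (clifford p q)" using that by (simp add: tilde_def clifford_def)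
    then show ?thesis
      unfolding assms(3) mult.assoc[symmetric]
      by (rule clifford_carrier_eqI(1)) (simp add: assms(2) neg_one_power_mult_self mult.assoc)
  qed
qed

lemma represents_conj:
  assumes "I \<subseteq> {1..p+q}" "\<And>S. S \<subseteq> {1..p+q} \<Longrightarrow> comm_sign I S = f S * (-1) ^ card (S \<inter> Cx_idx)"
    and "\<And>a. \<phi> a = (\<lambda>S. f S * bar a S)"
  shows "represents p q \<gamma> \<phi> conj_mat (e I)"
  using assms(1) rep_conj
proof (rule represents_e)
  show "\<phi> a S = comm_sign I S * ((- 1) ^ card (S \<inter> Cx_idx) * cnj (a S))"
    if "a \<in> carrier (clifford p q)" for a S
    unfolding assms(3) bar_def mult.assoc[symmetric]
    by (rule clifford_carrier_eqI(2)[OF that]) (simp add: assms(2) neg_one_power_mult_self mult.assoc)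
qed

lemma represents_P_set: "represents p q \<gamma> bar conj_mat (e P_set)"
  using ext_sets_subset(3) by (rule represents_conj[where f = "\<lambda>S. 1"]) (auto simp: comm_sign_P)

lemma rep_transpose_conj:
  assumes a: "a \<in> carrier (clifford p q)"
  shows "(\<lambda>S. (-1) ^ card (S \<inter> Sk_idx) * (-1) ^ card (S \<inter> Cx_idx) * bar (tilde a) S) \<in> carrier (clifford p q) \<and>
    (transpose_mat \<circ> conj_mat) (\<gamma> a) = \<gamma> (\<lambda>S. (-1) ^ card (S \<inter> Sk_idx) * (-1) ^ card (S \<inter> Cx_idx) * bar (tilde a) S)"
  using rep_transpose[OF conjunct1[OF rep_conj[OF a]]] conjunct2[OF rep_conj[OF a]]
  by (simp add: tilde_def bar_def mult_ac)

lemma represents_transpose_conj: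
  assumes "I \<subseteq> {1..p+q}"
    and "\<And>S. S \<subseteq> {1..p+q} \<Longrightarrow> comm_sign I S = f S * ((-1) ^ card (S \<inter> Sk_idx) * (-1) ^ card (S \<inter> Cx_idx))"
    and "\<And>a. \<phi> a = (\<lambda>S. f S * bar (tilde a) S)"
  shows "represents p q \<gamma> \<phi> (transpose_mat \<circ> conj_mat) (e I)"
  using assms(1) rep_transpose_conj
proof (rule represents_e)
  show "\<phi> a S = comm_sign I S * ((-1) ^ card (S \<inter> Sk_idx) * (-1) ^ card (S \<inter> Cx_idx) * bar (tilde a) S)"
    if "a \<in> carrier (clifford p q)" for a S
  proof -
    have "bar (tilde a) \<in> carrier (clifford p q)" using that by (simp add: bar_def tilde_def clifford_def)
    moreover have "f S = comm_sign I S * ((-1) ^ card (S \<inter> Sk_idx) * (-1) ^ card (S \<inter> Cx_idx))"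
      if "S \<subseteq> {1..p+q}" for S
    proof -
      have "((-1) ^ card (S \<inter> Sk_idx) * (-1) ^ card (S \<inter> Cx_idx)) *
        ((-1) ^ card (S \<inter> Sk_idx) * (-1) ^ card (S \<inter> Cx_idx)) = (1 :: complex)"
        by (simp flip: power_add)
      then show ?thesis by (simp add: assms(2)[OF that] mult.assoc)
    qed
    ultimately have "f S * bar (tilde a) S =
        comm_sign I S * ((-1) ^ card (S \<inter> Sk_idx) * (-1) ^ card (S \<inter> Cx_idx)) * bar (tilde a) S"
      by (rule clifford_carrier_eqI(1))
    then show ?thesis by (simp only: assms(3) mult.assoc)
  qed
qed

text \<open>Characters multiply under symmetric difference. Those of W, E, P count all, the skew and
  the complex generators, so the products of these matrices implement the composite
  transformations.\<close>

lemma ext_matrices_ext_sets: "ext_matrices p q \<gamma> (map e ext_sets)"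
proof -
  note sub = ext_sets_subset
  have sub': "sym_diff E_set W_set \<subseteq> {1..p+q}" "sym_diff P_set W_set \<subseteq> {1..p+q}"
    "sym_diff P_set E_set \<subseteq> {1..p+q}" "sym_diff P_set (sym_diff E_set W_set) \<subseteq> {1..p+q}"
    using sub by blast+
  have 2: "represents p q \<gamma> tilde transpose_mat (e E_set)"
    using sub(2) by (rule represents_transpose[where f = "\<lambda>S. 1"]) (auto simp: comm_sign_E)
  have 3: "represents p q \<gamma> (tilde \<circ> star) transpose_mat (e (sym_diff E_set W_set))"
    using sub'(1) by (rule represents_transpose[where f = "\<lambda>S. (-1) ^ card S"])
      (simp only: comm_sign_simps mult.commute, auto simp: tilde_def star_def)
  have 5: "represents p q \<gamma> (bar \<circ> star) conj_mat (e (sym_diff P_set W_set))"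
    using sub'(2) by (rule represents_conj[where f = "\<lambda>S. (-1) ^ card S"])
      (simp only: comm_sign_simps mult.commute, auto simp: bar_def star_def)
  have 6: "represents p q \<gamma> (bar \<circ> tilde) (transpose_mat \<circ> conj_mat) (e (sym_diff P_set E_set))"
    using sub'(3) by (rule represents_transpose_conj[where f = "\<lambda>S. 1"])
      (simp only: comm_sign_simps mult.commute mult_1_left mult_1_right, auto simp: bar_def tilde_def)
  have 7: "represents p q \<gamma> (bar \<circ> tilde \<circ> star) (transpose_mat \<circ> conj_mat)
      (e (sym_diff P_set (sym_diff E_set W_set)))"
    using sub'(4) by (rule represents_transpose_conj[where f = "\<lambda>S. (-1) ^ card S"])
      (simp only: comm_sign_simps mult_ac, auto simp: bar_def tilde_def star_def)
  have prods: "\<forall>A\<in>set (map e ext_sets). \<exists>I\<subseteq>{1..p+q}. A =\<^sub>\<plusminus> spin_prod p q \<gamma> I"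
  proof
    fix A assume "A \<in> set (map e ext_sets)"
    then obtain I where "I \<in> insert {} (set ext_sets)" "A = e I" by auto
    then have "I \<subseteq> {1..p+q}" "A =\<^sub>\<plusminus> spin_prod p q \<gamma> I"
      using insert_ext_sets_subset by (auto simp: spin_prod_e eq_sign_refl)
    then show "\<exists>I\<subseteq>{1..p+q}. A =\<^sub>\<plusminus> spin_prod p q \<gamma> I" by blast
  qed
  have mult: "e (sym_diff S T) =\<^sub>\<plusminus> e S * e T" if "S \<subseteq> {1..p+q}" "T \<subseteq> {1..p+q}" for S T
    using e_sign_mult[OF that eq_sign_refl eq_sign_refl] by (auto simp: eq_sign_def)
  have X: "map e ext_sets = [e W_set, e E_set, e (sym_diff E_set W_set), e P_set, e (sym_diff P_set W_set),
    e (sym_diff P_set E_set), e (sym_diff P_set (sym_diff E_set W_set))]"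
    by (simp only: ext_sets_def list.map)
  have W: "e W_set =\<^sub>\<plusminus> spin_prod p q \<gamma> {1..p+q}"
    by (simp only: spin_prod_e W_set_def subset_refl eq_sign_refl)
  show ?thesis
    unfolding ext_matrices_def
    by ((rule exI)+, intro conjI, rule X, fact represents_W, fact 2, fact 3, fact represents_P_set, fact 5, fact 6, fact 7,
        fact prods, fact W, (rule mult; fact)+)
qed

text \<open>Ties an arbitrary list of matrices to the fixed index sets: W, E, P are prescribed up to
  sign, and the other four are products of them.\<close>

lemma ext_matrices_eq_ext_sets:
  assumes X: "ext_matrices p q \<gamma> X"
    and P: "X ! 3 =\<^sub>\<plusminus> spin_prod p q \<gamma> P_set" and E: "X ! 1 =\<^sub>\<plusminus> spin_prod p q \<gamma> E_set"
  shows "list_all2 (\<lambda>A S. A =\<^sub>\<plusminus> e S) X ext_sets"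
proof -
  obtain W E C P K S F where X_eq: "X = [W, E, C, P, K, S, F]"
    and W: "W =\<^sub>\<plusminus> spin_prod p q \<gamma> {1..p+q}"
    and rel: "C =\<^sub>\<plusminus> E * W" "K =\<^sub>\<plusminus> P * W" "S =\<^sub>\<plusminus> P * E" "F =\<^sub>\<plusminus> P * C"
    using X unfolding ext_matrices_def by blast
  note sub = ext_sets_subset
  have W': "W =\<^sub>\<plusminus> e W_set" and E': "E =\<^sub>\<plusminus> e E_set" and P': "P =\<^sub>\<plusminus> e P_set"
    using W assms(2,3) sub by (simp_all add: X_eq spin_prod_e W_set_def)
  have C': "C =\<^sub>\<plusminus> e (sym_diff E_set W_set)"
    using eq_sign_trans[OF rel(1) e_sign_mult[OF sub(2,1) E' W']] .
  have "sym_diff E_set W_set \<subseteq> {1..p+q}" using sub by blast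
  then have F': "F =\<^sub>\<plusminus> e (sym_diff P_set (sym_diff E_set W_set))"
    using eq_sign_trans[OF rel(4) e_sign_mult[OF sub(3) _ P' C']] by blast
  show ?thesis unfolding X_eq ext_sets_def
    using W' E' P' C' F' eq_sign_trans[OF rel(2) e_sign_mult[OF sub(3,1) P' W']]
      eq_sign_trans[OF rel(3) e_sign_mult[OF sub(3,2) P' E']]
    by (simp only: list_all2_Cons list.rel_inject list_all2_Nil simp_thms list_all2_Nil2)
qed

lemma Ext_e_sign:
  assumes "list_all2 (\<lambda>A S. A =\<^sub>\<plusminus> e S) X ext_sets"
  shows "A \<in> Ext p q X \<Longrightarrow> \<exists>S\<in>insert {} (set ext_sets). A =\<^sub>\<plusminus> e S"
    and "S \<in> insert {} (set ext_sets) \<Longrightarrow> \<exists>A\<in>Ext p q X. A =\<^sub>\<plusminus> e S"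
proof -
  have one: "1\<^sub>m N =\<^sub>\<plusminus> e {}" by (simp add: rep_one eq_sign_refl)
  show "\<exists>S\<in>insert {} (set ext_sets). A =\<^sub>\<plusminus> e S" if A: "A \<in> Ext p q X"
  proof (cases "A = 1\<^sub>m N")
    case False
    then obtain i where "i < length X" "A = X ! i" using A by (auto simp: Ext_def in_set_conv_nth)
    then have "A =\<^sub>\<plusminus> e (ext_sets ! i)" "ext_sets ! i \<in> set ext_sets"
      using list_all2_nthD[OF assms] list_all2_lengthD[OF assms] by (auto simp del: set_simps)
    then show ?thesis by blast
  qed (use one in blast)
  show "\<exists>A\<in>Ext p q X. A =\<^sub>\<plusminus> e S" if S: "S \<in> insert {} (set ext_sets)"
  proof (cases "S = {}")
    case False
    then obtain i where "i < length ext_sets" "S = ext_sets ! i" using S by (auto simp: in_set_conv_nth)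
    then have "X ! i =\<^sub>\<plusminus> e S" "X ! i \<in> set X"
      using list_all2_nthD2[OF assms] list_all2_lengthD[OF assms] by auto
    then show ?thesis unfolding Ext_def by blast
  qed (use one in \<open>simp add: Ext_def\<close>)
qed

lemma comm_sign_ext_sets:
  assumes "S \<subseteq> {1..p+q}" "comm_sign P_set S = 1" "comm_sign E_set S = 1" "comm_sign W_set S = 1"
    and "T \<in> insert {} (set ext_sets)"
  shows "comm_sign T S = 1"
proof -
  have "finite S" using assms(1) by (rule finite_index_set)
  moreover have "comm_sign {} S = 1" by (simp add: comm_sign_def)
  ultimately show ?thesis
    using assms(2-5) ext_sets_finite
    by (elim insertE; simp only: ext_sets_def set_simps) (auto simp: comm_sign_sym_diff_left)
qed

theorem signature_ext_iso:
  assumes X: "list_all2 (\<lambda>A S. A =\<^sub>\<plusminus> e S) X ext_sets"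
    and int: "of_int w = mono_sign p W_set W_set" "of_int \<epsilon> = mono_sign p E_set E_set"
      "of_int \<pi> = mono_sign p P_set P_set" "of_int a = comm_sign E_set W_set"
      "of_int b = comm_sign P_set W_set" "of_int d = comm_sign P_set E_set"
    and s: "s = sig_list w \<epsilon> \<pi> a b d"
  shows "has_signature p q X s" "ext_iso p q X (a = 1 \<and> b = 1 \<and> d = 1, count_list s 1, count_list s (-1))"
proof -
  have pm: "u \<in> {1, -1}" if "of_int u = x" "x = 1 \<or> x = (-1 :: complex)" for u :: int and x
    using that by (metis insertCI of_int_1 of_int_eq_iff of_int_minus)
  have len: "length X = 7" "length s = 7"
    using list_all2_lengthD[OF X] by (simp_all add: ext_sets_def s sig_list_def)
  have sub: "ext_sets ! i \<subseteq> {1..p+q}" and sign: "X ! i =\<^sub>\<plusminus> e (ext_sets ! i)" if "i < 7" for i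
    using that X len insert_ext_sets_subset
    by (auto simp: list_all2_conv_all_nth)
  have sq: "list_all2 (\<lambda>S u. mono_sign p S S = of_int u) ext_sets s"
    using ext_sets_finite unfolding ext_sets_def s sig_list_def
    by (simp add: mono_sign_sym_diff_self comm_sign_sym_diff_right int mult_ac)
  then have sq': "mono_sign p (ext_sets ! i) (ext_sets ! i) = of_int (s ! i)" if "i < 7" for i
    using that len by (simp add: list_all2_conv_all_nth)
  have XX: "X ! i * X ! i = of_int (s ! i) \<cdot>\<^sub>m 1\<^sub>m N" if "i < 7" for i
    using e_sign_square[OF sub[OF that] sign[OF that]] sq'[OF that] by simp
  have s_pm: "s ! i \<in> {1, -1}" if "i < 7" for i
    using pm[OF sq'[OF that, symmetric] mono_sign_cases] .
  then have set_s: "set s \<subseteq> {1, -1}" using len by (metis in_set_conv_nth subsetI)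
  then show "has_signature p q X s"
    unfolding has_signature_def using len XX by simp
  \<comment> \<open>Keeps the two possible squares apart, so that counting equal squares is the same
    as counting signs.\<close>
  have one: "(1\<^sub>m N :: complex mat) \<noteq> - 1\<^sub>m N" using e_neq_uminus[of "{}"] by (simp add: rep_one)
  have cnt: "card {i. i < 7 \<and> s ! i = u} = count_list s u" for u
    using len(2) count_list_eq_length_filter[of s u] length_filter_conv_card[of "(=) u" s]
    by (simp add: eq_commute)
  have plus: "{i. i < length X \<and> X ! i * X ! i = 1\<^sub>m N} = {i. i < 7 \<and> s ! i = 1}"
  proof (intro Collect_cong conj_cong)
    fix i :: nat assume i: "i < 7"
    show "X ! i * X ! i = 1\<^sub>m N \<longleftrightarrow> s ! i = 1"
      using s_pm[OF i] one unfolding XX[OF i] by (auto simp: one_smult_mat uminus_smult_mat)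
  qed (simp add: len)
  have minus: "{i. i < length X \<and> X ! i * X ! i = - 1\<^sub>m N} = {i. i < 7 \<and> s ! i = -1}"
  proof (intro Collect_cong conj_cong)
    fix i :: nat assume i: "i < 7"
    show "X ! i * X ! i = - 1\<^sub>m N \<longleftrightarrow> s ! i = -1"
      using s_pm[OF i] one unfolding XX[OF i] by (auto simp: one_smult_mat uminus_smult_mat)
  qed (simp add: len)
  have closed: "\<exists>D\<in>Ext p q X. A * B =\<^sub>\<plusminus> D" if AB: "A \<in> Ext p q X" "B \<in> Ext p q X" for A B
  proof -
    obtain S T where S: "S \<in> insert {} (set ext_sets)" "A =\<^sub>\<plusminus> e S"
      and T: "T \<in> insert {} (set ext_sets)" "B =\<^sub>\<plusminus> e T"
      using Ext_e_sign(1)[OF X] AB by meson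
    have "A * B =\<^sub>\<plusminus> e (sym_diff S T)"
      using S T insert_ext_sets_subset by (intro e_sign_mult) auto
    moreover obtain D where "D \<in> Ext p q X" "D =\<^sub>\<plusminus> e (sym_diff S T)"
      using Ext_e_sign(2)[OF X sym_diff_ext_sets[OF S(1) T(1)]] by blast
    ultimately show ?thesis unfolding eq_sign_def by (metis uminus_uminus_mat)
  qed
  have comm: "(\<forall>A\<in>Ext p q X. \<forall>B\<in>Ext p q X. A * B = B * A) \<longleftrightarrow> a = 1 \<and> b = 1 \<and> d = 1"
  proof
    assume c: "\<forall>A\<in>Ext p q X. \<forall>B\<in>Ext p q X. A * B = B * A"
    have "comm_sign (ext_sets ! i) (ext_sets ! j) = 1" if "i < 7" "j < 7" for i j
    proof -
      have "X ! i \<in> Ext p q X" "X ! j \<in> Ext p q X" using that len by (simp_all add: Ext_def)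
      then show ?thesis
        using e_sign_commute[OF sub[OF that(1)] sub[OF that(2)] sign[OF that(1)] sign[OF that(2)]] c
        by blast
    qed
    \<comment> \<open>Positions 0, 1, 3 hold W, E, P; these are the three pairs of generators of the
      span.\<close>
    from this[of 1 0] this[of 3 0] this[of 3 1] show "a = 1 \<and> b = 1 \<and> d = 1"
      using int(4-6) by (simp add: ext_sets_def)
  next
    assume "a = 1 \<and> b = 1 \<and> d = 1"
    then have abd: "comm_sign E_set W_set = 1" "comm_sign P_set W_set = 1" "comm_sign P_set E_set = 1"
      using int(4-6) by simp_all
    then have abd': "comm_sign E_set P_set = 1" "comm_sign W_set P_set = 1" "comm_sign W_set E_set = 1"
      by (simp_all only: comm_sign_commute[of W_set] comm_sign_commute[of E_set P_set])
    have all: "comm_sign S T = 1" if S: "S \<in> insert {} (set ext_sets)" and T: "T \<in> insert {} (set ext_sets)" for S T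
    proof (rule comm_sign_ext_sets[OF insert_ext_sets_subset[OF T] _ _ _ S])
      show "comm_sign P_set T = 1"
        using comm_sign_ext_sets[OF ext_sets_subset(3) comm_sign_self abd'(1,2) T] by (metis comm_sign_commute)
      show "comm_sign E_set T = 1"
        using comm_sign_ext_sets[OF ext_sets_subset(2) abd(3) comm_sign_self abd'(3) T] by (metis comm_sign_commute)
      show "comm_sign W_set T = 1"
        using comm_sign_ext_sets[OF ext_sets_subset(1) abd(2) abd(1) comm_sign_self T] by (metis comm_sign_commute)
    qed
    show "\<forall>A\<in>Ext p q X. \<forall>B\<in>Ext p q X. A * B = B * A"
    proof (intro ballI)
      fix A B assume "A \<in> Ext p q X" "B \<in> Ext p q X"
      then obtain S T where "S \<in> insert {} (set ext_sets)" "A =\<^sub>\<plusminus> e S"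
        "T \<in> insert {} (set ext_sets)" "B =\<^sub>\<plusminus> e T"
        using Ext_e_sign(1)[OF X] by meson
      then show "A * B = B * A"
        using e_sign_commute[of S T A B] all insert_ext_sets_subset by blast
    qed
  qed
  show "ext_iso p q X (a = 1 \<and> b = 1 \<and> d = 1, count_list s 1, count_list s (-1))"
    unfolding ext_iso_def plus minus cnt comm using closed by simp
qed

end

lemma even_spinbasisI:
  assumes "has_spinbasis p q \<gamma>" "even (p + q)"
  shows "even_spinbasis p q \<gamma>"
  using assms unfolding has_spinbasis_def
  by (simp add: even_spinbasis_def even_spinbasis_axioms_def spinbasis_def spinbasis_axioms_def spinor_def)

section \<open>Spinor representations from anticommuting matrices\<close>

definition mtrace :: "complex mat \<Rightarrow> complex" where
  "mtrace A = (\<Sum>i<dim_row A. A $$ (i, i))"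

lemma mtrace_mult:
  assumes "A \<in> carrier_mat n n" "B \<in> carrier_mat n n"
  shows "mtrace (A * B) = (\<Sum>i<n. \<Sum>j<n. A $$ (i, j) * B $$ (j, i))"
  using assms by (simp add: mtrace_def scalar_prod_def atLeast0LessThan)

lemma mtrace_commute:
  assumes "A \<in> carrier_mat n n" "B \<in> carrier_mat n n"
  shows "mtrace (A * B) = mtrace (B * A)"
  unfolding mtrace_mult[OF assms] mtrace_mult[OF assms(2,1)]
  by (subst sum.swap) (simp add: mult.commute)

lemma mtrace_smult: "A \<in> carrier_mat n n \<Longrightarrow> mtrace (c \<cdot>\<^sub>m A) = c * mtrace A"
  by (simp add: mtrace_def sum_distrib_left)

lemma clifford_mult: "(a \<otimes>\<^bsub>clifford p q\<^esub> b) U = (\<Sum>S\<in>Pow {1..p+q}. \<Sum>T\<in>Pow {1..p+q}.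
    if sym_diff S T = U then mono_sign p S T * a S * b T else 0)"
  by (simp only: clifford_def monoid.simps)

lemma mono_sign_insert:
  assumes "finite A" "b \<notin> A"
  shows "mono_sign p {i} (insert b A) = gen_sign p i b * mono_sign p {i} A"
  using assms by (simp add: mono_sign_prod)

locale clifford_gens =
  fixes p q N :: nat and E :: "nat \<Rightarrow> complex mat"
  assumes even_dim: "even (p + q)" and N: "N = spin_dim p q"
    and E_carrier: "\<And>i. i \<in> {1..p+q} \<Longrightarrow> E i \<in> carrier_mat N N"
    and E_square: "\<And>i. i \<in> {1..p+q} \<Longrightarrow> E i * E i = (if i \<le> p then 1 else -1) \<cdot>\<^sub>m 1\<^sub>m N"
    and E_anticommute: "\<And>i j. i \<in> {1..p+q} \<Longrightarrow> j \<in> {1..p+q} \<Longrightarrow> i \<noteq> j \<Longrightarrow>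
      E i * E j = (-1) \<cdot>\<^sub>m (E j * E i)"
begin

definition ES :: "nat set \<Rightarrow> complex mat" where
  "ES S = foldr (*) (map E (sorted_list_of_set S)) (1\<^sub>m N)"

lemma ES_empty: "ES {} = 1\<^sub>m N"
  by (simp add: ES_def)

lemma ES_insert: "finite A \<Longrightarrow> \<forall>a\<in>A. b < a \<Longrightarrow> ES (insert b A) = E b * ES A"
  unfolding ES_def by (simp add: sorted_list_of_set_insert_below del: sorted_list_of_set_insert_remove)

lemma ES_carrier [simp]:
  assumes "S \<subseteq> {1..p+q}"
  shows "ES S \<in> carrier_mat N N"
  using finite_index_set[OF assms] assms
proof (induction S rule: finite_linorder_min_induct)
  case (insert b A)
  then have "E b \<in> carrier_mat N N" "ES A \<in> carrier_mat N N" using E_carrier by simp_all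
  then show ?case using insert by (simp add: ES_insert)
qed (simp add: ES_empty)

lemma ES_dim [simp]: "S \<subseteq> {1..p+q} \<Longrightarrow> dim_row (ES S) = N" "S \<subseteq> {1..p+q} \<Longrightarrow> dim_col (ES S) = N"
  using ES_carrier by blast+

lemma ES_singleton: "i \<in> {1..p+q} \<Longrightarrow> ES {i} = E i"
  using ES_insert[of "{}" i] E_carrier[of i] by (simp add: ES_empty)

text \<open>One round of insertion sort: the new factor stays in front, cancels against an equal
  one, or passes the smallest generator at the cost of a sign.\<close>

lemma E_mult_ES:
  assumes i: "i \<in> {1..p+q}" and S: "S \<subseteq> {1..p+q}"
  shows "E i * ES S = mono_sign p {i} S \<cdot>\<^sub>m ES (sym_diff {i} S)"
  using finite_index_set[OF S] S
proof (induction S rule: finite_linorder_min_induct)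
  case empty
  show ?case
    using E_carrier[OF i] ES_singleton[OF i] by (simp add: mono_sign_below one_smult_mat ES_empty)
next
  case (insert b A)
  have b: "b \<in> {1..p+q}" and A: "A \<subseteq> {1..p+q}" using insert.prems by auto
  have bA: "b \<notin> A" using insert.hyps by auto
  note c = E_carrier[OF i] E_carrier[OF b] ES_carrier[OF A]
  consider "i < b" | "i = b" | "b < i" by linarith
  then show ?case
  proof cases
    case 1
    then have lt: "\<forall>a\<in>insert b A. i < a" using insert.hyps by auto
    then have "sym_diff {i} (insert b A) = insert i (insert b A)" by auto
    then show ?thesis
      using ES_insert[OF _ lt] insert.hyps(1) mono_sign_below[OF lt] by (simp add: one_smult_mat)
  next
    case 2
    have "sym_diff {i} (insert b A) = A" using 2 bA by auto
    moreover have "mono_sign p {i} (insert b A) = gen_sign p b b"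
      using 2 mono_sign_insert[OF insert.hyps(1) bA] mono_sign_below[OF insert.hyps(2)] by simp
    moreover have "E b * (E b * ES A) = (E b * E b) * ES A"
      using c by simp
    moreover have "(x \<cdot>\<^sub>m 1\<^sub>m N) * ES A = x \<cdot>\<^sub>m ES A" for x
      using c(3) by (simp add: mult_smult_assoc_mat[of _ N N _ N])
    ultimately show ?thesis
      using 2 by (simp add: ES_insert[OF insert.hyps(1,2)] E_square[OF b] gen_sign_def)
  next
    case 3
    have sd: "sym_diff {i} (insert b A) = insert b (sym_diff {i} A)" using 3 bA by auto
    have lt: "\<forall>a\<in>sym_diff {i} A. b < a" using 3 insert.hyps(2) by auto
    have fin: "finite (sym_diff {i} A)" using insert.hyps(1) by simp
    have sub: "sym_diff {i} A \<subseteq> {1..p+q}" using i A by auto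
    have sign: "mono_sign p {i} (insert b A) = - mono_sign p {i} A"
      using 3 mono_sign_insert[OF insert.hyps(1) bA] by (simp add: gen_sign_def)
    have "E i * ES (insert b A) = (E i * E b) * ES A"
      using c by (simp add: ES_insert[OF insert.hyps(1,2)])
    also have "\<dots> = (-1) \<cdot>\<^sub>m (E b * (E i * ES A))"
      using 3 c E_anticommute[OF i b]
      by (simp add: mult_smult_assoc_mat[of _ N N _ N])
    also have "\<dots> = (- mono_sign p {i} A) \<cdot>\<^sub>m (E b * ES (sym_diff {i} A))"
      unfolding insert.IH[OF A]
      by (simp only: mult_smult_distrib[OF c(2) ES_carrier[OF sub]] smult_smult_mat mult_minus1)
    also have "E b * ES (sym_diff {i} A) = ES (insert b (sym_diff {i} A))"
      by (rule ES_insert[OF fin lt, symmetric])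
    finally show ?thesis unfolding sd sign .
  qed
qed

lemma ES_mult:
  assumes S: "S \<subseteq> {1..p+q}" and T: "T \<subseteq> {1..p+q}"
  shows "ES S * ES T = mono_sign p S T \<cdot>\<^sub>m ES (sym_diff S T)"
  using finite_index_set[OF S] S
proof (induction S rule: finite_linorder_min_induct)
  case empty
  have "mono_sign p {} T = 1" by (simp add: mono_sign_def)
  then show ?case using ES_carrier[OF T] by (simp add: ES_empty one_smult_mat)
next
  case (insert b A)
  have b: "b \<in> {1..p+q}" and A: "A \<subseteq> {1..p+q}" using insert.prems by auto
  have bA: "b \<notin> A" using insert.hyps by auto
  have fin: "finite A" "finite T" using insert.hyps(1) finite_index_set[OF T] .
  have sub: "sym_diff A T \<subseteq> {1..p+q}" using A T by auto
  note c = E_carrier[OF b] ES_carrier[OF A] ES_carrier[OF T] ES_carrier[OF sub]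
  have ins: "insert b A = sym_diff {b} A" using bA by auto
  have sign: "mono_sign p (insert b A) T = mono_sign p A T * mono_sign p {b} (sym_diff A T)"
    unfolding ins
    using fin mono_sign_below[OF insert.hyps(2), of p]
    by (simp only: mono_sign_sym_diff_left mono_sign_sym_diff_right finite.intros mult_ac mult_1_left)
  have sd: "sym_diff (insert b A) T = sym_diff {b} (sym_diff A T)" using bA by auto
  have "ES (insert b A) * ES T = E b * (ES A * ES T)"
    using c by (simp add: ES_insert[OF insert.hyps(1,2)])
  also have "\<dots> = mono_sign p A T \<cdot>\<^sub>m (E b * ES (sym_diff A T))"
    unfolding insert.IH[OF A] by (rule mult_smult_distrib[OF c(1,4)])
  also have "\<dots> = (mono_sign p A T * mono_sign p {b} (sym_diff A T)) \<cdot>\<^sub>m ES (sym_diff {b} (sym_diff A T))"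
    unfolding E_mult_ES[OF b sub] smult_smult_mat ..
  finally show ?case unfolding sd sign .
qed

text \<open>Every nonempty monomial anticommutes with some generator, because the number of generators
  is even.\<close>

lemma mtrace_ES:
  assumes S: "S \<subseteq> {1..p+q}" "S \<noteq> {}"
  shows "mtrace (ES S) = 0"
proof -
  have finS: "finite S" by (rule finite_index_set[OF S(1)])
  obtain i where i: "i \<in> {1..p+q}" and com: "comm_sign {i} S = -1"
  proof (cases "even (card S)")
    case True
    obtain i where "i \<in> S" using S(2) by auto
    then show thesis using S(1) True by (intro that[of i]) (auto simp: comm_sign_def)
  next
    case False
    then have "S \<noteq> {1..p+q}" using even_dim by auto
    then obtain i where "i \<in> {1..p+q}" "i \<notin> S" using S(1) by blast
    then show thesis using False by (intro that[of i]) (auto simp: comm_sign_def)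
  qed
  let ?T = "sym_diff {i} S"
  have sub: "{i} \<subseteq> {1..p+q}" "?T \<subseteq> {1..p+q}" using i S(1) by auto
  have sd: "sym_diff {i} ?T = S" "sym_diff ?T {i} = S" by auto
  have "comm_sign {i} ?T = -1"
    using com comm_sign_sym_diff_right[of "{i}" S "{i}"] finS by (simp add: comm_sign_def)
  then have sign: "mono_sign p {i} ?T = - mono_sign p ?T {i}"
    using mono_sign_commute[of "{i}" ?T p] finS by simp
  \<comment> \<open>Up to sign, \<open>ES S\<close> is the product of the anticommuting
    \<open>ES {i}\<close> and \<open>ES ?T\<close>; invariance of the trace under swapping them
    makes it equal to its own negative.\<close>
  have "mtrace (ES {i} * ES ?T) = mtrace (ES ?T * ES {i})"
    by (rule mtrace_commute[OF ES_carrier[OF sub(1)] ES_carrier[OF sub(2)]])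
  then have "mono_sign p {i} ?T * mtrace (ES S) = mono_sign p ?T {i} * mtrace (ES S)"
    unfolding ES_mult[OF sub] ES_mult[OF sub(2,1)] sd mtrace_smult[OF ES_carrier[OF S(1)]] .
  then show ?thesis using sign mono_sign_cases[of p ?T "{i}"] by auto
qed

section \<open>Trace orthogonality and the isomorphism with the matrix algebra\<close>

lemma ES_orthogonal:
  assumes S: "S \<subseteq> {1..p+q}" and T: "T \<subseteq> {1..p+q}"
  shows "(\<Sum>i<N. \<Sum>j<N. ES S $$ (i, j) * ES T $$ (j, i)) = (if S = T then of_nat N * mono_sign p S S else 0)"
proof -
  have sub: "sym_diff S T \<subseteq> {1..p+q}" using S T by blast
  have "(\<Sum>i<N. \<Sum>j<N. ES S $$ (i, j) * ES T $$ (j, i)) = mono_sign p S T * mtrace (ES (sym_diff S T))"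
    unfolding mtrace_mult[OF ES_carrier[OF S] ES_carrier[OF T], symmetric] ES_mult[OF S T]
    by (rule mtrace_smult[OF ES_carrier[OF sub]])
  moreover have "sym_diff S T = {} \<longleftrightarrow> S = T" by blast
  moreover have "mtrace (ES {}) = of_nat N" by (simp add: ES_empty mtrace_def)
  ultimately show ?thesis using mtrace_ES[OF sub] by auto
qed

text \<open>Normalizes the trace pairing: \<open>coeff S\<close> times \<open>ES S\<close> is the
  element dual to \<open>ES S\<close>.\<close>

definition coeff :: "nat set \<Rightarrow> complex" where
  "coeff S = mono_sign p S S / of_nat N"

lemma N_pos: "N > 0"
  by (simp add: N)

text \<open>The orthogonality relations say that one of two square matrices is the inverse of the other;
  completeness is the same statement with the factors exchanged.\<close>

lemma ES_complete:
  assumes "r < N" "c < N" "r' < N" "c' < N"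
  shows "(\<Sum>S\<in>Pow {1..p+q}. ES S $$ (r, c) * (coeff S * ES S $$ (c', r'))) =
    (if r = r' \<and> c = c' then 1 else 0)"
proof -
  let ?I = "{..<N} \<times> {..<N}" and ?P = "Pow {1..p+q}" and ?d = "N * N"
  obtain k where "p + q = 2 * k" using even_dim by (rule evenE)
  \<comment> \<open>There are as many monomials as matrix positions, so the two matrices below are
    square and a left inverse is a right inverse.\<close>
  then have "2 ^ (p + q) = N * N" by (simp add: N mult_2 power_add)
  then have card: "card ?P = ?d" "card ?I = ?d" by (simp_all add: card_Pow)
  obtain h where h: "bij_betw h {0..<?d} ?P"
    using ex_bij_betw_nat_finite[of ?P] card(1) by auto
  obtain g where g: "bij_betw g {0..<?d} ?I"
    using ex_bij_betw_nat_finite[of ?I] card(2) by auto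
  define A where "A = mat ?d ?d (\<lambda>(s, x). coeff (h s) * ES (h s) $$ (snd (g x), fst (g x)))"
  define B where "B = mat ?d ?d (\<lambda>(x, t). ES (h t) $$ g x)"
  have AB: "A \<in> carrier_mat ?d ?d" "B \<in> carrier_mat ?d ?d" by (simp_all add: A_def B_def)
  have "A * B = 1\<^sub>m ?d"
  proof (rule eq_matI)
    fix s t assume "s < dim_row (1\<^sub>m ?d)" "t < dim_col (1\<^sub>m ?d)"
    then have st: "s < ?d" "t < ?d" by simp_all
    then have hs: "h s \<subseteq> {1..p+q}" "h t \<subseteq> {1..p+q}" and inj: "h s = h t \<longleftrightarrow> s = t"
      using bij_betwE[OF h] inj_on_eq_iff[OF bij_betw_imp_inj_on[OF h]] by simp_all
    have "(A * B) $$ (s, t) = (\<Sum>x\<in>{0..<?d}. coeff (h s) * ES (h s) $$ (snd (g x), fst (g x)) * ES (h t) $$ g x)"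
      using st by (simp add: A_def B_def scalar_prod_def)
    also have "\<dots> = (\<Sum>y\<in>?I. coeff (h s) * ES (h s) $$ (snd y, fst y) * ES (h t) $$ y)"
      by (rule sum.reindex_bij_betw[OF g])
    also have "\<dots> = coeff (h s) * (\<Sum>j<N. \<Sum>i<N. ES (h s) $$ (i, j) * ES (h t) $$ (j, i))"
      by (simp add: sum.cartesian_product case_prod_beta sum_distrib_left mult.assoc)
    also have "\<dots> = coeff (h s) * (if h s = h t then of_nat N * mono_sign p (h s) (h s) else 0)"
      by (subst sum.swap) (simp only: ES_orthogonal[OF hs])
    also have "\<dots> = (if s = t then 1 else 0)"
      using N_pos mono_sign_square[of p "h t" "h t"] by (simp add: inj coeff_def)
    finally show "(A * B) $$ (s, t) = 1\<^sub>m ?d $$ (s, t)" using st by simp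
  qed (use AB in auto)
  then have BA: "B * A = 1\<^sub>m ?d" by (rule mat_mult_left_right_inverse[OF AB])
  obtain x where x: "x < ?d" "g x = (r, c)"
    using g assms(1,2) unfolding bij_betw_def by (metis (no_types, lifting) SigmaI atLeastLessThan_iff imageE lessThan_iff)
  obtain y where y: "y < ?d" "g y = (r', c')"
    using g assms(3,4) unfolding bij_betw_def by (metis (no_types, lifting) SigmaI atLeastLessThan_iff imageE lessThan_iff)
  have xy: "x = y \<longleftrightarrow> r = r' \<and> c = c'"
    using x y inj_on_eq_iff[OF bij_betw_imp_inj_on[OF g], of x y] by simp
  have "(\<Sum>S\<in>?P. ES S $$ (r, c) * (coeff S * ES S $$ (c', r'))) =
     (\<Sum>s\<in>{0..<?d}. ES (h s) $$ (r, c) * (coeff (h s) * ES (h s) $$ (c', r')))"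
    by (rule sum.reindex_bij_betw[OF h, symmetric])
  also have "\<dots> = (B * A) $$ (x, y)"
    using x y by (simp add: A_def B_def scalar_prod_def)
  finally show ?thesis using x y xy by (simp add: BA)
qed

definition rep :: "cliff \<Rightarrow> complex mat" where
  "rep a = mat N N (\<lambda>(r, c). \<Sum>S\<in>Pow {1..p+q}. a S * ES S $$ (r, c))"

lemma rep_carrier: "rep a \<in> carrier_mat N N"
  by (simp add: rep_def)

lemma rep_index:
  "r < N \<Longrightarrow> c < N \<Longrightarrow> rep a $$ (r, c) = (\<Sum>S\<in>Pow {1..p+q}. a S * ES S $$ (r, c))"
  by (simp add: rep_def)

lemma rep_monomial: "S \<subseteq> {1..p+q} \<Longrightarrow> rep (monomial S) = ES S"
  by (intro eq_matI) (auto simp: rep_def monomial_def if_distrib[of "\<lambda>x. x * _"] cong: if_cong)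

text \<open>Pairing with the dual basis recovers each coefficient, which gives injectivity.\<close>

lemma rep_coeff:
  assumes "T \<subseteq> {1..p+q}"
  shows "coeff T * (\<Sum>i<N. \<Sum>j<N. ES T $$ (i, j) * rep a $$ (j, i)) = a T"
proof -
  have "(\<Sum>i<N. \<Sum>j<N. ES T $$ (i, j) * rep a $$ (j, i)) =
    (\<Sum>i<N. \<Sum>j<N. \<Sum>S\<in>Pow {1..p+q}. a S * (ES T $$ (i, j) * ES S $$ (j, i)))"
    by (simp add: rep_def sum_distrib_left mult.left_commute)
  also have "\<dots> = (\<Sum>i<N. \<Sum>S\<in>Pow {1..p+q}. \<Sum>j<N. a S * (ES T $$ (i, j) * ES S $$ (j, i)))"
    by (intro sum.cong refl sum.swap)
  also have "\<dots> = (\<Sum>S\<in>Pow {1..p+q}. a S * (\<Sum>i<N. \<Sum>j<N. ES T $$ (i, j) * ES S $$ (j, i)))"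
    by (subst sum.swap) (simp add: sum_distrib_left)
  also have "\<dots> = (\<Sum>S\<in>Pow {1..p+q}. if S = T then a T * (of_nat N * mono_sign p T T) else 0)"
    by (intro sum.cong refl) (auto simp: ES_orthogonal[OF assms])
  also have "\<dots> = a T * (of_nat N * mono_sign p T T)"
    using assms by (simp only: sum.delta finite_Pow_iff finite_atLeastAtMost Pow_iff if_True)
  finally show ?thesis
    using N_pos mono_sign_square[of p T T] by (simp add: coeff_def)
qed

lemma rep_surj:
  assumes M: "M \<in> carrier_mat N N"
  obtains a where "a \<in> carrier (clifford p q)" "rep a = M"
proof
  \<comment> \<open>The coefficients of \<open>M\<close> against the dual basis, extended by 0 to
    stay in the carrier; completeness then reconstructs every entry.\<close>
  define a where "a = (\<lambda>S. if S \<in> Pow {1..p+q} then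
     (\<Sum>r'<N. \<Sum>c'<N. M $$ (r', c') * (coeff S * ES S $$ (c', r'))) else 0)"
  show "a \<in> carrier (clifford p q)" by (auto simp: a_def clifford_def)
  show "rep a = M"
  proof (rule eq_matI)
    fix r c assume "r < dim_row M" "c < dim_col M"
    then have rc: "r < N" "c < N" using M by auto
    have "rep a $$ (r, c) = (\<Sum>S\<in>Pow {1..p+q}. \<Sum>r'<N. \<Sum>c'<N.
       M $$ (r', c') * (ES S $$ (r, c) * (coeff S * ES S $$ (c', r'))))"
      unfolding rep_index[OF rc]
      by (rule sum.cong[OF refl]) (simp add: a_def sum_distrib_right sum_distrib_left mult_ac)
    also have "\<dots> = (\<Sum>r'<N. \<Sum>S\<in>Pow {1..p+q}. \<Sum>c'<N.
       M $$ (r', c') * (ES S $$ (r, c) * (coeff S * ES S $$ (c', r'))))"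
      by (rule sum.swap)
    also have "\<dots> = (\<Sum>r'<N. \<Sum>c'<N. \<Sum>S\<in>Pow {1..p+q}.
       M $$ (r', c') * (ES S $$ (r, c) * (coeff S * ES S $$ (c', r'))))"
      by (intro sum.cong refl sum.swap)
    also have "\<dots> = (\<Sum>r'<N. \<Sum>c'<N. M $$ (r', c') * (if r = r' \<and> c = c' then 1 else 0))"
      by (intro sum.cong refl) (simp only: ES_complete[OF rc] lessThan_iff flip: sum_distrib_left)
    also have "\<dots> = (\<Sum>r'<N. if r' = r then (\<Sum>c'<N. if c' = c then M $$ (r', c') else 0) else 0)"
    proof (rule sum.cong[OF refl])
      show "(\<Sum>c'<N. M $$ (r', c') * (if r = r' \<and> c = c' then 1 else 0)) =
        (if r' = r then (\<Sum>c'<N. if c' = c then M $$ (r', c') else 0) else 0)" for r'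
      proof (cases "r' = r")
        case True
        then show ?thesis by (simp only: refl if_True simp_thms) (rule sum.cong, auto)
      qed simp
    qed
    also have "\<dots> = M $$ (r, c)"
      using rc by (simp only: sum.delta finite_lessThan lessThan_iff if_True)
    finally show "rep a $$ (r, c) = M $$ (r, c)" .
  qed (use M in \<open>auto simp: rep_def\<close>)
qed

lemma rep_mult: "rep (a \<otimes>\<^bsub>clifford p q\<^esub> b) = rep a * rep b"
proof (rule eq_matI)
  let ?P = "Pow {1..p+q}"
  fix r c assume "r < dim_row (rep a * rep b)" "c < dim_col (rep a * rep b)"
  then have rc: "r < N" "c < N" by (simp_all add: rep_def)
  have "rep (a \<otimes>\<^bsub>clifford p q\<^esub> b) $$ (r, c) = (\<Sum>U\<in>?P. \<Sum>S\<in>?P. \<Sum>T\<in>?P.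
     (if sym_diff S T = U then mono_sign p S T * a S * b T else 0) * ES U $$ (r, c))"
    by (simp only: rep_index[OF rc] clifford_mult sum_distrib_right)
  also have "\<dots> = (\<Sum>S\<in>?P. \<Sum>U\<in>?P. \<Sum>T\<in>?P.
     (if sym_diff S T = U then mono_sign p S T * a S * b T else 0) * ES U $$ (r, c))"
    by (rule sum.swap)
  also have "\<dots> = (\<Sum>S\<in>?P. \<Sum>T\<in>?P. \<Sum>U\<in>?P.
     (if sym_diff S T = U then mono_sign p S T * a S * b T else 0) * ES U $$ (r, c))"
    by (intro sum.cong refl sum.swap)
  also have "\<dots> = (\<Sum>S\<in>?P. \<Sum>T\<in>?P. a S * b T * (\<Sum>k<N. ES S $$ (r, k) * ES T $$ (k, c)))"
  proof (intro sum.cong refl)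
    fix S T assume "S \<in> ?P" "T \<in> ?P"
    then have S: "S \<subseteq> {1..p+q}" and T: "T \<subseteq> {1..p+q}" and U: "sym_diff S T \<in> ?P" by auto
    have "(\<Sum>U\<in>?P. (if sym_diff S T = U then mono_sign p S T * a S * b T else 0) * ES U $$ (r, c)) =
      (\<Sum>U\<in>?P. if sym_diff S T = U then mono_sign p S T * a S * b T * ES U $$ (r, c) else 0)"
      by (intro sum.cong refl) simp
    also have "\<dots> = mono_sign p S T * a S * b T * ES (sym_diff S T) $$ (r, c)"
      using U by (simp only: sum.delta' finite_Pow_iff finite_atLeastAtMost if_True)
    also have "\<dots> = a S * b T * (mono_sign p S T \<cdot>\<^sub>m ES (sym_diff S T)) $$ (r, c)"
      using ES_dim[of "sym_diff S T"] U rc by (simp only: Pow_iff index_smult_mat) (simp only: mult_ac)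
    also have "\<dots> = a S * b T * (ES S * ES T) $$ (r, c)" by (simp only: ES_mult[OF S T])
    also have "(ES S * ES T) $$ (r, c) = (\<Sum>k<N. ES S $$ (r, k) * ES T $$ (k, c))"
      using ES_carrier[OF S] ES_carrier[OF T] rc by (simp add: scalar_prod_def atLeast0LessThan)
    finally show "(\<Sum>U\<in>?P. (if sym_diff S T = U then mono_sign p S T * a S * b T else 0) * ES U $$ (r, c)) =
      a S * b T * (\<Sum>k<N. ES S $$ (r, k) * ES T $$ (k, c))" .
  qed
  also have "\<dots> = (\<Sum>S\<in>?P. \<Sum>T\<in>?P. \<Sum>k<N. a S * ES S $$ (r, k) * (b T * ES T $$ (k, c)))"
    by (simp add: sum_distrib_left mult_ac)
  also have "\<dots> = (\<Sum>S\<in>?P. \<Sum>k<N. \<Sum>T\<in>?P. a S * ES S $$ (r, k) * (b T * ES T $$ (k, c)))"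
    by (intro sum.cong refl sum.swap)
  also have "\<dots> = (\<Sum>k<N. \<Sum>S\<in>?P. \<Sum>T\<in>?P. a S * ES S $$ (r, k) * (b T * ES T $$ (k, c)))"
    by (rule sum.swap)
  also have "\<dots> = (rep a * rep b) $$ (r, c)"
    using rc by (simp add: rep_def scalar_prod_def atLeast0LessThan sum_product)
  finally show "rep (a \<otimes>\<^bsub>clifford p q\<^esub> b) $$ (r, c) = (rep a * rep b) $$ (r, c)" .
qed (simp_all add: rep_def)

theorem spinor_rep_rep: "spinor_rep p q rep"
proof -
  have "rep \<in> ring_iso (clifford p q) (ring_mat TYPE(complex) N ())"
  proof (rule ring_iso_memI)
    show "rep (a \<oplus>\<^bsub>clifford p q\<^esub> b) = rep a \<oplus>\<^bsub>ring_mat TYPE(complex) N ()\<^esub> rep b" for a b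
      by (intro eq_matI) (auto simp: rep_def clifford_def ring_mat_def distrib_right sum.distrib)
    have inj: "inj_on rep (carrier (clifford p q))"
    proof (rule inj_onI, rule ext)
      fix a b S assume ab: "a \<in> carrier (clifford p q)" "b \<in> carrier (clifford p q)" "rep a = rep b"
      show "a S = b S"
      proof (cases "S \<subseteq> {1..p+q}")
        case True
        then show ?thesis using rep_coeff[OF True, of a] rep_coeff[OF True, of b] ab(3) by simp
      qed (use ab in \<open>auto simp: clifford_def\<close>)
    qed
    moreover have "rep ` carrier (clifford p q) = carrier_mat N N"
      using rep_surj rep_carrier by blast
    ultimately show "bij_betw rep (carrier (clifford p q)) (carrier (ring_mat TYPE(complex) N ()))"
      by (simp add: bij_betw_def ring_mat_def)
    show "rep \<one>\<^bsub>clifford p q\<^esub> = \<one>\<^bsub>ring_mat TYPE(complex) N ()\<^esub>"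
      by (simp add: clifford_one rep_monomial ES_empty ring_mat_def)
  qed (simp_all add: rep_mult rep_carrier ring_mat_def)
  moreover have "rep (scale c a) = c \<cdot>\<^sub>m rep a" for c a
    by (intro eq_matI) (auto simp: rep_def scale_def sum_distrib_left mult.assoc)
  ultimately show ?thesis unfolding spinor_rep_def N by simp
qed

lemma rep_gen: "i \<in> {1..p+q} \<Longrightarrow> rep (gen i) = E i"
  by (simp add: gen_def rep_monomial ES_singleton)

end

section \<open>The quaternionic division ring\<close>

text \<open>The absence of nontrivial idempotents, in coordinates: \<open>b \<noteq> 0\<close>
  forces \<open>Re a = 1 / 2\<close> by the second equation, and the real part of the first would
  then make a sum of squares equal to -1/4.\<close>

lemma quaternion_idempotent:
  assumes "a * a - b * cnj b = a" "a * b + b * cnj a = (b :: complex)"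
  shows "b = 0" "a = 0 \<or> a = 1"
proof -
  show b: "b = 0"
  proof (rule ccontr)
    assume b: "b \<noteq> 0"
    have "b * (a + cnj a) = b * 1" using assms(2) by (simp add: algebra_simps)
    then have "a + cnj a = 1" using b mult_left_cancel by blast
    then have re: "Re a = 1 / 2" by (simp add: complex_eq_iff)
    have "Re (a * a - b * cnj b) = Re a" using assms(1) by simp
    then have "Re a * Re a - Im a * Im a - (Re b * Re b + Im b * Im b) = Re a" by simp
    then have "Im a * Im a + Re b * Re b + Im b * Im b = - (1 / 4)" unfolding re by simp
    moreover have "Im a * Im a + Re b * Re b + Im b * Im b \<ge> 0" by simp
    ultimately show False by linarith
  qed
  then have "a * (a - 1) = 0" using assms(1) by (simp add: algebra_simps)
  then show "a = 0 \<or> a = 1" by simp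
qed

text \<open>The matrix P is the structure map of a right quaternionic vector space: the real subalgebra
  consists of the matrices M with \<open>M P = P (conj M)\<close>. Let D be the projection to the first
  coordinate; then \<open>F = D - P D P\<close> projects to the quaternionic line spanned by the first basis
  vector, and the corner of F consists of the matrices \<open>Y(a, b) = a D - b D P - b* P D - a* P D P\<close>.\<close>

locale quaternionic_structure = spinbasis +
  fixes P :: "complex mat"
  assumes P_carrier: "P \<in> carrier_mat N N"
    and P_real: "conj_mat P = P"
    and P_skew: "transpose_mat P = - P"
    and P_square: "P * P = - 1\<^sub>m N"
    and P_bar: "represents p q \<gamma> bar conj_mat P"
begin

lemma real_clifford_simps:
  "monoid.mult (real_clifford p q) = monoid.mult (clifford p q)"
  "add (real_clifford p q) = add (clifford p q)"
  "zero (real_clifford p q) = zero (clifford p q)"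
  "one (real_clifford p q) = one (clifford p q)"
  by (simp_all add: real_clifford_def)

text \<open>Real elements are the fixed points of \<open>bar\<close>, and \<open>P\<close> carries
  this condition over to matrices.\<close>

lemma real_carrier_iff:
  assumes "x \<in> carrier (clifford p q)"
  shows "x \<in> carrier (real_clifford p q) \<longleftrightarrow> \<gamma> x * P = P * conj_mat (\<gamma> x)"
proof -
  obtain P' where P': "P' \<in> carrier_mat N N" "P * P' = 1\<^sub>m N" "P' * P = 1\<^sub>m N"
    and bar: "\<gamma> (bar x) = P * conj_mat (\<gamma> x) * P'"
    using P_bar assms unfolding represents_def by blast
  have bx: "bar x \<in> carrier (clifford p q)" using assms by (simp add: bar_def clifford_def)
  note c = rep_carrier[OF assms] rep_carrier[OF bx] P_carrier P'(1)
  have cc: "conj_mat (\<gamma> x) \<in> carrier_mat N N" using c(1) by simp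
  have "x \<in> carrier (real_clifford p q) \<longleftrightarrow> bar x = x"
    using assms by (auto simp: real_clifford_def bar_def fun_eq_iff complex_is_Real_iff complex_eq_iff)
  also have "\<dots> \<longleftrightarrow> \<gamma> (bar x) = \<gamma> x" using rep_eq_iff[OF bx assms] by simp
  also have "\<dots> \<longleftrightarrow> \<gamma> x * P = P * conj_mat (\<gamma> x)"
  proof
    assume "\<gamma> (bar x) = \<gamma> x"
    then have "\<gamma> x * P = P * conj_mat (\<gamma> x) * P' * P" using bar by simp
    also have "\<dots> = P * conj_mat (\<gamma> x) * (P' * P)" using c cc by (simp add: assoc_mult_mat[of _ N N _ N _ N])
    also have "\<dots> = P * conj_mat (\<gamma> x)" using c cc P'(3) by simp
    finally show "\<gamma> x * P = P * conj_mat (\<gamma> x)" .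
  next
    assume *: "\<gamma> x * P = P * conj_mat (\<gamma> x)"
    have "\<gamma> (bar x) = \<gamma> x * (P * P')"
      unfolding bar *[symmetric] using c by (simp add: assoc_mult_mat[of _ N N _ N _ N])
    then show "\<gamma> (bar x) = \<gamma> x" using c P'(2) by simp
  qed
  finally show ?thesis .
qed

lemma real_carrierD: "x \<in> carrier (real_clifford p q) \<Longrightarrow> x \<in> carrier (clifford p q)"
  by (simp add: real_clifford_def)

section \<open>The quaternionic line through the first basis vector\<close>

definition D :: "complex mat" where
  "D = mat N N (\<lambda>(i, j). if i = 0 \<and> j = 0 then 1 else 0)"

lemma N_pos: "0 < N" by simp

lemma D_carrier: "D \<in> carrier_mat N N" by (simp add: D_def)

lemma D_conj: "conj_mat D = D" by (rule eq_matI) (auto simp: D_def)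

text \<open>The projection has rank one, so compressing to it leaves a single scalar.\<close>

lemma D_sandwich:
  assumes "A \<in> carrier_mat N N"
  shows "D * A * D = A $$ (0, 0) \<cdot>\<^sub>m D"
proof -
  have DA: "D * A = mat N N (\<lambda>(i, j). if i = 0 then A $$ (0, j) else 0)"
    using assms N_pos
    by (intro eq_matI) (auto simp: D_def scalar_prod_def if_distrib[of "\<lambda>x. x * _"] cong: if_cong)
  show ?thesis
    unfolding DA using assms N_pos
    by (intro eq_matI) (auto simp: D_def scalar_prod_def if_distrib[of "\<lambda>x. _ * x"] cong: if_cong)
qed

text \<open>The first basis vector is orthogonal to its image under \<open>P\<close>. This makes
  \<open>D\<close> and \<open>- P * D * P\<close> orthogonal projections whose sum is
  \<open>F\<close>.\<close>

lemma P_00: "P $$ (0, 0) = 0"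
proof -
  have "transpose_mat P $$ (0, 0) = (- P) $$ (0, 0)" by (simp only: P_skew)
  then show ?thesis using P_carrier N_pos by simp
qed

definition Y :: "complex \<Rightarrow> complex \<Rightarrow> complex mat" where
  "Y a b = a \<cdot>\<^sub>m D + (- b) \<cdot>\<^sub>m (D * P) + (- cnj b) \<cdot>\<^sub>m (P * D) + (- cnj a) \<cdot>\<^sub>m (P * D * P)"

abbreviation "cm \<equiv> carrier_mat N N :: complex mat set"

lemma cm_simps [simp]:
  "A \<in> cm \<Longrightarrow> B \<in> cm \<Longrightarrow> A * B \<in> cm"
  "A \<in> cm \<Longrightarrow> B \<in> cm \<Longrightarrow> A + B \<in> cm"
  "A \<in> cm \<Longrightarrow> c \<cdot>\<^sub>m A \<in> cm"
  "D \<in> cm" "P \<in> cm" "1\<^sub>m N \<in> cm" "0\<^sub>m N N \<in> cm"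
  using D_carrier P_carrier by auto

lemma dim_DP [simp]: "dim_row D = N" "dim_col D = N" "dim_row P = N" "dim_col P = N"
  by (fact carrier_matD[OF D_carrier] carrier_matD[OF P_carrier])+

lemma cm_unit [simp]:
  "A \<in> cm \<Longrightarrow> A * 1\<^sub>m N = A" "A \<in> cm \<Longrightarrow> 1\<^sub>m N * A = A"
  "A \<in> cm \<Longrightarrow> A * 0\<^sub>m N N = 0\<^sub>m N N" "A \<in> cm \<Longrightarrow> 0\<^sub>m N N * A = 0\<^sub>m N N"
  "A \<in> cm \<Longrightarrow> A + 0\<^sub>m N N = A" "A \<in> cm \<Longrightarrow> 0\<^sub>m N N + A = A"
  by simp_all

lemma cm_assoc: "A \<in> cm \<Longrightarrow> B \<in> cm \<Longrightarrow> C \<in> cm \<Longrightarrow> A * B * C = A * (B * C)"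
  by (rule assoc_mult_mat)

lemma cm_distrib:
  "A \<in> cm \<Longrightarrow> B \<in> cm \<Longrightarrow> C \<in> cm \<Longrightarrow> A * (B + C) = A * B + A * C"
  "A \<in> cm \<Longrightarrow> B \<in> cm \<Longrightarrow> C \<in> cm \<Longrightarrow> (B + C) * A = B * A + C * A"
  "A \<in> cm \<Longrightarrow> B \<in> cm \<Longrightarrow> A * (c \<cdot>\<^sub>m B) = c \<cdot>\<^sub>m (A * B)"
  "A \<in> cm \<Longrightarrow> B \<in> cm \<Longrightarrow> (c \<cdot>\<^sub>m A) * B = c \<cdot>\<^sub>m (A * B)"
  "A \<in> cm \<Longrightarrow> B \<in> cm \<Longrightarrow> c \<cdot>\<^sub>m (A + B) = c \<cdot>\<^sub>m A + c \<cdot>\<^sub>m B"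
  by (rule mult_add_distrib_mat add_mult_distrib_mat mult_smult_distrib mult_smult_assoc_mat
      add_smult_distrib_left_mat; assumption)+

lemma PP: "P * P = (-1) \<cdot>\<^sub>m 1\<^sub>m N" "A \<in> cm \<Longrightarrow> P * (P * A) = (-1) \<cdot>\<^sub>m A"
proof -
  show 1: "P * P = (-1) \<cdot>\<^sub>m 1\<^sub>m N" by (simp add: P_square uminus_smult_mat)
  assume A: "A \<in> cm"
  have "P * (P * A) = P * P * A" using A by (simp add: cm_assoc)
  then show "P * (P * A) = (-1) \<cdot>\<^sub>m A" using A by (simp add: 1 cm_distrib)
qed

lemma DD: "D * D = D" "A \<in> cm \<Longrightarrow> D * (D * A) = D * A"
proof -
  have "D * D = D * 1\<^sub>m N * D" by (simp only: cm_unit cm_simps)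
  also have "\<dots> = D" using N_pos by (simp only: D_sandwich[OF one_carrier_mat]) (simp add: one_smult_mat)
  finally show 1: "D * D = D" .
  show "D * (D * A) = D * A" if "A \<in> cm"
    using that 1 cm_assoc[of D D A] by simp
qed

lemma zero_smult_mat: "(A :: complex mat) \<in> cm \<Longrightarrow> 0 \<cdot>\<^sub>m A = 0\<^sub>m N N"
  by (intro eq_matI) auto

lemma DPD: "D * (P * D) = 0\<^sub>m N N" "A \<in> cm \<Longrightarrow> D * (P * (D * A)) = 0\<^sub>m N N"
proof -
  have "D * (P * D) = D * P * D" by (simp add: cm_assoc)
  then show 1: "D * (P * D) = 0\<^sub>m N N" by (simp add: D_sandwich P_00 zero_smult_mat)
  assume A: "A \<in> cm"
  have "D * (P * (D * A)) = D * (P * D) * A" using A by (simp add: cm_assoc)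
  then show "D * (P * (D * A)) = 0\<^sub>m N N" using A by (simp add: 1)
qed

definition F :: "complex mat" where "F = Y 1 0"

lemma F_eq: "F = D + (-1) \<cdot>\<^sub>m (P * (D * P))"
  unfolding F_def Y_def by (simp add: zero_smult_mat one_smult_mat cm_assoc)

lemma F_cm [simp]: "F \<in> cm" by (simp add: F_eq)

lemma Y_cm [simp]: "Y a b \<in> cm" by (simp add: Y_def)

lemma F_mult_Y: "F * Y a b = Y a b" "Y a b * F = Y a b"
  \<comment> \<open>After normalization both sides are linear combinations of the same words in
    \<open>D\<close> and \<open>P\<close>. Deleting the rule for entries of products keeps these
    words atomic in the entrywise comparison.\<close>
  unfolding F_eq Y_def
  by (simp_all add: cm_assoc cm_distrib PP DD DPD smult_smult_mat zero_smult_mat)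
    (intro eq_matI; simp del: index_mult_mat(1))+

lemma index_00:
  "A \<in> cm \<Longrightarrow> B \<in> cm \<Longrightarrow> (A + B) $$ (0, 0) = A $$ (0, 0) + B $$ (0, 0)"
  "A \<in> cm \<Longrightarrow> (c \<cdot>\<^sub>m A) $$ (0, 0) = c * A $$ (0, 0)"
proof -
  show "(A + B) $$ (0, 0) = A $$ (0, 0) + B $$ (0, 0)" if "A \<in> cm" "B \<in> cm"
    using that N_pos by simp
  show "(c \<cdot>\<^sub>m A) $$ (0, 0) = c * A $$ (0, 0)" if "A \<in> cm"
    using that N_pos by simp
qed

lemma D_index:
  assumes "A \<in> cm"
  shows "(D * A) $$ (0, 0) = A $$ (0, 0)" "(A * D) $$ (0, 0) = A $$ (0, 0)"
proof -
  show "(D * A) $$ (0, 0) = A $$ (0, 0)"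
    using assms N_pos
    by (simp add: D_def scalar_prod_def if_distrib[of "\<lambda>x. x * _"] cong: if_cong)
  show "(A * D) $$ (0, 0) = A $$ (0, 0)"
    using assms N_pos
    by (simp add: D_def scalar_prod_def if_distrib[of "\<lambda>x. _ * x"] cong: if_cong)
qed

lemma mult_D_index:
  assumes "A \<in> cm" "B \<in> cm"
  shows "(A * (D * B)) $$ (0, 0) = A $$ (0, 0) * B $$ (0, 0)"
proof -
  have "(A * (D * B)) $$ (0, 0) = (D * (A * (D * B)) * D) $$ (0, 0)"
    using assms by (simp add: D_index del: index_mult_mat(1))
  also have "D * (A * (D * B)) * D = (D * A * D) * (B * D)" using assms by (simp add: cm_assoc)
  also have "\<dots> = A $$ (0, 0) \<cdot>\<^sub>m (D * (B * D))" using assms by (simp add: D_sandwich cm_distrib)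
  finally show ?thesis using assms by (simp add: index_00 D_index del: index_mult_mat(1))
qed

lemma Y_index: "Y a b $$ (0, 0) = a" "(Y a b * P) $$ (0, 0) = b"
proof -
  have D00: "D $$ (0, 0) = 1" using N_pos by (simp add: D_def)
  show "Y a b $$ (0, 0) = a"
    unfolding Y_def by (simp add: index_00 D_index mult_D_index cm_assoc D00 P_00 del: index_mult_mat(1))
  show "(Y a b * P) $$ (0, 0) = b"
    unfolding Y_def
    by (simp add: index_00 D_index mult_D_index cm_assoc cm_distrib D00 P_00 PP del: index_mult_mat(1))
qed

lemma Y_commute: "Y a b * P = P * conj_mat (Y a b)"
proof -
  have "conj_mat (Y a b) = cnj a \<cdot>\<^sub>m D + (- cnj b) \<cdot>\<^sub>m (D * P) + (- b) \<cdot>\<^sub>m (P * D) + (- a) \<cdot>\<^sub>m (P * D * P)"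
  proof -
    have add: "conj_mat (A + B) = conj_mat A + conj_mat B" if "A \<in> cm" "B \<in> cm" for A B
      using that by (intro eq_matI) auto
    have mult: "conj_mat (A * B) = conj_mat A * conj_mat B" if "A \<in> cm" "B \<in> cm" for A B
      using that by (rule conj_mat_mult)
    show ?thesis unfolding Y_def by (simp add: add mult conj_mat_smult D_conj P_real)
  qed
  then show ?thesis
    unfolding Y_def by (simp add: cm_assoc cm_distrib PP smult_smult_mat)
      (intro eq_matI; simp del: index_mult_mat(1))
qed

text \<open>The four blocks of a matrix in the corner are determined by two of them.\<close>

lemma corner_eq_Y:
  assumes M: "M \<in> cm" and real: "M * P = P * conj_mat M" and corner: "F * M * F = M"
  shows "M = Y (M $$ (0, 0)) ((M * P) $$ (0, 0))"
proof -
  have cM: "conj_mat M \<in> cm" using M by simp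
  have index_conj: "conj_mat A $$ (0, 0) = cnj (A $$ (0, 0))" if "A \<in> cm" for A
    using that N_pos by simp
  have PM: "P * M = conj_mat M * P"
  proof -
    have "conj_mat (M * P) = conj_mat (P * conj_mat M)" by (simp only: real)
    moreover have "conj_mat (conj_mat M) = M" by (intro eq_matI) auto
    ultimately show ?thesis
      using M cM by (simp add: conj_mat_mult[of _ N N _ N] P_real)
  qed
  have i1: "(P * M) $$ (0, 0) = cnj ((M * P) $$ (0, 0))"
  proof -
    have "P * M = conj_mat (M * P)" unfolding PM using M by (simp add: conj_mat_mult[of _ N N _ N] P_real)
    then show ?thesis using M by (simp add: index_conj)
  qed
  have "P * (M * P) = (-1) \<cdot>\<^sub>m conj_mat M" unfolding real using cM by (simp add: PP)
  then have i2: "(P * (M * P)) $$ (0, 0) = - cnj (M $$ (0, 0))" using M cM by (simp add: index_00 index_conj)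
  have DAD: "D * (A * D) = A $$ (0, 0) \<cdot>\<^sub>m D" "D * (A * (D * B)) = A $$ (0, 0) \<cdot>\<^sub>m (D * B)"
    if "A \<in> cm" "B \<in> cm" for A B
  proof -
    show 1: "D * (A * D) = A $$ (0, 0) \<cdot>\<^sub>m D" using that D_sandwich[of A] by (simp add: cm_assoc)
    have "D * (A * (D * B)) = D * (A * D) * B" using that by (simp add: cm_assoc)
    then show "D * (A * (D * B)) = A $$ (0, 0) \<cdot>\<^sub>m (D * B)" unfolding 1 using that by (simp add: cm_distrib)
  qed
  \<comment> \<open>Expanding \<open>F * M * F\<close> puts \<open>M\<close>, \<open>M * P\<close>,
    \<open>P * M\<close> and \<open>P * (M * P)\<close> between two copies of \<open>D\<close>, so
    each block is one scalar; \<open>i1\<close> and \<open>i2\<close> express the last two scalars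
    by the first two.\<close>
  have e: "D * (M * D) = M $$ (0, 0) \<cdot>\<^sub>m D"
    "D * (M * (P * (D * P))) = (M * P) $$ (0, 0) \<cdot>\<^sub>m (D * P)"
    "D * (P * (M * D)) = (P * M) $$ (0, 0) \<cdot>\<^sub>m D"
    "D * (P * (M * (P * (D * P)))) = (P * (M * P)) $$ (0, 0) \<cdot>\<^sub>m (D * P)"
    using M DAD[of M D] DAD[of "M * P" P] DAD[of "P * M" D] DAD[of "P * (M * P)" P] by (simp_all add: cm_assoc)
  have "M = F * M * F" by (simp only: corner)
  also have "\<dots> = M $$ (0, 0) \<cdot>\<^sub>m D + (- (M * P) $$ (0, 0)) \<cdot>\<^sub>m (D * P) +
     (- (P * M) $$ (0, 0)) \<cdot>\<^sub>m (P * D) + ((P * (M * P)) $$ (0, 0)) \<cdot>\<^sub>m (P * (D * P))"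
    unfolding F_eq using M
    by (simp add: cm_assoc cm_distrib e smult_smult_mat) (intro eq_matI; simp del: index_mult_mat(1))
  also have "\<dots> = Y (M $$ (0, 0)) ((M * P) $$ (0, 0))"
    unfolding i1 i2 Y_def by (simp add: cm_assoc)
  finally show ?thesis .
qed

lemma Y_mult: "Y a b * Y c d = Y (a * c - b * cnj d) (a * d + b * cnj c)"
  unfolding Y_def
  by (simp add: cm_assoc cm_distrib PP DD DPD smult_smult_mat zero_smult_mat)
    (intro eq_matI; simp add: algebra_simps del: index_mult_mat(1))

lemma Y_add: "Y a b + Y c d = Y (a + c) (b + d)"
  unfolding Y_def by (intro eq_matI; simp add: algebra_simps del: index_mult_mat(1))

section \<open>The primitive idempotent and its corner ring\<close>

definition f :: cliff where "f = inv_into (carrier (clifford p q)) \<gamma> F"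

lemma f_carrier: "f \<in> carrier (clifford p q)" and rep_f: "\<gamma> f = F"
proof -
  have "F \<in> \<gamma> ` carrier (clifford p q)" using rep_surj[of F] F_cm by (metis image_eqI)
  then show "f \<in> carrier (clifford p q)" "\<gamma> f = F"
    unfolding f_def by (rule inv_into_into, rule f_inv_into_f)
qed

lemma f_real: "f \<in> carrier (real_clifford p q)"
  unfolding real_carrier_iff[OF f_carrier] rep_f F_def by (rule Y_commute)

lemma clifford_mult_carrier:
  assumes "x \<in> carrier (clifford p q)" "y \<in> carrier (clifford p q)"
  shows "x \<otimes>\<^bsub>clifford p q\<^esub> y \<in> carrier (clifford p q)"
proof -
  have "(x \<otimes>\<^bsub>clifford p q\<^esub> y) U = 0" if U: "\<not> U \<subseteq> {1..p+q}" for U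
    unfolding clifford_mult
  proof (intro sum.neutral ballI)
    fix S T assume "S \<in> Pow {1..p+q}" "T \<in> Pow {1..p+q}"
    then have "sym_diff S T \<noteq> U" using U by blast
    then show "(if sym_diff S T = U then mono_sign p S T * x S * y T else 0) = 0"
      by (simp only: if_False)
  qed
  then show ?thesis by (simp add: clifford_def)
qed

lemma F_conj: "conj_mat F = F"
proof -
  have "conj_mat (D + (-1) \<cdot>\<^sub>m (P * (D * P))) = conj_mat D + conj_mat ((-1) \<cdot>\<^sub>m (P * (D * P)))"
    by (intro eq_matI; simp del: index_mult_mat(1))
  then show ?thesis
    by (simp add: F_eq conj_mat_smult conj_mat_mult[of _ N N _ N] D_conj P_real)
qed

lemma F_commute: "F * P = P * F"
  using Y_commute[of 1 0] F_conj by (simp add: F_def)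

lemma F_idem: "F * F = F"
  using F_mult_Y(1)[of 1 0] by (simp only: F_def)

lemma corner_iff:
  "x \<in> carrier (corner (real_clifford p q) f) \<longleftrightarrow>
    x \<in> carrier (clifford p q) \<and> (\<exists>a b. \<gamma> x = Y a b)"
proof
  assume "x \<in> carrier (corner (real_clifford p q) f)"
  then obtain y where y: "y \<in> carrier (real_clifford p q)"
    and x: "x = f \<otimes>\<^bsub>clifford p q\<^esub> y \<otimes>\<^bsub>clifford p q\<^esub> f"
    by (auto simp: corner_def real_clifford_simps)
  have yc: "y \<in> carrier (clifford p q)" using y by (rule real_carrierD)
  have xc: "x \<in> carrier (clifford p q)"
    unfolding x using f_carrier yc by (intro clifford_mult_carrier)
  have M: "\<gamma> y \<in> cm" using yc by (rule rep_carrier)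
  have gx: "\<gamma> x = F * \<gamma> y * F"
    unfolding x using f_carrier yc by (simp add: rep_mult clifford_mult_carrier rep_f)
  have "F * \<gamma> x * F = \<gamma> x"
  proof -
    have "F * (F * \<gamma> y * F) * F = (F * F) * \<gamma> y * (F * F)" using M by (simp add: cm_assoc)
    then show ?thesis unfolding gx F_idem .
  qed
  moreover have "\<gamma> x * P = P * conj_mat (\<gamma> x)"
  proof -
    have cM: "conj_mat (\<gamma> y) \<in> cm" using M by simp
    have yP: "\<gamma> y * P = P * conj_mat (\<gamma> y)" using y real_carrier_iff[OF yc] by simp
    have "\<gamma> x * P = F * (\<gamma> y * P) * F" unfolding gx using M by (simp add: cm_assoc F_commute)
    also have "\<dots> = F * P * (conj_mat (\<gamma> y) * F)" unfolding yP using cM by (simp add: cm_assoc)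
    also have "\<dots> = P * (F * conj_mat (\<gamma> y) * F)" unfolding F_commute using cM by (simp add: cm_assoc)
    also have "F * conj_mat (\<gamma> y) * F = conj_mat (F * \<gamma> y * F)"
      using M by (simp add: conj_mat_mult[of _ N N _ N] F_conj)
    finally show ?thesis unfolding gx .
  qed
  ultimately show "x \<in> carrier (clifford p q) \<and> (\<exists>a b. \<gamma> x = Y a b)"
    using xc corner_eq_Y[OF rep_carrier[OF xc]] by blast
next
  assume x: "x \<in> carrier (clifford p q) \<and> (\<exists>a b. \<gamma> x = Y a b)"
  then obtain a b where gx: "\<gamma> x = Y a b" by blast
  have xr: "x \<in> carrier (real_clifford p q)"
    using x unfolding real_carrier_iff[OF conjunct1[OF x]] gx by (simp add: Y_commute)
  have "\<gamma> (f \<otimes>\<^bsub>clifford p q\<^esub> x \<otimes>\<^bsub>clifford p q\<^esub> f) = \<gamma> x"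
    using x f_carrier by (simp add: rep_mult clifford_mult_carrier rep_f gx F_mult_Y)
  then have "x = f \<otimes>\<^bsub>clifford p q\<^esub> x \<otimes>\<^bsub>clifford p q\<^esub> f"
    using x f_carrier rep_eq_iff clifford_mult_carrier by metis
  then show "x \<in> carrier (corner (real_clifford p q) f)"
    using xr by (auto simp: corner_def real_clifford_simps)
qed

definition quat :: "cliff \<Rightarrow> complex \<times> complex" where
  "quat x = (\<gamma> x $$ (0, 0), (\<gamma> x * P) $$ (0, 0))"

lemma quat_Y: "\<gamma> x = Y a b \<Longrightarrow> quat x = (a, b)"
  by (simp add: quat_def Y_index)

lemma corner_iso: "corner (real_clifford p q) f \<simeq> quaternion_ring"
proof -
  let ?C = "corner (real_clifford p q) f"
  have "quat \<in> ring_iso ?C quaternion_ring"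
  proof (rule ring_iso_memI)
    fix x y assume "x \<in> carrier ?C" "y \<in> carrier ?C"
    then obtain a b c d where x: "x \<in> carrier (clifford p q)" "\<gamma> x = Y a b"
      and y: "y \<in> carrier (clifford p q)" "\<gamma> y = Y c d"
      unfolding corner_iff by blast
    have "\<gamma> (x \<otimes>\<^bsub>?C\<^esub> y) = Y (a * c - b * cnj d) (a * d + b * cnj c)"
      using x y by (simp add: corner_def real_clifford_simps rep_mult Y_mult)
    then show "quat (x \<otimes>\<^bsub>?C\<^esub> y) = quat x \<otimes>\<^bsub>quaternion_ring\<^esub> quat y"
      using quat_Y x(2) y(2) by (simp add: quaternion_ring_def)
    have "\<gamma> (x \<oplus>\<^bsub>?C\<^esub> y) = Y (a + c) (b + d)"
      using x y by (simp add: corner_def real_clifford_simps rep_add Y_add)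
    then show "quat (x \<oplus>\<^bsub>?C\<^esub> y) = quat x \<oplus>\<^bsub>quaternion_ring\<^esub> quat y"
      using quat_Y x(2) y(2) by (simp add: quaternion_ring_def)
  next
    show "quat \<one>\<^bsub>?C\<^esub> = \<one>\<^bsub>quaternion_ring\<^esub>"
      using quat_Y[of f 1 0] by (simp add: corner_def quaternion_ring_def rep_f F_def)
    show "bij_betw quat (carrier ?C) (carrier quaternion_ring)"
    proof (rule bij_betwI')
      fix x y assume "x \<in> carrier ?C" "y \<in> carrier ?C"
      then obtain a b c d where x: "x \<in> carrier (clifford p q)" "\<gamma> x = Y a b"
        and y: "y \<in> carrier (clifford p q)" "\<gamma> y = Y c d"
        unfolding corner_iff by blast
      show "quat x = quat y \<longleftrightarrow> x = y"
      proof
        assume "quat x = quat y"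
        then have "\<gamma> x = \<gamma> y" unfolding quat_Y[OF x(2)] quat_Y[OF y(2)] x(2) y(2) by simp
        then show "x = y" by (simp only: rep_eq_iff[OF x(1) y(1)])
      qed simp
    next
      fix z :: "complex \<times> complex"
      obtain a b where z: "z = (a, b)" by (cases z)
      obtain x where x: "x \<in> carrier (clifford p q)" "\<gamma> x = Y a b" using rep_surj[of "Y a b"] Y_cm by blast
      have "x \<in> carrier ?C" unfolding corner_iff using x by blast
      moreover have "z = quat x" unfolding z by (rule quat_Y[OF x(2), symmetric])
      ultimately show "\<exists>x\<in>carrier ?C. z = quat x" by blast
    qed (simp add: quaternion_ring_def)
  qed (simp add: quaternion_ring_def)
  then show ?thesis unfolding is_ring_iso_def by blast
qed

lemma rep_zero: "\<gamma> \<zero>\<^bsub>clifford p q\<^esub> = 0\<^sub>m N N"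
proof -
  have "\<zero>\<^bsub>clifford p q\<^esub> = scale 0 (monomial {})" by (simp add: clifford_def scale_def)
  then show ?thesis by (simp add: rep_scale monomial_carrier rep_one zero_smult_mat)
qed

text \<open>Orthogonal idempotents with sum \<open>f\<close> lie in the corner, which is a copy of
  the quaternions and hence has only the idempotents zero and one.\<close>

lemma f_primitive: "primitive_idempotent (real_clifford p q) f"
proof -
  have ff: "f \<otimes>\<^bsub>clifford p q\<^esub> f = f"
    using rep_eq_iff[OF clifford_mult_carrier[OF f_carrier f_carrier] f_carrier]
    by (simp add: rep_mult f_carrier rep_f F_idem)
  have zero_carrier: "\<zero>\<^bsub>clifford p q\<^esub> \<in> carrier (clifford p q)" by (simp add: clifford_def)
  have "f \<noteq> \<zero>\<^bsub>clifford p q\<^esub>"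
  proof
    assume "f = \<zero>\<^bsub>clifford p q\<^esub>"
    then have "Y 1 0 $$ (0, 0) = 0\<^sub>m N N $$ (0, 0)" using rep_f rep_zero by (simp only: F_def)
    then show False using N_pos by (simp only: Y_index index_zero_mat) simp
  qed
  moreover have "g = \<zero>\<^bsub>clifford p q\<^esub> \<or> h = \<zero>\<^bsub>clifford p q\<^esub>"
    if gh: "idempotent (real_clifford p q) g" "idempotent (real_clifford p q) h"
      "g \<otimes>\<^bsub>clifford p q\<^esub> h = \<zero>\<^bsub>clifford p q\<^esub>" "h \<otimes>\<^bsub>clifford p q\<^esub> g = \<zero>\<^bsub>clifford p q\<^esub>"
      "f = g \<oplus>\<^bsub>clifford p q\<^esub> h" for g h
  proof -
    have g: "g \<in> carrier (clifford p q)" "g \<in> carrier (real_clifford p q)"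
      and h: "h \<in> carrier (clifford p q)" "h \<in> carrier (real_clifford p q)"
      using gh(1,2) real_carrierD by (auto simp: idempotent_def)
    have G: "\<gamma> g \<in> cm" and H: "\<gamma> h \<in> cm" using g h rep_carrier by auto
    have GG: "\<gamma> g * \<gamma> g = \<gamma> g"
      using gh(1) rep_mult[OF g(1) g(1)] by (simp add: idempotent_def real_clifford_simps)
    have GH: "\<gamma> g * \<gamma> h = 0\<^sub>m N N" "\<gamma> h * \<gamma> g = 0\<^sub>m N N"
      using gh(3,4) rep_mult[OF g(1) h(1)] rep_mult[OF h(1) g(1)] rep_zero by simp_all
    have F: "F = \<gamma> g + \<gamma> h" using rep_add[OF g(1) h(1)] gh(5) rep_f by simp
    \<comment> \<open>Orthogonality absorbs the other summand on both sides; this places the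
      idempotent in the corner.\<close>
    have FG: "F * \<gamma> g * F = \<gamma> g"
      unfolding F using G H by (simp add: cm_distrib GG GH cm_assoc)
    obtain a b where ab: "\<gamma> g = Y a b"
      using corner_eq_Y[OF G _ FG] g real_carrier_iff[OF g(1)] by blast
    have "quat (g \<otimes>\<^bsub>clifford p q\<^esub> g) = quat g"
      using gh(1) by (simp add: idempotent_def real_clifford_simps)
    moreover have "\<gamma> (g \<otimes>\<^bsub>clifford p q\<^esub> g) = Y (a * a - b * cnj b) (a * b + b * cnj a)"
      using g by (simp add: rep_mult ab Y_mult)
    ultimately have eqs: "a * a - b * cnj b = a" "a * b + b * cnj a = b"
      using quat_Y ab by auto
    have "b = 0" using quaternion_idempotent(1)[OF eqs] .
    moreover have "a = 0 \<or> a = 1" using quaternion_idempotent(2)[OF eqs] .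
    moreover have "Y 0 0 = 0\<^sub>m N N" unfolding Y_def by (simp add: zero_smult_mat)
    ultimately consider "\<gamma> g = 0\<^sub>m N N" | "\<gamma> g = F" using ab by (auto simp: F_def)
    then show ?thesis
    proof cases
      case 1
      then have "g = \<zero>\<^bsub>clifford p q\<^esub>" using rep_zero rep_eq_iff[OF g(1) zero_carrier] by simp
      then show ?thesis ..
    next
      case 2
      have "\<gamma> h = 0\<^sub>m N N"
      proof (rule eq_matI)
        fix i j assume "i < dim_row (0\<^sub>m N N)" "j < dim_col (0\<^sub>m N N)"
        moreover have "F $$ (i, j) = (\<gamma> g + \<gamma> h) $$ (i, j)" by (simp only: F[symmetric])
        ultimately show "\<gamma> h $$ (i, j) = 0\<^sub>m N N $$ (i, j)" using 2 H by simp
      qed (use H in auto)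
      then have "h = \<zero>\<^bsub>clifford p q\<^esub>" using rep_zero rep_eq_iff[OF h(1) zero_carrier] by simp
      then show ?thesis ..
    qed
  qed
  ultimately show ?thesis
    unfolding primitive_idempotent_def real_clifford_simps idempotent_def[of _ f]
    using f_real ff by blast
qed

theorem quaternionic_division_ring: "has_division_ring p q quaternion_ring"
  unfolding has_division_ring_def using f_primitive corner_iso by blast

end

section \<open>Real anticommuting matrices\<close>

text \<open>Symmetry and sign of the square are tied together, so the matrices are orthogonal. A
  later factor of the imaginary unit flips the square but keeps the symmetry.\<close>

definition real_gens :: "nat \<Rightarrow> complex mat list \<Rightarrow> nat \<Rightarrow> bool" where
  "real_gens N B k \<longleftrightarrow>
     (\<forall>a<length B. B ! a \<in> carrier_mat N N \<and> conj_mat (B ! a) = B ! a \<and>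
        transpose_mat (B ! a) = (if a < k then 1 else -1) \<cdot>\<^sub>m (B ! a) \<and>
        B ! a * B ! a = (if a < k then 1 else -1) \<cdot>\<^sub>m 1\<^sub>m N) \<and>
     (\<forall>a<length B. \<forall>b<length B. a \<noteq> b \<longrightarrow> B ! a * B ! b = (-1) \<cdot>\<^sub>m (B ! b * B ! a))"

text \<open>The Kronecker products of A with the Pauli matrix \<open>diag(1, -1)\<close>, and of the unit matrix with
  the off-diagonal matrices of square \<open>s\<close>.\<close>

definition diag_sign :: "nat \<Rightarrow> complex mat \<Rightarrow> complex mat" where
  "diag_sign N A = four_block_mat A (0\<^sub>m N N) (0\<^sub>m N N) ((-1) \<cdot>\<^sub>m A)"

definition off_diag :: "nat \<Rightarrow> complex \<Rightarrow> complex mat" where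
  "off_diag N s = four_block_mat (0\<^sub>m N N) (1\<^sub>m N) (s \<cdot>\<^sub>m 1\<^sub>m N) (0\<^sub>m N N)"

lemma smult_four_block:
  assumes "A \<in> carrier_mat N N" "B \<in> carrier_mat N N" "C \<in> carrier_mat N N" "D \<in> carrier_mat N N"
  shows "c \<cdot>\<^sub>m four_block_mat A B C D = four_block_mat (c \<cdot>\<^sub>m A) (c \<cdot>\<^sub>m B) (c \<cdot>\<^sub>m C) (c \<cdot>\<^sub>m D)"
  using assms by (rule smult_four_block_mat)

lemma one_four_block: "c \<cdot>\<^sub>m 1\<^sub>m (N + N) = four_block_mat (c \<cdot>\<^sub>m 1\<^sub>m N) (0\<^sub>m N N) (0\<^sub>m N N) (c \<cdot>\<^sub>m 1\<^sub>m N)"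
  for c :: complex
  by (rule eq_matI) auto

lemma diag_sign_mult:
  assumes "A \<in> carrier_mat N N" "B \<in> carrier_mat N N"
  shows "diag_sign N A * diag_sign N B = four_block_mat (A * B) (0\<^sub>m N N) (0\<^sub>m N N) (A * B)"
proof -
  have "(-1) \<cdot>\<^sub>m A * ((-1) \<cdot>\<^sub>m B) = A * B"
    using mult_smult_assoc_mat[OF assms(1), of "(-1) \<cdot>\<^sub>m B" N "-1"] mult_smult_distrib[OF assms, of "-1"] assms
    by (simp add: smult_smult_mat one_smult_mat)
  moreover have "A * B \<in> carrier_mat N N" using assms by simp
  ultimately show ?thesis
    unfolding diag_sign_def using assms
    by (subst mult_four_block_mat[of _ N N _ N _ N _ _ N _ N])
      (simp_all add: right_mult_zero_mat[of _ N N] left_mult_zero_mat[of _ N N])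
qed

lemma diag_sign_off_diag:
  assumes "A \<in> carrier_mat N N"
  shows "diag_sign N A * off_diag N s = four_block_mat (0\<^sub>m N N) A ((- s) \<cdot>\<^sub>m A) (0\<^sub>m N N)"
    and "off_diag N s * diag_sign N A = four_block_mat (0\<^sub>m N N) ((-1) \<cdot>\<^sub>m A) (s \<cdot>\<^sub>m A) (0\<^sub>m N N)"
proof -
  have 1: "(-1) \<cdot>\<^sub>m A * (s \<cdot>\<^sub>m 1\<^sub>m N) = (- s) \<cdot>\<^sub>m A"
    using assms mult_smult_distrib[of "(-1) \<cdot>\<^sub>m A" N N "1\<^sub>m N" N s] by (simp add: smult_smult_mat)
  have 2: "(s \<cdot>\<^sub>m 1\<^sub>m N) * A = s \<cdot>\<^sub>m A"
    using assms mult_smult_assoc_mat[of "1\<^sub>m N" N N A N s] by simp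
  show "diag_sign N A * off_diag N s = four_block_mat (0\<^sub>m N N) A ((- s) \<cdot>\<^sub>m A) (0\<^sub>m N N)"
    unfolding diag_sign_def off_diag_def using assms
    by (subst mult_four_block_mat[of _ N N _ N _ N _ _ N _ N])
      (simp_all add: 1 right_mult_zero_mat[of _ N N] left_mult_zero_mat[of _ N N])
  show "off_diag N s * diag_sign N A = four_block_mat (0\<^sub>m N N) ((-1) \<cdot>\<^sub>m A) (s \<cdot>\<^sub>m A) (0\<^sub>m N N)"
    unfolding diag_sign_def off_diag_def using assms
    by (subst mult_four_block_mat[of _ N N _ N _ N _ _ N _ N])
      (simp_all add: 2 right_mult_zero_mat[of _ N N] left_mult_zero_mat[of _ N N])
qed

lemma off_diag_mult:
  "off_diag N s * off_diag N t = four_block_mat (t \<cdot>\<^sub>m 1\<^sub>m N) (0\<^sub>m N N) (0\<^sub>m N N) (s \<cdot>\<^sub>m 1\<^sub>m N)"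
  unfolding off_diag_def
  by (subst mult_four_block_mat[of _ N N _ N _ N _ _ N _ N])
    (simp_all add: right_mult_zero_mat[of _ N N] left_mult_zero_mat[of _ N N])

lemma diag_sign_carrier: "A \<in> carrier_mat N N \<Longrightarrow> diag_sign N A \<in> carrier_mat (N + N) (N + N)"
  by (simp add: diag_sign_def)

lemma off_diag_carrier: "off_diag N s \<in> carrier_mat (N + N) (N + N)"
  by (simp add: off_diag_def)

lemma diag_sign_conj_transpose:
  assumes "A \<in> carrier_mat N N"
  shows "conj_mat A = A \<Longrightarrow> conj_mat (diag_sign N A) = diag_sign N A"
    and "transpose_mat A = c \<cdot>\<^sub>m A \<Longrightarrow> transpose_mat (diag_sign N A) = c \<cdot>\<^sub>m diag_sign N A"
proof -
  assume A: "conj_mat A = A"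
  have "cnj (A $$ (i, j)) = A $$ (i, j)" if "i < N" "j < N" for i j
  proof -
    have "conj_mat A $$ (i, j) = cnj (A $$ (i, j))" using that assms by simp
    then show ?thesis by (simp only: A)
  qed
  then show "conj_mat (diag_sign N A) = diag_sign N A"
    unfolding diag_sign_def using assms by (intro eq_matI) auto
next
  assume c: "transpose_mat A = c \<cdot>\<^sub>m A"
  show "transpose_mat (diag_sign N A) = c \<cdot>\<^sub>m diag_sign N A"
    unfolding diag_sign_def
    using assms c transpose_four_block_mat[of A N N "0\<^sub>m N N" N "0\<^sub>m N N" N "(-1) \<cdot>\<^sub>m A"]
    by (simp add: smult_four_block[of _ N] transpose_mat_smult smult_smult_mat)
qed

lemma off_diag_conj_transpose:
  assumes "s = 1 \<or> s = -1"
  shows "conj_mat (off_diag N s) = off_diag N s" "transpose_mat (off_diag N s) = s \<cdot>\<^sub>m off_diag N s"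
proof -
  show "conj_mat (off_diag N s) = off_diag N s"
    unfolding off_diag_def using assms by (intro eq_matI) auto
  show "transpose_mat (off_diag N s) = s \<cdot>\<^sub>m off_diag N s"
    unfolding off_diag_def using assms
    by (subst transpose_four_block_mat[of _ N N _ N _ N])
      (auto simp add: smult_four_block[of _ N] transpose_mat_smult smult_smult_mat one_smult_mat)
qed

text \<open>Doubling the dimension keeps the old relations and adds one generator of each square;
  the symmetric newcomer is inserted at position \<open>k\<close> so that symmetric matrices still
  come first.\<close>

lemma real_gens_double:
  assumes B: "real_gens N B k" and k: "k \<le> length B"
  shows "real_gens (N + N) (map (diag_sign N) (take k B) @ [off_diag N 1] @ map (diag_sign N) (drop k B) @ [off_diag N (-1)]) (Suc k)"
proof -
  let ?n = "length B"
  let ?C = "map (diag_sign N) (take k B) @ [off_diag N 1] @ map (diag_sign N) (drop k B) @ [off_diag N (-1)]"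
  \<comment> \<open>The position in \<open>B\<close> of an inherited entry; those behind the
    inserted matrix have moved by one.\<close>
  define old where "old a = (if a < k then a else a - 1)" for a
  have len: "length ?C = Suc (Suc ?n)" using k by simp
  have nth: "?C ! a = (if a = k then off_diag N 1 else if a = Suc ?n then off_diag N (-1) else diag_sign N (B ! old a))"
    if "a < Suc (Suc ?n)" for a
  proof -
    consider "a < k" | "a = k" | j where "a = Suc (k + j)" "j < ?n - k" | "a = Suc ?n"
    proof -
      have "a = Suc (k + (a - Suc k))" "a - Suc k < ?n - k" if "k < a" "a \<noteq> Suc ?n"
        using that k \<open>a < Suc (Suc ?n)\<close> by linarith+
      then show thesis using that by (metis linorder_neqE_nat)
    qed
    then show ?thesis
    proof cases
      case 1
      then show ?thesis using k by (simp add: nth_append old_def)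
    next
      case (3 j)
      then have "k + j < ?n" using k by linarith
      then show ?thesis using k 3 by (simp add: nth_append old_def)
    qed (use k in \<open>simp_all add: nth_append Suc_diff_le\<close>)
  qed
  have old: "old a < ?n" "old a < k \<longleftrightarrow> a < Suc k" if "a < Suc (Suc ?n)" "a \<noteq> k" "a \<noteq> Suc ?n" for a
    using that k by (auto simp: old_def)
  have old_inj: "old a \<noteq> old b" if "a \<noteq> b" "a \<noteq> k" "b \<noteq> k" for a b
    using that by (auto simp: old_def split: if_splits)
  have Bc: "B ! a \<in> carrier_mat N N" if "a < ?n" for a using B that by (simp add: real_gens_def)
  have anti: "diag_sign N A * diag_sign N A' = (-1) \<cdot>\<^sub>m (diag_sign N A' * diag_sign N A)"
    if "A \<in> carrier_mat N N" "A' \<in> carrier_mat N N" "A * A' = (-1) \<cdot>\<^sub>m (A' * A)" for A A'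
    using that by (simp add: diag_sign_mult smult_four_block[of _ N])
  have anti1: "diag_sign N A * off_diag N s = (-1) \<cdot>\<^sub>m (off_diag N s * diag_sign N A)"
    "off_diag N s * diag_sign N A = (-1) \<cdot>\<^sub>m (diag_sign N A * off_diag N s)"
    if "A \<in> carrier_mat N N" for A s
    using that by (simp_all add: diag_sign_off_diag smult_four_block[of _ N] smult_smult_mat one_smult_mat)
  have anti2: "off_diag N s * off_diag N (- s) = (-1) \<cdot>\<^sub>m (off_diag N (- s) * off_diag N s)" for s
    by (simp add: off_diag_mult smult_four_block[of _ N] smult_smult_mat)
  have sq: "off_diag N s * off_diag N s = s \<cdot>\<^sub>m 1\<^sub>m (N + N)" for s
    by (simp add: off_diag_mult one_four_block)
  have props: "?C ! a \<in> carrier_mat (N + N) (N + N) \<and> conj_mat (?C ! a) = ?C ! a \<and>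
      transpose_mat (?C ! a) = (if a < Suc k then 1 else -1) \<cdot>\<^sub>m (?C ! a) \<and>
      ?C ! a * ?C ! a = (if a < Suc k then 1 else -1) \<cdot>\<^sub>m 1\<^sub>m (N + N)" if a: "a < Suc (Suc ?n)" for a
  proof -
    consider "a = k" | "a = Suc ?n" "a \<noteq> k" | "a \<noteq> k" "a \<noteq> Suc ?n" by blast
    then show ?thesis
    proof cases
      case 1
      then show ?thesis unfolding nth[OF a] using off_diag_carrier off_diag_conj_transpose[of 1 N] sq[of 1] by simp
    next
      case 2
      then show ?thesis unfolding nth[OF a] using k off_diag_carrier off_diag_conj_transpose[of "-1" N] sq[of "-1"] by simp
    next
      case 3
      note o = old[OF a 3]
      have b: "B ! old a \<in> carrier_mat N N" "conj_mat (B ! old a) = B ! old a"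
        "transpose_mat (B ! old a) = (if a < Suc k then 1 else -1) \<cdot>\<^sub>m (B ! old a)"
        "B ! old a * B ! old a = (if a < Suc k then 1 else -1) \<cdot>\<^sub>m 1\<^sub>m N"
        using B o by (simp_all add: real_gens_def)
      show ?thesis
        unfolding nth[OF a] if_not_P[OF 3(1)] if_not_P[OF 3(2)]
        using diag_sign_carrier[OF b(1)] diag_sign_conj_transpose(1)[OF b(1,2)]
          diag_sign_conj_transpose(2)[OF b(1,3)] diag_sign_mult[OF b(1,1)] b(4)
          one_four_block[of "if a < Suc k then 1 else -1" N]
        by simp
    qed
  qed
  have "?C ! a * ?C ! b = (-1) \<cdot>\<^sub>m (?C ! b * ?C ! a)"
    if ab: "a < Suc (Suc ?n)" "b < Suc (Suc ?n)" "a \<noteq> b" for a b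
  proof -
    consider "a = k" "b = Suc ?n" | "a = Suc ?n" "b = k" "a \<noteq> k" | "a \<in> {k, Suc ?n}" "b \<noteq> k" "b \<noteq> Suc ?n"
      | "a \<noteq> k" "a \<noteq> Suc ?n" "b \<in> {k, Suc ?n}" | "a \<noteq> k" "a \<noteq> Suc ?n" "b \<noteq> k" "b \<noteq> Suc ?n"
      using ab(3) by blast
    then show ?thesis
    proof cases
      case 1
      have "?C ! a = off_diag N 1" unfolding nth[OF ab(1)] using 1 by simp
      moreover have "?C ! b = off_diag N (-1)" unfolding nth[OF ab(2)] using 1 ab(3) by simp
      ultimately show ?thesis using anti2[of 1] by (simp only:)
    next
      case 2
      have "?C ! a = off_diag N (-1)" unfolding nth[OF ab(1)] using 2 by simp
      moreover have "?C ! b = off_diag N 1" unfolding nth[OF ab(2)] using 2 by simp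
      ultimately show ?thesis using anti2[of "-1"] by (simp only: minus_minus)
    next
      case 3
      have "?C ! b = diag_sign N (B ! old b)" unfolding nth[OF ab(2)] using 3 by simp
      moreover have "\<exists>s. ?C ! a = off_diag N s" unfolding nth[OF ab(1)] using 3(1) by auto
      then obtain s where "?C ! a = off_diag N s" ..
      ultimately show ?thesis using anti1(2)[OF Bc[OF old(1)[OF ab(2) 3(2,3)]], of s] by (simp only:)
    next
      case 4
      have "?C ! a = diag_sign N (B ! old a)" unfolding nth[OF ab(1)] using 4 by simp
      moreover have "\<exists>s. ?C ! b = off_diag N s" unfolding nth[OF ab(2)] using 4(3) by auto
      then obtain s where "?C ! b = off_diag N s" ..
      ultimately show ?thesis using anti1(1)[OF Bc[OF old(1)[OF ab(1) 4(1,2)]], of s] by (simp only:)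
    next
      case 5
      note o = old(1)[OF ab(1) 5(1,2)] old(1)[OF ab(2) 5(3,4)]
      have "?C ! a = diag_sign N (B ! old a)" unfolding nth[OF ab(1)] using 5 by simp
      moreover have "?C ! b = diag_sign N (B ! old b)" unfolding nth[OF ab(2)] using 5 by simp
      moreover have "B ! old a * B ! old b = (-1) \<cdot>\<^sub>m (B ! old b * B ! old a)"
        using B o old_inj[OF ab(3) 5(1,3)] unfolding real_gens_def by blast
      ultimately show ?thesis using anti[OF Bc[OF o(1)] Bc[OF o(2)]] by (simp only:)
    qed
  qed
  then show ?thesis unfolding real_gens_def len using props by blast
qed

lemma real_gens_butlast:
  assumes "real_gens N (B @ [A]) k"
  shows "real_gens N B k"
proof -
  have nth: "(B @ [A]) ! a = B ! a" "a < length (B @ [A])" if "a < length B" for a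
    using that by (simp_all add: nth_append)
  show ?thesis
    unfolding real_gens_def using assms[unfolded real_gens_def] nth by metis
qed

lemma real_gens_iterate:
  assumes "real_gens N B k" "k \<le> length B"
  shows "\<exists>C. length C = length B + 2 * j \<and> real_gens (2 ^ j * N) C (k + j)"
proof (induction j)
  case 0
  then show ?case using assms by auto
next
  case (Suc j)
  then obtain C where C: "length C = length B + 2 * j" "real_gens (2 ^ j * N) C (k + j)" by blast
  then have "k + j \<le> length C" using assms(2) by simp
  from real_gens_double[OF C(2) this] C(1) \<open>k + j \<le> length C\<close> show ?case
    by (intro exI conjI) (auto simp: mult_2[symmetric] mult.assoc)
qed

text \<open>Each doubling adds one generator of either square, so \<open>s - t\<close> is fixed by
  the start: the empty list in dimension one, or two symmetric matrices in dimension two.\<close>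

lemma ex_real_gens:
  assumes "s = t \<or> s = t + 2"
  shows "\<exists>B. length B = s + t \<and> real_gens (2 ^ ((s + t) div 2)) B s"
proof (cases "s = t")
  case True
  have "real_gens 1 [] 0" by (simp add: real_gens_def)
  from real_gens_iterate[OF this, of t] show ?thesis using True by (auto simp: mult_2)
next
  case False
  have "real_gens 1 [1\<^sub>m 1] 1"
    by (simp add: real_gens_def one_smult_mat) (intro eq_matI; auto)
  \<comment> \<open>Doubling the one-by-one unit gives the diagonal Pauli matrix and two
    off-diagonal ones; dropping the last, of square -1, leaves two of square 1.\<close>
  from real_gens_double[OF this]
  have "real_gens 2 [diag_sign 1 (1\<^sub>m 1), off_diag 1 1, off_diag 1 (-1)] 2" by (simp add: numeral_2_eq_2)
  then have "real_gens 2 [diag_sign 1 (1\<^sub>m 1), off_diag 1 1] 2"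
    using real_gens_butlast[of 2 "[diag_sign 1 (1\<^sub>m 1), off_diag 1 1]" "off_diag 1 (-1)" 2] by simp
  from real_gens_iterate[OF this, of t] obtain C
    where C: "length C = 2 + 2 * t" "real_gens (2 ^ t * 2) C (2 + t)" by auto
  have "s + t = 2 * Suc t" using False assms by simp
  then have "(s + t) div 2 = Suc t" by simp
  then show ?thesis using C False assms by (intro exI[of _ C]) (auto simp: mult.commute)
qed

section \<open>Order structures and families of signatures\<close>

lemma (in group) ord_eq_2_iff:
  assumes "x \<in> carrier G"
  shows "ord x = 2 \<longleftrightarrow> x \<noteq> \<one> \<and> x \<otimes> x = \<one>"
proof -
  have dvd2: "d dvd 2 \<longleftrightarrow> d = 1 \<or> d = (2::nat)" for d
  proof
    assume "d dvd 2"
    then have "d \<le> 2" "d > 0" by (auto dest: dvd_imp_le intro: dvd_pos_nat[of 2])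
    then show "d = 1 \<or> d = 2" by linarith
  qed auto
  have "x [^] (2::nat) = x \<otimes> x" using assms by (simp add: numeral_2_eq_2)
  then have "x \<otimes> x = \<one> \<longleftrightarrow> ord x dvd 2" using pow_eq_id[OF assms, of 2] by simp
  also have "\<dots> \<longleftrightarrow> ord x = 1 \<or> ord x = 2" by (rule dvd2)
  finally show ?thesis using ord_eq_1[OF assms] by auto
qed

lemma (in group) ord_eq_4_iff:
  assumes "x \<in> carrier G"
  shows "ord x = 4 \<longleftrightarrow> x \<otimes> x \<noteq> \<one> \<and> (x \<otimes> x) \<otimes> (x \<otimes> x) = \<one>"
proof -
  have dvd4: "d dvd 4 \<longleftrightarrow> d = 1 \<or> d = 2 \<or> d = (4::nat)" for d
  proof
    assume d: "d dvd 4"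
    then have "d \<le> 4" "d > 0" by (auto dest: dvd_imp_le intro: dvd_pos_nat[of 4])
    then have "d = 1 \<or> d = 2 \<or> d = 3 \<or> d = 4" by linarith
    then show "d = 1 \<or> d = 2 \<or> d = 4" using d by auto
  qed auto
  have "x [^] (4::nat) = (x \<otimes> x) \<otimes> (x \<otimes> x)"
    using assms by (simp add: eval_nat_numeral m_assoc)
  then have "(x \<otimes> x) \<otimes> (x \<otimes> x) = \<one> \<longleftrightarrow> ord x dvd 4" using pow_eq_id[OF assms, of 4] by simp
  also have "\<dots> \<longleftrightarrow> ord x = 1 \<or> ord x = 2 \<or> ord x = 4" by (rule dvd4)
  finally show ?thesis using ord_eq_1[OF assms] ord_eq_2_iff[OF assms] assms by auto
qed

text \<open>Orders are replaced by conditions on squares, which can be evaluated by listing the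
  carrier.\<close>

lemma group_type_eq:
  assumes "group G"
  shows "group_type G = (comm_group G,
    card {x \<in> carrier G. x \<noteq> \<one>\<^bsub>G\<^esub> \<and> x \<otimes>\<^bsub>G\<^esub> x = \<one>\<^bsub>G\<^esub>},
    card {x \<in> carrier G. x \<otimes>\<^bsub>G\<^esub> x \<noteq> \<one>\<^bsub>G\<^esub> \<and> (x \<otimes>\<^bsub>G\<^esub> x) \<otimes>\<^bsub>G\<^esub> (x \<otimes>\<^bsub>G\<^esub> x) = \<one>\<^bsub>G\<^esub>})"
proof -
  have "{x \<in> carrier G. group.ord G x = 2} = {x \<in> carrier G. x \<noteq> \<one>\<^bsub>G\<^esub> \<and> x \<otimes>\<^bsub>G\<^esub> x = \<one>\<^bsub>G\<^esub>}"
    using group.ord_eq_2_iff[OF assms] by blast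
  moreover have "{x \<in> carrier G. group.ord G x = 4} =
      {x \<in> carrier G. x \<otimes>\<^bsub>G\<^esub> x \<noteq> \<one>\<^bsub>G\<^esub> \<and> (x \<otimes>\<^bsub>G\<^esub> x) \<otimes>\<^bsub>G\<^esub> (x \<otimes>\<^bsub>G\<^esub> x) = \<one>\<^bsub>G\<^esub>}"
    using group.ord_eq_4_iff[OF assms] by blast
  ultimately show ?thesis by (simp only: group_type_def)
qed

lemma Collect_insert_conv: "{x \<in> insert a A. P x} = (if P a then insert a {x \<in> A. P x} else {x \<in> A. P x})"
  by auto

lemma comm_group_DirProd:
  assumes "comm_group G" "comm_group H"
  shows "comm_group (G \<times>\<times> H)"
proof -
  interpret G: comm_group G by fact
  interpret H: comm_group H by fact
  have "group (G \<times>\<times> H)" by (intro DirProd_group G.is_group H.is_group)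
  then show ?thesis
    by (rule group.group_comm_groupI) (auto simp: G.m_comm H.m_comm)
qed

lemma carrier_Z24: "carrier Z2 = {0, 1}" "carrier Z4 = {0, 1, 2, 3}"
  by (auto simp: carrier_integer_mod_group)

lemma group_type_Z2Z2Z2: "group_type (Z2 \<times>\<times> Z2 \<times>\<times> Z2) = (True, 7, 0)"
proof -
  have c: "comm_group (Z2 \<times>\<times> Z2 \<times>\<times> Z2)"
    by (intro comm_group_DirProd abelian_integer_mod_group)
  then have "group (Z2 \<times>\<times> Z2 \<times>\<times> Z2)" by (simp add: comm_group_def)
  note gt = group_type_eq[OF this]
  have "carrier (Z2 \<times>\<times> Z2 \<times>\<times> Z2) = {(0,0,0),(0,0,1),(0,1,0),(0,1,1),(1,0,0),(1,0,1),(1,1,0),(1,1,1)}"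
    by (auto simp: carrier_Z24)
  then show ?thesis
    unfolding gt by (simp only: Collect_insert_conv) (simp add: c)
qed

lemma group_type_Z4Z2: "group_type (Z4 \<times>\<times> Z2) = (True, 3, 4)"
proof -
  have c: "comm_group (Z4 \<times>\<times> Z2)"
    by (intro comm_group_DirProd abelian_integer_mod_group)
  then have "group (Z4 \<times>\<times> Z2)" by (simp add: comm_group_def)
  note gt = group_type_eq[OF this]
  have "carrier (Z4 \<times>\<times> Z2) = {(0,0),(0,1),(1,0),(1,1),(2,0),(2,1),(3,0),(3,1)}"
    by (auto simp: carrier_Z24)
  then show ?thesis
    unfolding gt by (simp only: Collect_insert_conv) (simp add: c)
qed

lemma carrier_D4: "({0..<4} \<times> {0..<2} :: (int \<times> int) set) = {(0,0),(0,1),(1,0),(1,1),(2,0),(2,1),(3,0),(3,1)}"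
proof -
  have 1: "{0..<4 :: int} = {0, 1, 2, 3}" by auto
  have 2: "{0..<2 :: int} = {0, 1}" by auto
  show ?thesis unfolding 1 2 by auto
qed

lemma group_D4: "group D4"
proof (rule groupI)
  fix x y z assume "x \<in> carrier D4" "y \<in> carrier D4" "z \<in> carrier D4"
  moreover obtain a r b s c t where xyz: "x = (a, r)" "y = (b, s)" "z = (c, t)"
    by (metis surj_pair)
  ultimately have "r = 0 \<or> r = 1" "s = 0 \<or> s = 1" "t = 0 \<or> t = 1" by (auto simp: D4_def)
  then show "x \<otimes>\<^bsub>D4\<^esub> y \<otimes>\<^bsub>D4\<^esub> z = x \<otimes>\<^bsub>D4\<^esub> (y \<otimes>\<^bsub>D4\<^esub> z)"
    unfolding xyz D4_def
    by (elim disjE; hypsubst; simp add: mod_simps algebra_simps)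
next
  fix x assume x: "x \<in> carrier D4"
  obtain a r where ar: "x = (a, r)" by (metis surj_pair)
  then have "r = 0 \<or> r = 1" using x by (auto simp: D4_def)
  then have "(if r = 0 then (- a) mod 4 else a, r) \<otimes>\<^bsub>D4\<^esub> x = \<one>\<^bsub>D4\<^esub>"
    "(if r = 0 then (- a) mod 4 else a, r) \<in> carrier D4"
    using x unfolding ar D4_def by (elim disjE; hypsubst; simp add: mod_simps)+
  then show "\<exists>y\<in>carrier D4. y \<otimes>\<^bsub>D4\<^esub> x = \<one>\<^bsub>D4\<^esub>" by blast
next
  show "\<one>\<^bsub>D4\<^esub> \<in> carrier D4" by (simp add: D4_def)
  show "x \<otimes>\<^bsub>D4\<^esub> y \<in> carrier D4" for x y
    by (cases x; cases y) (simp add: D4_def)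
  show "\<one>\<^bsub>D4\<^esub> \<otimes>\<^bsub>D4\<^esub> x = x" if "x \<in> carrier D4" for x
    using that by (cases x) (simp add: D4_def)
qed

lemma group_Q4: "group Q4"
proof (rule groupI)
  have 1: "(u + v mod 4 - w) mod 4 = (u + v - w) mod 4" for u v w :: int
    using mod_add_left_eq[of v 4 "u - w"] by (simp add: algebra_simps)
  have 2: "(u + (v + 2) - w) mod 4 = (u + v - (w + 2)) mod 4" for u v w :: int
    using mod_add_self2[of "u + v - (w + 2)" 4] by (simp add: algebra_simps)
  fix x y z assume "x \<in> carrier Q4" "y \<in> carrier Q4" "z \<in> carrier Q4"
  moreover obtain a r b s c t where xyz: "x = (a, r)" "y = (b, s)" "z = (c, t)"
    by (metis surj_pair)
  ultimately have "r = 0 \<or> r = 1" "s = 0 \<or> s = 1" "t = 0 \<or> t = 1" by (auto simp: Q4_def)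
  then show "x \<otimes>\<^bsub>Q4\<^esub> y \<otimes>\<^bsub>Q4\<^esub> z = x \<otimes>\<^bsub>Q4\<^esub> (y \<otimes>\<^bsub>Q4\<^esub> z)"
    unfolding xyz Q4_def
    by (elim disjE; hypsubst; simp add: mod_simps algebra_simps 1 2; simp add: algebra_simps)
next
  have 3: "((u + 2) mod 4 - u + 2) mod 4 = 0" for u :: int
    using mod_add_left_eq[of "u + 2" 4 "2 - u"] by (simp add: algebra_simps)
  fix x assume x: "x \<in> carrier Q4"
  obtain a r where ar: "x = (a, r)" by (metis surj_pair)
  then have "r = 0 \<or> r = 1" using x by (auto simp: Q4_def)
  \<comment> \<open>An element with second coordinate 1 squares to \<open>(2, 0)\<close>, so its
    inverse is itself shifted by 2.\<close>
  then have "(if r = 0 then (- a) mod 4 else (a + 2) mod 4, r) \<otimes>\<^bsub>Q4\<^esub> x = \<one>\<^bsub>Q4\<^esub>"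
    "(if r = 0 then (- a) mod 4 else (a + 2) mod 4, r) \<in> carrier Q4"
    using x 3 unfolding ar Q4_def by (elim disjE; hypsubst; simp add: mod_add_left_eq)+
  then show "\<exists>y\<in>carrier Q4. y \<otimes>\<^bsub>Q4\<^esub> x = \<one>\<^bsub>Q4\<^esub>" by blast
next
  show "\<one>\<^bsub>Q4\<^esub> \<in> carrier Q4" by (simp add: Q4_def)
  show "x \<otimes>\<^bsub>Q4\<^esub> y \<in> carrier Q4" for x y
    by (cases x; cases y) (simp add: Q4_def)
  show "\<one>\<^bsub>Q4\<^esub> \<otimes>\<^bsub>Q4\<^esub> x = x" if "x \<in> carrier Q4" for x
    using that by (cases x) (simp add: Q4_def)
qed

lemma not_comm_groupI:
  assumes "x \<in> carrier G" "y \<in> carrier G" "x \<otimes>\<^bsub>G\<^esub> y \<noteq> y \<otimes>\<^bsub>G\<^esub> x"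
  shows "\<not> comm_group G"
proof
  assume "comm_group G"
  then interpret comm_group G .
  show False using m_comm[OF assms(1,2)] assms(3) by contradiction
qed

lemma group_type_D4: "group_type D4 = (False, 5, 2)"
proof -
  have "\<not> comm_group D4"
    by (rule not_comm_groupI[of "(1, 0)" _ "(0, 1)"]) (simp_all add: D4_def)
  then show ?thesis
    unfolding group_type_eq[OF group_D4]
    unfolding D4_def partial_object.simps monoid.simps carrier_D4 Collect_insert_conv by simp
qed

lemma group_type_Q4: "group_type Q4 = (False, 1, 6)"
proof -
  have "\<not> comm_group Q4"
    by (rule not_comm_groupI[of "(1, 0)" _ "(0, 1)"]) (simp_all add: Q4_def)
  then show ?thesis
    unfolding group_type_eq[OF group_Q4]
    unfolding Q4_def partial_object.simps monoid.simps carrier_D4 Collect_insert_conv by simp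
qed

lemmas group_types = group_type_Z2Z2Z2 group_type_Z4Z2 group_type_D4 group_type_Q4 Z4Z2_star_def

section \<open>Counting and classifying sign patterns\<close>

lemma signs_0: "signs 0 k = (if k = 0 then {[]} else {})"
proof -
  have "t \<in> signs 0 k \<longleftrightarrow> t = [] \<and> k = 0" for t
    by (auto simp: signs_def)
  then show ?thesis by auto
qed

lemma signs_Suc:
  "signs (Suc n) k = (if k = 0 then {} else (#) 1 ` signs n (k - 1)) \<union> (#) (-1) ` signs n k"
proof -
  have "t \<in> signs (Suc n) k \<longleftrightarrow> (k \<noteq> 0 \<and> t \<in> (#) 1 ` signs n (k - 1)) \<or> t \<in> (#) (-1) ` signs n k" for t
    by (cases t) (auto simp: signs_def)
  then show ?thesis by auto
qed

lemma finite_signs: "finite (signs n k)"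
proof (induction n arbitrary: k)
  case (Suc n)
  then show ?case by (simp add: signs_Suc)
qed (simp add: signs_0)

lemma card_signs: "card (signs n k) = n choose k"
proof (induction n arbitrary: k)
  case (Suc n)
  have "card (signs (Suc n) (Suc k)) = card ((#) 1 ` signs n k) + card ((#) (-1) ` signs n (Suc k))" for k
    unfolding signs_Suc using finite_signs by (subst card_Un_disjoint[symmetric]) auto
  moreover have "card (signs (Suc n) 0) = card ((#) (-1) ` signs n 0)" by (simp add: signs_Suc)
  ultimately show ?case
    by (cases k) (simp_all add: card_image Suc)
qed (simp add: signs_0 binomial_eq_0)

lemma card_all_signatures: "card all_signatures = 64"
proof -
  have "signs 7 j \<inter> signs 7 k = {}" if "j \<noteq> k" for j k
    using that by (auto simp: signs_def)
  then have "card all_signatures = card (signs 7 7) + card (signs 7 5) + card (signs 7 3) + card (signs 7 1)"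
    unfolding all_signatures_def
    by (subst card_Un_disjoint; (simp add: finite_signs Int_Un_distrib2)?)+
  then show ?thesis by (simp add: card_signs eval_nat_numeral)
qed

lemma mem_signs_iff: "t \<in> signs n k \<longleftrightarrow> length t = n \<and> set t \<subseteq> {1, -1} \<and> count_list t 1 = k"
  by (simp add: signs_def)

lemma sig_with_iff:
  "[a, b, c, d, e, f, g] \<in> sig_with [x, y, z] k \<longleftrightarrow>
    a = x \<and> b = y \<and> c = z \<and> {d, e, f, g} \<subseteq> {1, -1} \<and> count_list [d, e, f, g] 1 = k"
proof -
  have "[a, b, c, d, e, f, g] \<in> sig_with [x, y, z] k \<longleftrightarrow> a = x \<and> b = y \<and> c = z \<and> [d, e, f, g] \<in> signs 4 k"
    by (auto simp: sig_with_def)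
  then show ?thesis by (simp add: mem_signs_iff)
qed

lemma D4_family:
  "{abc @ [1, 1, 1, 1] |abc. abc \<in> signs 3 1} =
    {[1, -1, -1, 1, 1, 1, 1], [-1, 1, -1, 1, 1, 1, 1], [-1, -1, 1, 1, 1, 1, 1 :: int]}"
proof -
  have "signs 3 1 = {[1, -1, -1], [-1, 1, -1], [-1, -1, 1 :: int]}"
    by (simp add: signs_Suc signs_0 numeral_3_eq_3 insert_commute)
  then show ?thesis by (simp only: setcompr_eq_image image_insert image_empty append.simps Collect_mem_eq)
qed

lemmas family_simps = abelian_families_def nonabelian_families_def D4_family group_types

text \<open>Both sides are the patterns with an odd number of pluses. Every family depends only on
  the first three signs and on the number of pluses among the last four, so a table of prefixes and
  counts decides membership.\<close>

lemma all_signatures_families: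
  "all_signatures = \<Union> ((\<lambda>(t, \<tau>, \<Sigma>). \<Sigma>) ` (abelian_families \<union> nonabelian_families))"
proof -
  have "s \<in> all_signatures \<longleftrightarrow> s \<in> \<Union> ((\<lambda>(t, \<tau>, \<Sigma>). \<Sigma>) ` (abelian_families \<union> nonabelian_families))"
    if len: "length s = 7" and set: "set s \<subseteq> {1, -1}" for s
  proof -
    obtain a b c d e f g where s: "s = [a, b, c, d, e, f, g]"
      using len by (auto simp: eval_nat_numeral length_Suc_conv)
    have "a \<in> {1, -1}" "b \<in> {1, -1}" "c \<in> {1, -1}" "d \<in> {1, -1}" "e \<in> {1, -1}" "f \<in> {1, -1}" "g \<in> {1, -1}"
      using set by (simp_all add: s)
    moreover have "s \<in> \<Union> ((\<lambda>(t, \<tau>, \<Sigma>). \<Sigma>) ` (abelian_families \<union> nonabelian_families)) \<longleftrightarrow>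
      (a, b, c, count_list [d, e, f, g] 1) \<in> {(1, 1, 1, 4), (1, 1, 1, 0), (1, -1, -1, 2), (-1, 1, -1, 2),
        (-1, -1, 1, 2), (-1, -1, -1, 1), (1, -1, 1, 3), (1, 1, -1, 3), (-1, 1, 1, 3), (1, -1, -1, 0),
        (-1, 1, -1, 0), (-1, -1, 1, 0), (1, 1, 1, 2), (1, -1, -1, 4), (-1, 1, -1, 4), (-1, -1, 1, 4),
        (1, -1, 1, 1), (1, 1, -1, 1), (-1, 1, 1, 1), (-1, -1, -1, 3)}"
      using calculation unfolding s family_simps by (auto simp: sig_with_iff)
    ultimately show ?thesis unfolding s all_signatures_def
      by (elim insertE emptyE; hypsubst; simp add: mem_signs_iff)
  qed
  moreover have "length s = 7 \<and> set s \<subseteq> {1, -1}" if "s \<in> all_signatures" for s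
    using that by (auto simp: all_signatures_def signs_def)
  moreover have "length s = 7 \<and> set s \<subseteq> {1, -1}"
    if "s \<in> \<Union> ((\<lambda>(t, \<tau>, \<Sigma>). \<Sigma>) ` (abelian_families \<union> nonabelian_families))" for s
    using that by (auto simp: abelian_families_def nonabelian_families_def sig_with_def signs_def)
  ultimately show ?thesis by blast
qed

lemma abelian_family:
  assumes "w \<in> {1, -1}" "\<epsilon> \<in> {1, -1}" "\<pi> \<in> {1, -1}" "s = sig_list w \<epsilon> \<pi> 1 1 1"
  shows "\<exists>(t, \<tau>, \<Sigma>)\<in>abelian_families. t = (if w = 1 then 4 else 6) \<and>
    \<tau> = (True, count_list s 1, count_list s (-1)) \<and> s \<in> \<Sigma>"
  using assms(1-3) unfolding assms(4) sig_list_def abelian_families_def group_types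
  by (elim insertE emptyE) (simp_all add: sig_with_iff)

lemma nonabelian_family:
  assumes "w \<in> {1, -1}" "\<epsilon> \<in> {1, -1}" "\<pi> \<in> {1, -1}" "a \<in> {1, -1}" "b \<in> {1, -1}" "d \<in> {1, -1}"
    and "\<not> (a = 1 \<and> b = 1 \<and> d = 1)" "s = sig_list w \<epsilon> \<pi> a b d"
  shows "\<exists>(t, \<tau>, \<Sigma>)\<in>nonabelian_families. t = (if w = 1 then 4 else 6) \<and>
    \<tau> = (False, count_list s 1, count_list s (-1)) \<and> s \<in> \<Sigma>"
  using assms(1-7) unfolding assms(8) sig_list_def nonabelian_families_def D4_family group_types
  by (elim insertE emptyE) (simp_all add: sig_with_iff)

section \<open>Signatures in terms of the spinbasis\<close>

definition sgn_pow :: "nat \<Rightarrow> int" where "sgn_pow k = (if even k then 1 else -1)"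

lemma of_int_sgn_pow: "of_int (sgn_pow k) = ((-1) ^ k :: complex)"
  by (simp add: sgn_pow_def)

lemma sgn_pow_cases: "sgn_pow k \<in> {1, -1}"
  by (simp add: sgn_pow_def)

lemma sgn_pow_eq_1: "sgn_pow k = 1 \<longleftrightarrow> even k"
  by (simp add: sgn_pow_def)

lemma card_split:
  assumes "finite A" "A \<subseteq> B \<union> C" "B \<inter> C = {}"
  shows "card A = card (A \<inter> B) + card (A \<inter> C)"
proof -
  have "A = (A \<inter> B) \<union> (A \<inter> C)" using assms(2) by blast
  moreover have "card ((A \<inter> B) \<union> (A \<inter> C)) = card (A \<inter> B) + card (A \<inter> C)"
    using assms by (intro card_Un_disjoint) auto
  ultimately show ?thesis by simp
qed

context even_spinbasis
begin

abbreviation "nm \<equiv> num_m p q \<gamma>"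
abbreviation "nl \<equiv> num_l p q \<gamma>"
abbreviation "nu \<equiv> num_u p q \<gamma>"
abbreviation "nv \<equiv> num_v p q \<gamma>"

lemma card_idx: "card Cx_idx = nm + nl" "card Re_idx = nu + nv" "card Sk_idx = nm + nu" "card Sy_idx = nl + nv"
proof -
  note fin = index_sets_finite and dis = index_sets_disjoint
  have ss: "X \<subseteq> Sk_idx \<union> Sy_idx" "X \<subseteq> Cx_idx \<union> Re_idx" if "X \<subseteq> {1..p+q}" for X
    using that real_or_complex sym_or_skew by auto
  have d: "Sk_idx \<inter> Sy_idx = {}" "Cx_idx \<inter> Re_idx = {}" using dis by auto
  show "card Cx_idx = nm + nl"
    using card_split[OF fin(2) ss(1)[OF index_sets_subset(2)] d(1)] by (simp add: num_m_def num_l_def)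
  show "card Re_idx = nu + nv"
    using card_split[OF fin(1) ss(1)[OF index_sets_subset(1)] d(1)] by (simp add: num_u_def num_v_def)
  show "card Sk_idx = nm + nu"
    using card_split[OF fin(4) ss(2)[OF index_sets_subset(4)] d(2)] by (simp add: num_m_def num_u_def Int_commute)
  show "card Sy_idx = nl + nv"
    using card_split[OF fin(3) ss(2)[OF index_sets_subset(3)] d(2)] by (simp add: num_l_def num_v_def Int_commute)
qed

lemma card_total: "nm + nv + nl + nu = p + q"
proof -
  have "card {1..p+q} = card ({1..p+q} \<inter> Re_idx) + card ({1..p+q} \<inter> Cx_idx)"
    using real_or_complex index_sets_disjoint by (intro card_split) auto
  moreover have "{1..p+q} \<inter> Re_idx = Re_idx" "{1..p+q} \<inter> Cx_idx = Cx_idx"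
    using index_sets_subset by auto
  ultimately show ?thesis using card_idx by simp
qed

text \<open>Commuting past \<open>E_set\<close> or \<open>P_set\<close> counts skew or complex
  generators. For the last sign, the complex members of \<open>E_set\<close> number m or l according
  to which set was chosen.\<close>

lemma comm_signs:
  "of_int (sgn_pow (nm + nu)) = comm_sign E_set W_set"
  "of_int (sgn_pow (nm + nl)) = comm_sign P_set W_set"
  "of_int (sgn_pow (if even (nm + nu) then nm else nl)) = comm_sign P_set E_set"
proof -
  have "W_set \<inter> Sk_idx = Sk_idx" "W_set \<inter> Cx_idx = Cx_idx"
    using index_sets_subset by (auto simp: W_set_def)
  then show "of_int (sgn_pow (nm + nu)) = comm_sign E_set W_set"
    "of_int (sgn_pow (nm + nl)) = comm_sign P_set W_set"
    by (simp_all only: of_int_sgn_pow comm_sign_E[OF ext_sets_subset(1)] comm_sign_P[OF ext_sets_subset(1)] card_idx)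
  show "of_int (sgn_pow (if even (nm + nu) then nm else nl)) = comm_sign P_set E_set"
    unfolding of_int_sgn_pow comm_sign_P[OF ext_sets_subset(2)]
    by (simp add: E_set_def card_idx num_m_def num_l_def Int_commute)
qed

text \<open>With p + q = 2k, the sorting sign has the parity of k and the q generators of square -1
  contribute q. The parity of k + q is that of (p - q)/2, which is even for residue 4 and odd for
  residue 6.\<close>

lemma mono_sign_W:
  assumes "(int p - int q) mod 8 = (if w = 1 then 4 else 6)" "w \<in> {1, -1}"
  shows "of_int w = mono_sign p W_set W_set"
proof -
  obtain k where k: "p + q = 2 * k" using even_dim by (rule evenE)
  have "{i \<in> W_set. p < i} = {p<..p+q}" by (auto simp: W_set_def)
  then have c: "card {i \<in> W_set. p < i} = q" by simp
  have "(2 * k) choose 2 = k * (2 * k - 1)"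
    by (simp add: choose_two)
  moreover have "even (k * (2 * k - 1)) \<longleftrightarrow> even k" by (cases k) auto
  ultimately have "even ((p + q) choose 2) \<longleftrightarrow> even k" by (simp only: k)
  then have "mono_sign p W_set W_set = (-1) ^ (k + q)"
    by (simp only: mono_sign_self[OF ext_sets_finite(1)] c neg_one_power_eq_iff even_add)
      (simp add: W_set_def)
  moreover have "even (k + q) \<longleftrightarrow> w = 1"
  proof -
    have "int p + int q = 2 * int k" using arg_cong[OF k, of int] by simp
    then have eq: "int p - int q = 2 * (int k - int q)" by (simp add: algebra_simps)
    show ?thesis using assms unfolding eq by (cases "w = 1") (simp_all, presburger+)
  qed
  ultimately have "mono_sign p W_set W_set = (if w = 1 then 1 else -1)"
    by (simp only: minus_one_power_iff)
  then show ?thesis using assms(2) by auto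
qed

lemma ex_int_sign: "\<exists>s\<in>{1, -1 :: int}. of_int s = mono_sign p S S"
  using mono_sign_cases[of p S S] by auto

text \<open>The first two signs being 1 gives m, u, l the same parity, the even total adds v, and
  the third sign then says that this common parity is even.\<close>

lemma all_even_iff:
  "(\<forall>x\<in>spin_counts p q \<gamma>. even x) \<longleftrightarrow>
    sgn_pow (nm + nu) = 1 \<and> sgn_pow (nm + nl) = 1 \<and> sgn_pow (if even (nm + nu) then nm else nl) = 1"
proof -
  have "even (nm + nv + nl + nu)" using card_total even_dim by simp
  then show ?thesis unfolding sgn_pow_eq_1 spin_counts_def by auto
qed

end

lemma quaternionic_ext_family:
  assumes X: "quaternionic_ext p q \<gamma> X"
  shows "\<forall>x\<in>spin_counts p q \<gamma>. even x \<Longrightarrow> \<exists>(t, \<tau>, \<Sigma>)\<in>abelian_families.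
      (int p - int q) mod 8 = t \<and> ext_iso p q X \<tau> \<and> (\<exists>s\<in>\<Sigma>. has_signature p q X s)"
    and "\<not> (\<forall>x\<in>spin_counts p q \<gamma>. even x) \<Longrightarrow> \<exists>(t, \<tau>, \<Sigma>)\<in>nonabelian_families.
      (int p - int q) mod 8 = t \<and> ext_iso p q X \<tau> \<and> (\<exists>s\<in>\<Sigma>. has_signature p q X s)"
proof -
  interpret even_spinbasis p q \<gamma>
    using X by (intro even_spinbasisI) (simp_all add: quaternionic_ext_def)
  have all2: "list_all2 (\<lambda>A S. A =\<^sub>\<plusminus> e S) X ext_sets"
    using X unfolding quaternionic_ext_def
    by (intro ext_matrices_eq_ext_sets) (simp_all add: P_set_def E_set_def)
  define w :: int where "w = (if (int p - int q) mod 8 = 4 then 1 else -1)"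
  have w: "w \<in> {1, -1}" by (simp add: w_def)
  have t: "(int p - int q) mod 8 = (if w = 1 then 4 else 6)"
    using X by (auto simp: w_def quaternionic_ext_def)
  obtain \<epsilon> where \<epsilon>: "\<epsilon> \<in> {1, -1}" "of_int \<epsilon> = mono_sign p E_set E_set" using ex_int_sign by blast
  obtain \<pi> where \<pi>: "\<pi> \<in> {1, -1}" "of_int \<pi> = mono_sign p P_set P_set" using ex_int_sign by blast
  define a b d where "a = sgn_pow (nm + nu)" "b = sgn_pow (nm + nl)"
    "d = sgn_pow (if even (nm + nu) then nm else nl)"
  note abd = this
  have abd_pm: "a \<in> {1, -1}" "b \<in> {1, -1}" "d \<in> {1, -1}" unfolding abd by (rule sgn_pow_cases)+
  define s where "s = sig_list w \<epsilon> \<pi> a b d"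
  note sig = signature_ext_iso[OF all2 mono_sign_W[OF t w] \<epsilon>(2) \<pi>(2) comm_signs, folded abd, OF s_def]
  show "\<exists>(t, \<tau>, \<Sigma>)\<in>abelian_families.
      (int p - int q) mod 8 = t \<and> ext_iso p q X \<tau> \<and> (\<exists>s\<in>\<Sigma>. has_signature p q X s)"
    if "\<forall>x\<in>spin_counts p q \<gamma>. even x"
  proof -
    have True: "a = 1 \<and> b = 1 \<and> d = 1" using that unfolding all_even_iff abd .
    then have "s = sig_list w \<epsilon> \<pi> 1 1 1" using s_def by simp
    from abelian_family[OF w \<epsilon>(1) \<pi>(1) this] sig True t show ?thesis by fastforce
  qed
  show "\<exists>(t, \<tau>, \<Sigma>)\<in>nonabelian_families.
      (int p - int q) mod 8 = t \<and> ext_iso p q X \<tau> \<and> (\<exists>s\<in>\<Sigma>. has_signature p q X s)"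
    if "\<not> (\<forall>x\<in>spin_counts p q \<gamma>. even x)"
  proof -
    have False: "\<not> (a = 1 \<and> b = 1 \<and> d = 1)" using that unfolding all_even_iff abd .
    from nonabelian_family[OF w \<epsilon>(1) \<pi>(1) abd_pm False s_def] sig False t show ?thesis by fastforce
  qed
qed

section \<open>Realization of the families\<close>

text \<open>The generators come in four blocks: v real symmetric and m complex skew of square 1,
  then l complex symmetric and u real skew of square -1. Removing the imaginary units leaves v + l
  symmetric and u + m skew real matrices, whence the condition on the numbers.\<close>

lemma ex_spinbasis:
  assumes even: "even (m + v + l + u)" and sig: "v + l = u + m \<or> v + l = u + m + 2"
  obtains \<gamma> where "has_spinbasis (v + m) (l + u) \<gamma>"
    "complex_idx (v + m) (l + u) \<gamma> = {v<..v + m + l}"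
    "real_idx (v + m) (l + u) \<gamma> = {1..v} \<union> {v + m + l<..v + m + (l + u)}"
    "sym_idx (v + m) (l + u) \<gamma> = {1..v} \<union> {v + m<..v + m + l}"
    "skew_idx (v + m) (l + u) \<gamma> = {v<..v + m} \<union> {v + m + l<..v + m + (l + u)}"
proof -
  let ?p = "v + m" and ?q = "l + u"
  let ?n = "?p + ?q" and ?N = "spin_dim (v + m) (l + u)"
  have n: "(v + l) + (u + m) = ?n" by simp
  obtain B where B: "length B = ?n" "real_gens ?N B (v + l)"
    using ex_real_gens[OF sig] unfolding n by blast
  \<comment> \<open>In \<open>B\<close> all symmetric matrices come first, whereas here the
    generators of square 1 do, so the two middle blocks are exchanged. The shift by one turns
    indices into list positions.\<close>
  define \<pi> where "\<pi> i = (if i \<le> v \<or> v + m + l < i then i - 1 else if i \<le> v + m then l + i - 1 else i - 1 - m)" for i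
  \<comment> \<open>The two middle blocks receive the imaginary unit, which flips their
    squares.\<close>
  define c where "c i = (if v < i \<and> i \<le> v + m + l then \<i> else 1)" for i
  define E where "E i = c i \<cdot>\<^sub>m (B ! \<pi> i)" for i
  have \<pi>: "\<pi> i < ?n" "\<pi> i < v + l \<longleftrightarrow> i \<le> v \<or> v + m < i \<and> i \<le> v + m + l" if "i \<in> {1..?n}" for i
    using that by (auto simp: \<pi>_def)
  have \<pi>_inj: "\<pi> i \<noteq> \<pi> j" if "i \<in> {1..?n}" "j \<in> {1..?n}" "i \<noteq> j" for i j
    using that by (auto simp: \<pi>_def split: if_splits)
  have Bc: "B ! \<pi> i \<in> carrier_mat ?N ?N" if "i \<in> {1..?n}" for i
    using B \<pi>(1)[OF that] by (simp add: real_gens_def)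
  interpret gens: clifford_gens ?p ?q ?N E
  proof
    show "even (?p + ?q)" using even by (simp add: algebra_simps)
    show "E i \<in> carrier_mat ?N ?N" if "i \<in> {1..?n}" for i
      using Bc[OF that] by (simp add: E_def)
    show "E i * E i = (if i \<le> ?p then 1 else -1) \<cdot>\<^sub>m 1\<^sub>m ?N" if i: "i \<in> {1..?n}" for i
    proof -
      have "E i * E i = (c i * c i) \<cdot>\<^sub>m (B ! \<pi> i * B ! \<pi> i)"
        unfolding E_def mult_smult_assoc_mat[OF Bc[OF i] smult_carrier_mat[OF Bc[OF i]]]
          mult_smult_distrib[OF Bc[OF i] Bc[OF i]] smult_smult_mat ..
      also have "B ! \<pi> i * B ! \<pi> i = (if \<pi> i < v + l then 1 else -1) \<cdot>\<^sub>m 1\<^sub>m ?N"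
        using B \<pi>(1)[OF i] by (simp add: real_gens_def)
      finally show ?thesis using \<pi>(2)[OF i] by (simp add: smult_smult_mat c_def)
    qed
    show "E i * E j = (-1) \<cdot>\<^sub>m (E j * E i)" if i: "i \<in> {1..?n}" and j: "j \<in> {1..?n}" and "i \<noteq> j" for i j
    proof -
      have mult: "E i * E j = (c i * c j) \<cdot>\<^sub>m (B ! \<pi> i * B ! \<pi> j)"
        if i: "i \<in> {1..?n}" and j: "j \<in> {1..?n}" for i j
        unfolding E_def mult_smult_assoc_mat[OF Bc[OF i] smult_carrier_mat[OF Bc[OF j]]]
          mult_smult_distrib[OF Bc[OF i] Bc[OF j]] smult_smult_mat ..
      have "B ! \<pi> i * B ! \<pi> j = (-1) \<cdot>\<^sub>m (B ! \<pi> j * B ! \<pi> i)"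
        using B \<pi>(1)[OF i] \<pi>(1)[OF j] \<pi>_inj[OF i j \<open>i \<noteq> j\<close>] unfolding real_gens_def by metis
      then show ?thesis unfolding mult[OF i j] mult[OF j i] by (simp add: smult_smult_mat mult.commute)
    qed
  qed simp_all
  define \<gamma> where "\<gamma> = gens.rep"
  have rep: "spinor_rep ?p ?q \<gamma>" unfolding \<gamma>_def by (rule gens.spinor_rep_rep)
  have gen: "\<gamma> (gen i) = E i" if "i \<in> {1..?n}" for i
    unfolding \<gamma>_def by (rule gens.rep_gen[OF that])
  have conj: "conj_mat (E i) = (if v < i \<and> i \<le> v + m + l then - E i else E i)" if "i \<in> {1..?n}" for i
  proof -
    have "conj_mat (B ! \<pi> i) = B ! \<pi> i" using B \<pi>(1)[OF that] by (simp add: real_gens_def)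
    then show ?thesis by (simp add: E_def conj_mat_smult c_def uminus_smult_mat smult_smult_mat)
  qed
  have transp: "transpose_mat (E i) = (if i \<le> v \<or> v + m < i \<and> i \<le> v + m + l then E i else - E i)" if "i \<in> {1..?n}" for i
  proof -
    have "transpose_mat (B ! \<pi> i) = (if \<pi> i < v + l then 1 else -1) \<cdot>\<^sub>m (B ! \<pi> i)"
      using B \<pi>(1)[OF that] by (simp add: real_gens_def)
    then show ?thesis
      unfolding \<pi>(2)[OF that] by (simp add: E_def transpose_mat_smult uminus_smult_mat smult_smult_mat one_smult_mat)
  qed
  have sub: "{v<..v + m + l} \<subseteq> complex_idx ?p ?q \<gamma>"
    "{1..v} \<union> {v + m + l<..?n} \<subseteq> real_idx ?p ?q \<gamma>"
    "{1..v} \<union> {v + m<..v + m + l} \<subseteq> sym_idx ?p ?q \<gamma>"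
    "{v<..v + m} \<union> {v + m + l<..?n} \<subseteq> skew_idx ?p ?q \<gamma>"
    unfolding complex_idx_def real_idx_def sym_idx_def skew_idx_def
    by (auto simp: gen conj transp)
  have le: "complex_idx ?p ?q \<gamma> \<subseteq> {1..?n}" "real_idx ?p ?q \<gamma> \<subseteq> {1..?n}"
    "sym_idx ?p ?q \<gamma> \<subseteq> {1..?n}" "skew_idx ?p ?q \<gamma> \<subseteq> {1..?n}"
    unfolding complex_idx_def real_idx_def sym_idx_def skew_idx_def by auto
  have cover: "{1..?n} \<subseteq> ({1..v} \<union> {v + m + l<..?n}) \<union> {v<..v + m + l}"
    "{1..?n} \<subseteq> ({1..v} \<union> {v + m<..v + m + l}) \<union> ({v<..v + m} \<union> {v + m + l<..?n})" by auto
  have spin: "has_spinbasis ?p ?q \<gamma>"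
    unfolding has_spinbasis_def
  proof (intro conjI rep equalityI Un_least le)
    show "{1..?n} \<subseteq> real_idx ?p ?q \<gamma> \<union> complex_idx ?p ?q \<gamma>" using cover(1) sub(1,2) by blast
    show "{1..?n} \<subseteq> sym_idx ?p ?q \<gamma> \<union> skew_idx ?p ?q \<gamma>" using cover(2) sub(3,4) by blast
  qed
  then interpret even_spinbasis ?p ?q \<gamma>
    using gens.even_dim by (rule even_spinbasisI)
  note dis = index_sets_disjoint
  show thesis
  proof (rule that[OF spin])
    show "complex_idx ?p ?q \<gamma> = {v<..v + m + l}" using sub(1,2) dis(1) le(1) cover(1) by blast
    show "real_idx ?p ?q \<gamma> = {1..v} \<union> {v + m + l<..v + m + (l + u)}"
      using sub(1,2) dis(1) le(2) cover(1) by blast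
    show "sym_idx ?p ?q \<gamma> = {1..v} \<union> {v + m<..v + m + l}"
      using sub(3,4) dis(2) le(3) cover(2) by blast
    show "skew_idx ?p ?q \<gamma> = {v<..v + m} \<union> {v + m + l<..v + m + (l + u)}"
      using sub(3,4) dis(2) le(4) cover(2) by blast
  qed
qed

text \<open>A linear map over the two-element field with trivial kernel is injective, so nonempty
  sets are automatically distinct.\<close>

lemma (in even_spinbasis) distinct_ext_sets:
  assumes "{} \<notin> set ext_sets"
  shows "distinct ({} # ext_sets)"
proof -
  define L where "L = [(False, False, False), (False, False, True), (False, True, False), (False, True, True),
     (True, False, False), (True, False, True), (True, True, False), (True, True, True)]"
  let ?f = "\<lambda>(x, y, z). comb P_set E_set W_set x y z"
  have map: "{} # ext_sets = map ?f L"
    unfolding ext_sets_comb by (simp add: L_def comb_def)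
  have empty: "\<not> x \<and> \<not> y \<and> \<not> z" if "comb P_set E_set W_set x y z = {}" for x y z
    using assms that unfolding ext_sets_comb by (cases x; cases y; cases z) simp_all
  have "inj_on ?f (set L)"
  proof (rule inj_onI)
    fix s t assume "?f s = ?f t"
    moreover obtain x y z x' y' z' where st: "s = (x, y, z)" "t = (x', y', z')" by (metis prod_cases3)
    ultimately have "sym_diff (comb P_set E_set W_set x y z) (comb P_set E_set W_set x' y' z') = {}" by simp
    then show "s = t" unfolding sym_diff_comb st using empty[of "x \<noteq> x'" "y \<noteq> y'" "z \<noteq> z'"] by simp
  qed
  moreover have "distinct L" by (simp add: L_def)
  ultimately show ?thesis unfolding map by (simp add: distinct_map)
qed

text \<open>The sign of the square of a product of k spinbasis matrices, r of which have square -1.\<close>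

definition sq_sign :: "nat \<Rightarrow> nat \<Rightarrow> int" where
  "sq_sign k r = sgn_pow (k * (k - 1) div 2 + r)"

lemma mono_sign_sq_sign:
  "finite S \<Longrightarrow> card S = k \<Longrightarrow> card {i \<in> S. p < i} = r \<Longrightarrow> of_int (sq_sign k r) = mono_sign p S S"
  by (simp only: sq_sign_def of_int_sgn_pow mono_sign_self choose_two)

text \<open>The generators of square -1 are the l complex symmetric and the u real skew ones; this
  gives the second arguments of \<open>sq_sign\<close>.\<close>

definition real_sig :: "nat \<Rightarrow> nat \<Rightarrow> nat \<Rightarrow> nat \<Rightarrow> int list" where
  "real_sig m v l u = sig_list (sq_sign (m + v + l + u) (l + u))
     (if even (m + u) then sq_sign (m + u) u else sq_sign (v + l) l)
     (if even (m + l) then sq_sign (m + l) l else sq_sign (v + u) u)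
     (sgn_pow (m + u)) (sgn_pow (m + l)) (sgn_pow (if even (m + u) then m else l))"

text \<open>\<open>P_sign\<close> supplies the quaternionic structure. Each inequality in
  \<open>pos\<close> keeps one two-block union nonempty; these six unions are the index sets of all
  matrices other than W.\<close>

theorem realization:
  assumes even: "even (m + v + l + u)" and sig: "v + l = u + m \<or> v + l = u + m + 2"
    and mod8: "(int (v + m) - int (l + u)) mod 8 \<in> {4, 6}"
    and P_sign: "(if even (m + l) then sq_sign (m + l) l else sq_sign (v + u) u) = -1"
    and pos: "0 < m + l" "0 < v + u" "0 < m + u" "0 < v + l" "0 < l + u" "0 < m + v"
  shows "\<exists>p q \<gamma> X. quaternionic_ext p q \<gamma> X \<and> spin_counts p q \<gamma> = {m, v, l, u} \<and>
    int p - int q = int (v + m) - int (l + u) \<and> distinct_up_to_sign p q X \<and>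
    ext_iso p q X (even m \<and> even v \<and> even l \<and> even u, count_list (real_sig m v l u) 1, count_list (real_sig m v l u) (-1)) \<and>
    has_signature p q X (real_sig m v l u)"
proof -
  let ?p = "v + m" and ?q = "l + u"
  let ?n = "?p + ?q"
  obtain \<gamma> where spin: "has_spinbasis ?p ?q \<gamma>"
    and Cx: "complex_idx ?p ?q \<gamma> = {v<..v + m + l}"
    and Re: "real_idx ?p ?q \<gamma> = {1..v} \<union> {v + m + l<..?n}"
    and Sy: "sym_idx ?p ?q \<gamma> = {1..v} \<union> {v + m<..v + m + l}"
    and Sk: "skew_idx ?p ?q \<gamma> = {v<..v + m} \<union> {v + m + l<..?n}"
    using ex_spinbasis[OF even sig] by metis
  have even': "even (?p + ?q)" using even by (simp add: algebra_simps)
  interpret even_spinbasis ?p ?q \<gamma> using spin even' by (rule even_spinbasisI)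
  have "Cx_idx \<inter> Sk_idx = {v<..v + m}" "Cx_idx \<inter> Sy_idx = {v + m<..v + m + l}"
    "Re_idx \<inter> Sk_idx = {v + m + l<..?n}" "Re_idx \<inter> Sy_idx = {1..v}"
    unfolding Cx Re Sy Sk by auto
  then have counts: "nm = m" "nl = l" "nu = u" "nv = v"
    by (simp_all add: num_m_def num_l_def num_u_def num_v_def)
  have neg: "{i \<in> Cx_idx. ?p < i} = {v + m<..v + m + l}" "{i \<in> Re_idx. ?p < i} = {v + m + l<..?n}"
    "{i \<in> Sk_idx. ?p < i} = {v + m + l<..?n}" "{i \<in> Sy_idx. ?p < i} = {v + m<..v + m + l}"
    "{i \<in> W_set. ?p < i} = {v + m<..?n}"
    unfolding Cx Re Sy Sk W_set_def by auto
  note sq = mono_sign_sq_sign[where p = ?p]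
  have W: "of_int (sq_sign (m + v + l + u) (l + u)) = mono_sign ?p W_set W_set"
    by (rule sq[OF ext_sets_finite(1)]) (simp_all only: neg, simp_all add: W_set_def)
  have cards: "card Cx_idx = m + l" "card Re_idx = v + u" "card Sk_idx = m + u" "card Sy_idx = v + l"
    unfolding card_idx counts by simp_all
  have neg_cards: "card {i \<in> Cx_idx. ?p < i} = l" "card {i \<in> Re_idx. ?p < i} = u"
    "card {i \<in> Sk_idx. ?p < i} = u" "card {i \<in> Sy_idx. ?p < i} = l"
    unfolding neg by simp_all
  have E: "of_int (if even (m + u) then sq_sign (m + u) u else sq_sign (v + l) l) = mono_sign ?p E_set E_set"
    using sq[OF index_sets_finite(4) cards(3) neg_cards(3)] sq[OF index_sets_finite(3) cards(4) neg_cards(4)]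
    unfolding E_set_def cards by presburger
  have P: "of_int (if even (m + l) then sq_sign (m + l) l else sq_sign (v + u) u) = mono_sign ?p P_set P_set"
    using sq[OF index_sets_finite(2) cards(1) neg_cards(1)] sq[OF index_sets_finite(1) cards(2) neg_cards(2)]
    unfolding P_set_def cards by presburger
  have P_neg: "mono_sign ?p P_set P_set = -1" using P P_sign by simp
  have Q: "quaternionic_structure ?p ?q \<gamma> (e P_set)"
  proof
    show "e P_set \<in> carrier_mat N N" using ext_sets_subset(3) by (rule e_carrier)
    have "even (card (P_set \<inter> Cx_idx))"
    proof (cases "even (card Cx_idx)")
      case False
      then have "P_set \<inter> Cx_idx = {}" using index_sets_disjoint(1) by (simp only: P_set_def if_False)
      then show ?thesis by (simp only: card.empty even_zero)
    qed (simp only: P_set_def if_True Int_absorb)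
    then show "conj_mat (e P_set) = e P_set"
      unfolding e_conj[OF ext_sets_subset(3)] by (simp add: one_smult_mat)
    \<comment> \<open>Among the complex generators, m are skew and l have square -1, with m + l even
      when they are used; among the real ones the two properties coincide. Hence \<open>P\<close> is
      transposed with the sign of its square.\<close>
    have "even (card (P_set \<inter> Sk_idx)) \<longleftrightarrow> even (card {i \<in> P_set. ?p < i})"
    proof (cases "even (m + l)")
      case True
      then have "P_set = Cx_idx" by (simp only: P_set_def cards if_True)
      then show ?thesis using True counts(1) neg_cards(1) by (simp add: num_m_def)
    next
      case False
      then have "P_set = Re_idx" by (simp only: P_set_def cards if_False)
      then show ?thesis using counts(3) neg_cards(2) by (simp add: num_u_def)
    qed
    then have "(-1) ^ ((card P_set choose 2) + card (P_set \<inter> Sk_idx)) = mono_sign ?p P_set P_set"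
      unfolding mono_sign_self[OF ext_sets_finite(3)] neg_one_power_eq_iff by simp
    then show "transpose_mat (e P_set) = - e P_set"
      unfolding e_transpose[OF ext_sets_subset(3)] P_neg by (simp add: uminus_smult_mat)
    show "e P_set * e P_set = - 1\<^sub>m N"
      unfolding e_square[OF ext_sets_subset(3)] P_neg by (simp add: uminus_smult_mat)
    show "represents ?p ?q \<gamma> bar conj_mat (e P_set)" by (rule represents_P_set)
  qed
  define X where "X = map e ext_sets"
  have all2: "list_all2 (\<lambda>A S. A =\<^sub>\<plusminus> e S) X ext_sets"
    by (simp add: X_def list_all2_map1 list.rel_refl eq_sign_refl)
  have qX: "quaternionic_ext ?p ?q \<gamma> X"
    unfolding quaternionic_ext_def
  proof (intro conjI)
    show "even (?p + ?q)" by (rule even')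
    show "has_division_ring ?p ?q quaternion_ring"
      by (rule quaternionic_structure.quaternionic_division_ring[OF Q])
    show "(int ?p - int ?q) mod 8 \<in> {4, 6}" by (rule mod8)
    show "has_spinbasis ?p ?q \<gamma>" by (rule spin)
    show "ext_matrices ?p ?q \<gamma> X" unfolding X_def by (rule ext_matrices_ext_sets)
    show "X ! 3 =\<^sub>\<plusminus> spin_prod ?p ?q \<gamma> (if even (card Cx_idx) then Cx_idx else Re_idx)"
      unfolding P_set_def[symmetric] spin_prod_e[OF ext_sets_subset(3)] X_def ext_sets_def
      by (simp add: eq_sign_refl)
    show "X ! 1 =\<^sub>\<plusminus> spin_prod ?p ?q \<gamma> (if even (card Sk_idx) then Sk_idx else Sy_idx)"
      unfolding E_set_def[symmetric] spin_prod_e[OF ext_sets_subset(2)] X_def ext_sets_def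
      by (simp add: eq_sign_refl)
  qed
  have "distinct ({} # ext_sets)"
  proof (rule distinct_ext_sets)
    have ne: "{v<..v + m} \<noteq> {} \<longleftrightarrow> m > 0" "{v + m<..v + m + l} \<noteq> {} \<longleftrightarrow> l > 0"
      "{v + m + l<..?n} \<noteq> {} \<longleftrightarrow> u > 0" "{1..v} \<noteq> {} \<longleftrightarrow> v > 0" by auto
    have Cx': "Cx_idx = {v<..v + m} \<union> {v + m<..v + m + l}" unfolding Cx by auto
    have All: "{1..?n} = {1..v} \<union> {v<..v + m} \<union> {v + m<..v + m + l} \<union> {v + m + l<..?n}" by auto
    have dis: "{1..v} \<inter> {v<..v + m} = {}" "{1..v} \<inter> {v + m<..v + m + l} = {}" "{1..v} \<inter> {v + m + l<..?n} = {}"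
      "{v<..v + m} \<inter> {v + m<..v + m + l} = {}" "{v<..v + m} \<inter> {v + m + l<..?n} = {}"
      "{v + m<..v + m + l} \<inter> {v + m + l<..?n} = {}" by auto
    \<comment> \<open>The seven sets as unions of four disjoint blocks, for abstract sets so that no
      interval arithmetic interferes.\<close>
    have blocks: "W \<noteq> {} \<and> E \<noteq> {} \<and> sym_diff E W \<noteq> {} \<and> P \<noteq> {} \<and> sym_diff P W \<noteq> {} \<and> sym_diff P E \<noteq> {} \<and>
        sym_diff P (sym_diff E W) \<noteq> {}"
      if "W = V \<union> M \<union> L \<union> U" "E = M \<union> U \<or> E = V \<union> L" "P = M \<union> L \<or> P = V \<union> U"
        "V \<inter> M = {}" "V \<inter> L = {}" "V \<inter> U = {}" "M \<inter> L = {}" "M \<inter> U = {}" "L \<inter> U = {}"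
        "M \<union> L \<noteq> {}" "V \<union> U \<noteq> {}" "M \<union> U \<noteq> {}" "V \<union> L \<noteq> {}" "L \<union> U \<noteq> {}" "M \<union> V \<noteq> {}"
      for W E P V M L U :: "nat set"
    proof -
      have sd: "sym_diff (M \<union> U) W = V \<union> L" "sym_diff (V \<union> L) W = M \<union> U"
        "sym_diff (M \<union> L) W = V \<union> U" "sym_diff (V \<union> U) W = M \<union> L"
        "sym_diff (M \<union> L) (M \<union> U) = L \<union> U" "sym_diff (M \<union> L) (V \<union> L) = M \<union> V"
        "sym_diff (V \<union> U) (M \<union> U) = M \<union> V" "sym_diff (V \<union> U) (V \<union> L) = L \<union> U"
        unfolding that(1) set_eq_iff Un_iff Diff_iff using that(4-9) by auto
      have "W \<noteq> {}" using that(1,10) by blast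
      then show ?thesis using that(2,3,10-15) by (elim disjE) (simp_all only: sd simp_thms)
    qed
    have "W_set \<noteq> {} \<and> E_set \<noteq> {} \<and> sym_diff E_set W_set \<noteq> {} \<and> P_set \<noteq> {} \<and> sym_diff P_set W_set \<noteq> {} \<and>
        sym_diff P_set E_set \<noteq> {} \<and> sym_diff P_set (sym_diff E_set W_set) \<noteq> {}"
    proof (rule blocks[OF _ _ _ dis])
      show "W_set = {1..v} \<union> {v<..v + m} \<union> {v + m<..v + m + l} \<union> {v + m + l<..?n}"
        unfolding W_set_def by (rule All)
      show "E_set = {v<..v + m} \<union> {v + m + l<..?n} \<or> E_set = {1..v} \<union> {v + m<..v + m + l}"
        unfolding E_set_def Sk Sy by simp
      show "P_set = {v<..v + m} \<union> {v + m<..v + m + l} \<or> P_set = {1..v} \<union> {v + m + l<..?n}"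
        unfolding P_set_def Cx' Re by simp
    qed (use pos ne in \<open>simp_all only: Un_empty de_Morgan_conj add_gr_0\<close>)
    then show "{} \<notin> set ext_sets" unfolding ext_sets_def set_simps by blast
  qed
  then have "distinct_up_to_sign ?p ?q X"
  proof -
    have Y: "1\<^sub>m N # X = map e ({} # ext_sets)" by (simp add: X_def rep_one)
    have len: "length (map e ({} # ext_sets)) = length ({} # ext_sets)" by simp
    show ?thesis
      unfolding distinct_up_to_sign_def Let_def Y len
    proof (intro allI impI)
      fix i j assume ij: "i < length ({} # ext_sets)" "j < length ({} # ext_sets)" "i \<noteq> j"
      have mem: "({} # ext_sets) ! k \<in> insert {} (set ext_sets)" if "k < length ({} # ext_sets)" for k
        using nth_mem[OF that] by simp
      have "({} # ext_sets) ! i \<noteq> ({} # ext_sets) ! j"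
        using \<open>distinct ({} # ext_sets)\<close> ij nth_eq_iff_index_eq by blast
      then show "\<not> map e ({} # ext_sets) ! i =\<^sub>\<plusminus> map e ({} # ext_sets) ! j"
        unfolding nth_map[OF ij(1)] nth_map[OF ij(2)]
        using e_eq_sign_iff insert_ext_sets_subset[OF mem[OF ij(1)]] insert_ext_sets_subset[OF mem[OF ij(2)]] by blast
    qed
  qed
  moreover have s: "real_sig m v l u = sig_list (sq_sign (m + v + l + u) (l + u))
     (if even (m + u) then sq_sign (m + u) u else sq_sign (v + l) l)
     (if even (m + l) then sq_sign (m + l) l else sq_sign (v + u) u)
     (sgn_pow (m + u)) (sgn_pow (m + l)) (sgn_pow (if even (m + u) then m else l))"
    by (rule real_sig_def)
  note fin = signature_ext_iso[OF all2 W E P comm_signs[unfolded counts] s]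
  have sc: "spin_counts ?p ?q \<gamma> = {m, v, l, u}" by (simp add: spin_counts_def counts)
  have "(sgn_pow (m + u) = 1 \<and> sgn_pow (m + l) = 1 \<and> sgn_pow (if even (m + u) then m else l) = 1) \<longleftrightarrow>
      (even m \<and> even v \<and> even l \<and> even u)"
    using all_even_iff unfolding counts sc by auto
  ultimately show ?thesis using fin qX sc by (intro exI[of _ ?p] exI[of _ ?q] exI[of _ \<gamma>] exI[of _ X]) simp
qed

section \<open>Real division ring\<close>

context even_spinbasis
begin

lemma rep_bar_real:
  assumes "Re_idx = {1..p+q}" "a \<in> carrier (clifford p q)"
  shows "conj_mat (\<gamma> a) = \<gamma> (bar a)"
proof -
  have "Cx_idx = {}" using index_sets_disjoint(1) index_sets_subset(2) assms(1) by blast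
  then show ?thesis using conjunct2[OF rep_conj[OF assms(2)]] by (simp add: bar_def)
qed

text \<open>For a real spinbasis entrywise conjugation already realizes \<open>bar\<close>. Since
  the representation is onto, \<open>P\<close> commutes with every matrix and must be
  scalar.\<close>

lemma real_P_scalar:
  assumes real: "Re_idx = {1..p+q}" and P: "represents p q \<gamma> bar conj_mat P"
  shows "\<exists>c. P = c \<cdot>\<^sub>m 1\<^sub>m N"
proof -
  obtain P' where Pc: "P \<in> carrier_mat N N" "P' \<in> carrier_mat N N" and inv: "P' * P = 1\<^sub>m N"
    and bar: "\<And>a. a \<in> carrier (clifford p q) \<Longrightarrow> \<gamma> (bar a) = P * conj_mat (\<gamma> a) * P'"
    using P unfolding represents_def by blast
  have comm: "M * P = P * M" if M: "M \<in> carrier_mat N N" for M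
  proof -
    obtain a where a: "a \<in> carrier (clifford p q)" "\<gamma> a = M" using rep_surj[OF M] .
    have ba: "bar a \<in> carrier (clifford p q)" using a(1) by (simp add: bar_def clifford_def)
    have "bar (bar a) = a" by (simp add: bar_def)
    then have "M = P * M * P'"
      using bar[OF ba] rep_bar_real[OF real ba] a(2) by simp
    then have "M * P = P * M * P' * P" by simp
    also have "\<dots> = P * M * (P' * P)" using M Pc by (simp add: assoc_mult_mat[of _ N N _ N _ N])
    finally show ?thesis using M Pc inv by simp
  qed
  have "P = P $$ (0, 0) \<cdot>\<^sub>m 1\<^sub>m N"
  proof (rule eq_matI)
    fix i j assume "i < dim_row (P $$ (0, 0) \<cdot>\<^sub>m 1\<^sub>m N)" "j < dim_col (P $$ (0, 0) \<cdot>\<^sub>m 1\<^sub>m N)"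
    then have ij: "i < N" "j < N" by simp_all
    \<comment> \<open>A matrix unit that moves row i to row 0; comparing row 0 of both products
      yields all entries of row i.\<close>
    let ?M = "mat N N (\<lambda>(r, c). if r = 0 \<and> c = i then 1 else 0) :: complex mat"
    have M: "?M \<in> carrier_mat N N" by simp
    have "(?M * P) $$ (0, j) = P $$ (i, j)"
      using ij Pc(1) by (simp add: scalar_prod_def if_distrib[of "\<lambda>x. x * _"] cong: if_cong)
    moreover have "(P * ?M) $$ (0, j) = (if j = i then P $$ (0, 0) else 0)"
      using ij Pc(1) by (simp add: scalar_prod_def if_distrib[of "\<lambda>x. _ * x"] cong: if_cong)
    ultimately show "P $$ (i, j) = (P $$ (0, 0) \<cdot>\<^sub>m 1\<^sub>m N) $$ (i, j)"
      using comm[OF M] ij by auto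
  qed (use Pc in auto)
  then show ?thesis by blast
qed

text \<open>A monomial with a scalar image is the empty one. So \<open>P\<close> is the unit matrix
  up to sign, and K, S, F collapse onto W, E, C.\<close>

lemma real_Ext:
  assumes real: "Re_idx = {1..p+q}" and X: "ext_matrices p q \<gamma> X" and A: "A \<in> Ext p q X"
  shows "\<exists>B\<in>Aut p q X. A =\<^sub>\<plusminus> B"
proof -
  obtain W E C P K S F where X_eq: "X = [W, E, C, P, K, S, F]"
    and rep: "represents p q \<gamma> star (\<lambda>A. A) W" "represents p q \<gamma> tilde transpose_mat E"
      "represents p q \<gamma> (tilde \<circ> star) transpose_mat C" "represents p q \<gamma> bar conj_mat P"
    and prods: "\<forall>A\<in>set X. \<exists>I\<subseteq>{1..p+q}. A =\<^sub>\<plusminus> spin_prod p q \<gamma> I"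
    and rel: "K =\<^sub>\<plusminus> P * W" "S =\<^sub>\<plusminus> P * E" "F =\<^sub>\<plusminus> P * C"
    using X unfolding ext_matrices_def by blast
  have carriers: "W \<in> carrier_mat N N" "E \<in> carrier_mat N N" "C \<in> carrier_mat N N"
    using rep(1-3) unfolding represents_def by blast+
  obtain c where c: "P = c \<cdot>\<^sub>m 1\<^sub>m N" using real_P_scalar[OF real rep(4)] by blast
  obtain I where I: "I \<subseteq> {1..p+q}" "P =\<^sub>\<plusminus> e I"
    using prods unfolding X_eq by (auto simp: spin_prod_e)
  have "\<exists>c'. e I = c' \<cdot>\<^sub>m e {}"
    using I(2) c unfolding eq_sign_def rep_one
    by (metis smult_smult_mat uminus_smult_mat uminus_uminus_mat)
  then have "I = {}" using e_eq_smultD[OF I(1)] by blast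
  then have P: "P =\<^sub>\<plusminus> 1\<^sub>m N" using I(2) rep_one by simp
  have PA: "B =\<^sub>\<plusminus> A" if "A \<in> carrier_mat N N" "B =\<^sub>\<plusminus> P * A" for A B
    using P that unfolding eq_sign_def uminus_smult_mat[of "1\<^sub>m N"]
    by (auto simp: mult_smult_assoc_mat[of _ N N _ N] uminus_smult_mat smult_smult_mat one_smult_mat)
  have "K =\<^sub>\<plusminus> W" "S =\<^sub>\<plusminus> E" "F =\<^sub>\<plusminus> C"
    using PA carriers rel by blast+
  then show ?thesis
    using A P eq_sign_refl unfolding Ext_def Aut_def X_eq by auto
qed

end

section \<open>The realized families\<close>

definition abelian_realized :: "int \<times> order_structure \<times> int list set \<Rightarrow> bool" where
  "abelian_realized = (\<lambda>(t, \<tau>, \<Sigma>). (\<exists>s\<in>\<Sigma>. s ! 3 = -1) \<longrightarrow>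
        (\<exists>p q \<gamma> X.
           quaternionic_ext p q \<gamma> X \<and> (\<forall>x\<in>spin_counts p q \<gamma>. even x) \<and>
           (int p - int q) mod 8 = t \<and> distinct_up_to_sign p q X \<and>
           ext_iso p q X \<tau> \<and> (\<exists>s\<in>\<Sigma>. has_signature p q X s)))"

definition nonabelian_realized :: "int \<times> order_structure \<times> int list set \<Rightarrow> bool" where
  "nonabelian_realized = (\<lambda>(t, \<tau>, \<Sigma>). (\<exists>s\<in>\<Sigma>. s ! 3 = -1) \<longrightarrow>
        (\<exists>p q \<gamma> X.
           quaternionic_ext p q \<gamma> X \<and>
           ((\<forall>x\<in>spin_counts p q \<gamma>. odd x) \<or>
            (\<exists>x\<in>spin_counts p q \<gamma>. even x) \<and> (\<exists>x\<in>spin_counts p q \<gamma>. odd x)) \<and>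
           (int p - int q) mod 8 = t \<and> distinct_up_to_sign p q X \<and>
           ext_iso p q X \<tau> \<and> (\<exists>s\<in>\<Sigma>. has_signature p q X s)))"

text \<open>The numbers m, v, l, u are those of \<^const>\<open>num_m\<close>, \<^const>\<open>num_v\<close>, \<^const>\<open>num_l\<close> and
  \<^const>\<open>num_u\<close>.\<close>

definition realizes :: "nat \<Rightarrow> nat \<Rightarrow> nat \<Rightarrow> nat \<Rightarrow> int \<Rightarrow> nat \<Rightarrow> nat \<Rightarrow> int list set \<Rightarrow> bool" where
  "realizes m v l u t x y \<Sigma> \<longleftrightarrow>
     even (m + v + l + u) \<and> (v + l = u + m \<or> v + l = u + m + 2) \<and>
     (int (v + m) - int (l + u)) mod 8 = t \<and> t \<in> {4, 6} \<and>
     (if even (m + l) then sq_sign (m + l) l else sq_sign (v + u) u) = -1 \<and>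
     0 < m + l \<and> 0 < v + u \<and> 0 < m + u \<and> 0 < v + l \<and> 0 < l + u \<and> 0 < m + v \<and>
     count_list (real_sig m v l u) 1 = x \<and> count_list (real_sig m v l u) (-1) = y \<and>
     real_sig m v l u \<in> \<Sigma>"

lemma realizes_realization:
  assumes "realizes m v l u t x y \<Sigma>"
  shows "\<exists>p q \<gamma> X. quaternionic_ext p q \<gamma> X \<and> spin_counts p q \<gamma> = {m, v, l, u} \<and>
    (int p - int q) mod 8 = t \<and> distinct_up_to_sign p q X \<and>
    ext_iso p q X (even m \<and> even v \<and> even l \<and> even u, x, y) \<and> (\<exists>s\<in>\<Sigma>. has_signature p q X s)"
proof -
  note r = assms[unfolded realizes_def]
  have prems: "even (m + v + l + u)" "v + l = u + m \<or> v + l = u + m + 2"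
    "(int (v + m) - int (l + u)) mod 8 \<in> {4, 6}"
    "(if even (m + l) then sq_sign (m + l) l else sq_sign (v + u) u) = -1"
    "0 < m + l" "0 < v + u" "0 < m + u" "0 < v + l" "0 < l + u" "0 < m + v"
    using r by blast+
  obtain p q \<gamma> X where "quaternionic_ext p q \<gamma> X" "spin_counts p q \<gamma> = {m, v, l, u}"
    "int p - int q = int (v + m) - int (l + u)" "distinct_up_to_sign p q X"
    "ext_iso p q X (even m \<and> even v \<and> even l \<and> even u, count_list (real_sig m v l u) 1, count_list (real_sig m v l u) (-1))"
    "has_signature p q X (real_sig m v l u)"
    using realization[OF prems] by blast
  moreover have "(int p - int q) mod 8 = t" using calculation(3) r by simp
  moreover have xy: "count_list (real_sig m v l u) 1 = x" "count_list (real_sig m v l u) (-1) = y"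
    "real_sig m v l u \<in> \<Sigma>"
    using r by blast+
  ultimately show ?thesis unfolding xy(1,2) by blast
qed

lemma abelian_realizedI:
  assumes r: "realizes m v l u t x y \<Sigma>" and even: "even m" "even v" "even l" "even u"
  shows "abelian_realized (t, (True, x, y), \<Sigma>)"
proof -
  have "(even m \<and> even v \<and> even l \<and> even u) = True" using even by simp
  note * = realizes_realization[OF r, unfolded this]
  have "\<forall>x\<in>{m, v, l, u}. even x" using even by simp
  with * show ?thesis unfolding abelian_realized_def prod.case by (metis (no_types, lifting))
qed

lemma nonabelian_realizedI:
  assumes r: "realizes m v l u t x y \<Sigma>"
    and odd: "\<not> (even m \<and> even v \<and> even l \<and> even u)"
  shows "nonabelian_realized (t, (False, x, y), \<Sigma>)"
proof -
  have "(even m \<and> even v \<and> even l \<and> even u) = False" using odd by simp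
  note * = realizes_realization[OF r, unfolded this]
  have "(\<forall>x\<in>{m, v, l, u}. odd x) \<or> (\<exists>x\<in>{m, v, l, u}. even x) \<and> (\<exists>x\<in>{m, v, l, u}. odd x)"
    using odd by auto
  with * show ?thesis unfolding nonabelian_realized_def prod.case by (metis (no_types, lifting))
qed

lemmas realizes_simps = realizes_def real_sig_def sig_list_def sq_sign_def sgn_pow_def sig_with_iff

lemma abelian_realized: "\<forall>F\<in>abelian_families. abelian_realized F"
proof -
  \<comment> \<open>The only signature here has a plus for \<open>P\<close>, so the premise of the
    existence claim fails.\<close>
  have "abelian_realized (4, (True, 7, 0), {[1, 1, 1, 1, 1, 1, 1]})"
    by (simp add: abelian_realized_def)
  \<comment> \<open>The first four arguments are m, v, l, u. With m = 0 and l = 2 the square of P is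
    -1, and p - q is -4 or -2 according to whether v + l exceeds u + m by 0 or 2; u modulo 4 then
    selects the square of E. The algebras have (p, q) = (2, 6), (4, 8), (4, 6), (2, 4).\<close>
  moreover have "realizes 0 2 2 4 4 3 4 {[1, 1, 1, -1, -1, -1, -1]}"
    "realizes 0 4 2 6 4 3 4 (sig_with [1, -1, -1] 2)"
    "realizes 0 4 2 4 6 3 4 (sig_with [-1, 1, -1] 2)"
    "realizes 0 2 2 2 6 3 4 (sig_with [-1, -1, 1] 2)"
    by (simp_all add: realizes_simps)
  note this[THEN abelian_realizedI, simplified]
  ultimately show ?thesis unfolding abelian_families_def group_types by simp
qed

lemma nonabelian_realized: "\<forall>F\<in>nonabelian_families. nonabelian_realized F"
proof -
  \<comment> \<open>All members of these two families have a plus for \<open>P\<close>, which makes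
    the existence claim vacuous.\<close>
  have "nonabelian_realized (4, (False, 5, 2), {[1, -1, -1, 1, 1, 1, 1]})"
    "nonabelian_realized (6, (False, 5, 2), {[1, -1, -1, 1, 1, 1, 1], [-1, 1, -1, 1, 1, 1, 1], [-1, -1, 1, 1, 1, 1, 1]})"
    by (simp_all add: nonabelian_realized_def)
  \<comment> \<open>Modulo 4, m - l is -2 or -1 if v + l = u + m, and -3 or -2 if it exceeds u + m
    by 2; in both cases the first value gives residue 4 and the second residue 6. The parities of m,
    l, u select the commutation signs.\<close>
  moreover have "realizes 1 1 2 2 6 1 6 (sig_with [-1, -1, -1] 1)"
    "realizes 1 3 4 4 4 5 2 (sig_with [1, -1, 1] 3)"
    "realizes 0 4 3 5 4 5 2 (sig_with [1, 1, -1] 3)"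
    "realizes 1 0 7 4 6 5 2 (sig_with [-1, 1, 1] 3)"
    "realizes 1 1 3 3 4 1 6 {[1, -1, -1, -1, -1, -1, -1]}"
    "realizes 0 3 1 4 6 1 6 {[-1, 1, -1, -1, -1, -1, -1]}"
    "realizes 1 2 2 3 6 1 6 {[-1, -1, 1, -1, -1, -1, -1]}"
    "realizes 1 0 4 1 4 5 2 (sig_with [1, 1, 1] 2)"
    "realizes 0 1 3 2 4 3 4 (sig_with [1, -1, -1] 2)"
    "realizes 1 0 2 1 6 3 4 (sig_with [-1, 1, -1] 2)"
    "realizes 0 1 1 2 6 3 4 (sig_with [-1, -1, 1] 2)"
    "realizes 0 1 2 3 4 3 4 (sig_with [1, -1, 1] 1)"
    "realizes 1 0 3 2 4 3 4 (sig_with [1, 1, -1] 1)"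
    "realizes 0 2 1 3 6 3 4 (sig_with [-1, 1, 1] 1)"
    "realizes 0 1 2 1 6 3 4 (sig_with [-1, -1, -1] 3)"
    by (simp_all add: realizes_simps)
  note this[THEN nonabelian_realizedI, simplified]
  ultimately show ?thesis unfolding nonabelian_families_def group_types D4_family by simp
qed

theorem theorem6:
  shows
    "(\<forall>p q \<gamma>.
        even (p + q) \<and> has_division_ring p q real_ring \<and> (int p - int q) mod 8 \<in> {0, 2} \<and>
        has_spinbasis p q \<gamma> \<and> real_idx p q \<gamma> = {1..p+q} \<longrightarrow>
          (\<forall>P. represents p q \<gamma> bar conj_mat P \<longrightarrow> (\<exists>c. P = c \<cdot>\<^sub>m 1\<^sub>m (spin_dim p q))) \<and>
          (\<forall>X. ext_matrices p q \<gamma> X \<longrightarrow> (\<forall>A\<in>Ext p q X. \<exists>B\<in>Aut p q X. A =\<^sub>\<plusminus> B))) \<and>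
     (\<forall>p q \<gamma> X.
        quaternionic_ext p q \<gamma> X \<and> (\<forall>x\<in>spin_counts p q \<gamma>. even x) \<longrightarrow>
          (\<exists>(t, \<tau>, \<Sigma>)\<in>abelian_families.
             (int p - int q) mod 8 = t \<and> ext_iso p q X \<tau> \<and> (\<exists>s\<in>\<Sigma>. has_signature p q X s))) \<and>
     (\<forall>p q \<gamma> X.
        quaternionic_ext p q \<gamma> X \<and>
        ((\<forall>x\<in>spin_counts p q \<gamma>. odd x) \<or>
         (\<exists>x\<in>spin_counts p q \<gamma>. even x) \<and> (\<exists>x\<in>spin_counts p q \<gamma>. odd x)) \<longrightarrow>
          (\<exists>(t, \<tau>, \<Sigma>)\<in>nonabelian_families.
             (int p - int q) mod 8 = t \<and> ext_iso p q X \<tau> \<and> (\<exists>s\<in>\<Sigma>. has_signature p q X s))) \<and>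
     (\<forall>(t, \<tau>, \<Sigma>)\<in>abelian_families. (\<exists>s\<in>\<Sigma>. s ! 3 = -1) \<longrightarrow>
        (\<exists>p q \<gamma> X.
           quaternionic_ext p q \<gamma> X \<and> (\<forall>x\<in>spin_counts p q \<gamma>. even x) \<and>
           (int p - int q) mod 8 = t \<and> distinct_up_to_sign p q X \<and>
           ext_iso p q X \<tau> \<and> (\<exists>s\<in>\<Sigma>. has_signature p q X s))) \<and>
     (\<forall>(t, \<tau>, \<Sigma>)\<in>nonabelian_families. (\<exists>s\<in>\<Sigma>. s ! 3 = -1) \<longrightarrow>
        (\<exists>p q \<gamma> X.
           quaternionic_ext p q \<gamma> X \<and>
           ((\<forall>x\<in>spin_counts p q \<gamma>. odd x) \<or>
            (\<exists>x\<in>spin_counts p q \<gamma>. even x) \<and> (\<exists>x\<in>spin_counts p q \<gamma>. odd x)) \<and>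
           (int p - int q) mod 8 = t \<and> distinct_up_to_sign p q X \<and>
           ext_iso p q X \<tau> \<and> (\<exists>s\<in>\<Sigma>. has_signature p q X s))) \<and>
     all_signatures = \<Union> ((\<lambda>(t, \<tau>, \<Sigma>). \<Sigma>) ` (abelian_families \<union> nonabelian_families)) \<and>
     card all_signatures = 64"
proof (intro conjI)
  show "\<forall>p q \<gamma>.
        even (p + q) \<and> has_division_ring p q real_ring \<and> (int p - int q) mod 8 \<in> {0, 2} \<and>
        has_spinbasis p q \<gamma> \<and> real_idx p q \<gamma> = {1..p+q} \<longrightarrow>
          (\<forall>P. represents p q \<gamma> bar conj_mat P \<longrightarrow> (\<exists>c. P = c \<cdot>\<^sub>m 1\<^sub>m (spin_dim p q))) \<and>
          (\<forall>X. ext_matrices p q \<gamma> X \<longrightarrow> (\<forall>A\<in>Ext p q X. \<exists>B\<in>Aut p q X. A =\<^sub>\<plusminus> B))"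
    using even_spinbasis.real_P_scalar even_spinbasis.real_Ext even_spinbasisI by blast
  show "\<forall>p q \<gamma> X.
        quaternionic_ext p q \<gamma> X \<and> (\<forall>x\<in>spin_counts p q \<gamma>. even x) \<longrightarrow>
          (\<exists>(t, \<tau>, \<Sigma>)\<in>abelian_families.
             (int p - int q) mod 8 = t \<and> ext_iso p q X \<tau> \<and> (\<exists>s\<in>\<Sigma>. has_signature p q X s))"
    by (intro allI impI) (elim conjE, rule quaternionic_ext_family(1))
  show "\<forall>p q \<gamma> X.
        quaternionic_ext p q \<gamma> X \<and>
        ((\<forall>x\<in>spin_counts p q \<gamma>. odd x) \<or>
         (\<exists>x\<in>spin_counts p q \<gamma>. even x) \<and> (\<exists>x\<in>spin_counts p q \<gamma>. odd x)) \<longrightarrow>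
          (\<exists>(t, \<tau>, \<Sigma>)\<in>nonabelian_families.
             (int p - int q) mod 8 = t \<and> ext_iso p q X \<tau> \<and> (\<exists>s\<in>\<Sigma>. has_signature p q X s))"
  proof (intro allI impI, elim conjE)
    fix p q \<gamma> X
    assume X: "quaternionic_ext p q \<gamma> X"
      and odd: "(\<forall>x\<in>spin_counts p q \<gamma>. odd x) \<or>
         (\<exists>x\<in>spin_counts p q \<gamma>. even x) \<and> (\<exists>x\<in>spin_counts p q \<gamma>. odd x)"
    \<comment> \<open>Rules out that all counts are odd and even at once.\<close>
    have "spin_counts p q \<gamma> \<noteq> {}" by (simp add: spin_counts_def)
    then have "\<not> (\<forall>x\<in>spin_counts p q \<gamma>. even x)" using odd by blast
    then show "\<exists>(t, \<tau>, \<Sigma>)\<in>nonabelian_families.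
             (int p - int q) mod 8 = t \<and> ext_iso p q X \<tau> \<and> (\<exists>s\<in>\<Sigma>. has_signature p q X s)"
      by (rule quaternionic_ext_family(2)[OF X])
  qed
  show "\<forall>(t, \<tau>, \<Sigma>)\<in>abelian_families. (\<exists>s\<in>\<Sigma>. s ! 3 = -1) \<longrightarrow>
        (\<exists>p q \<gamma> X.
           quaternionic_ext p q \<gamma> X \<and> (\<forall>x\<in>spin_counts p q \<gamma>. even x) \<and>
           (int p - int q) mod 8 = t \<and> distinct_up_to_sign p q X \<and>
           ext_iso p q X \<tau> \<and> (\<exists>s\<in>\<Sigma>. has_signature p q X s))"
    using abelian_realized by (simp only: abelian_realized_def)
  show "\<forall>(t, \<tau>, \<Sigma>)\<in>nonabelian_families. (\<exists>s\<in>\<Sigma>. s ! 3 = -1) \<longrightarrow>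
        (\<exists>p q \<gamma> X.
           quaternionic_ext p q \<gamma> X \<and>
           ((\<forall>x\<in>spin_counts p q \<gamma>. odd x) \<or>
            (\<exists>x\<in>spin_counts p q \<gamma>. even x) \<and> (\<exists>x\<in>spin_counts p q \<gamma>. odd x)) \<and>
           (int p - int q) mod 8 = t \<and> distinct_up_to_sign p q X \<and>
           ext_iso p q X \<tau> \<and> (\<exists>s\<in>\<Sigma>. has_signature p q X s))"
    using nonabelian_realized by (simp only: nonabelian_realized_def)
qed (rule all_signatures_families card_all_signatures)+

end
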